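(* Assume that $G(-\mathbf{v})=-G(\mathbf{v})$ for all $\mathbf{v}\in(L^s(\Omega))^2$. Let $\psi_h\in\mathcal{N}_h+\tilde g$ be a solution of the nonconforming problem (N) stated in the context. Define $\mathbf{u}_h\in W_h$ by $\mathbf{u}_h:=-\widetilde P_{W_h}G^{-1}(\nabla\psi_h)$ (elementwise gradient) and $(p_h,\mu_h)\in Q_h\times\Lambda_h^g$ by $(p_h,\mu_h):=\widetilde{\mathcal{S}}_h^{\tilde g}(\psi_h)$. Then $(\mathbf{u}_h,p_h,\mu_h)$ is a solution of the hybridized mixed problem (H) stated in the context.
   Context: Setting. $\Omega\subset\mathbb{R}^2$ is a bounded domain with polygonal boundary, $r,s\in(1,\infty)$, $1/r+1/r'=1$, $1/s+1/s'=1$. $R:L^r(\Omega)\to L^{r'}(\Omega)$ is continuous; $G:(L^s(\Omega))^2\to(L^{s'}(\Omega))^2$ is continuous, coercive and strictly monotone (so $G$ is bijective by the Browder–Minty theorem). $f$ is a linear form on $L^r(\Omega)$, and $g\in L^1(\partial\Omega)$. Put $a(\mathbf{u},\mathbf{v})=\int_\Omega G(\mathbf{u})\cdot\mathbf{v}\,d\mathbf{x}$ and $c(p,q)=\int_\Omega R(p)\,q\,d\mathbf{x}$. Mesh. $\mathcal{T}_h$ is a (conforming) triangulation of $\Omega$ into triangles $K$, with set of edges $\mathcal{E}_h$, interior edges $\mathcal{E}_h^i$, boundary edges $\mathcal{E}_h^b$, $E_h=\bigcup_{e\in\mathcal{E}_h}e$, and $\mathbf{n}_K$ the exterior unit normal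 of $K$. $P_k(K)$ denotes polynomials of degree $\le k$ on $K$, and $RT_0(K)=(P_0(K))^2+\binom{x}{y}P_0(K)$. Spaces. $W_h=\{\mathbf{v}_h\in(L^s(\Omega))^2: \mathbf{v}_h|_K\in RT_0(K)\ \forall K\in\mathcal{T}_h\}$; $Q_h=\{q_h\in L^r(\Omega): q_h|_K\in P_0(K)\ \forall K\}$; $\Lambda_h=\{\lambda_h\in L^2(E_h):\lambda_h|_e\in P_0(e)\ \forall e\in\mathcal{E}_h\}$; for $\gamma\in L^1(\partial\Omega)$, $\Lambda_h^{\gamma}=\{\lambda_h\in\Lambda_h:\int_e(\lambda_h-\gamma)\,d\sigma=0\ \forall e\in\mathcal{E}_h^b\}$ (used with $\gamma=g$ and $\gamma=0$). Hybridized mixed problem (H): find $(\mathbf{u}_h,p_h,\mu_h)\in W_h\times Q_h\times\Lambda_h^g$ such that $$a(\mathbf{u}_h,\mathbf{v}_h)-\sum_K\int_K \mathrm{div}\,\mathbf{v}_h\,p_h\,d\mathbf{x}+\sum_K\int_{\partial K}\mu_h(\mathbf{v}_h\cdot\mathbf{n}_K)\,d\sigma=0\quad\forall\mathbf{v}_h\in W_h,$$ $$c(p_h,q_h)+\sum_K\int_K \mathrm{div}\,\mathbf{u}_h\,q_h\,d\mathbf{x}=f(q_h)\quad\forall q_h\in Q_h,$$ $$\sum_K\int_{\partial K}\lambda_h(\mathbf{u}_h\cdot\mathbf{n}_K)\,d\sigma=0\quad\forall\lambda_h\in\Lambda_h^0.$$ Nonconforming space. $\mathcal{N}_h=CR_1^0(\mathcal{T}_h)\oplus\mathcal{B}^3(\mathcal{T}_h)$,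 where $CR_1^0(\mathcal{T}_h)$ is the set of $\xi_h\in L^2(\Omega)$ with $\xi_h|_K\in P_1(K)$ for all $K$, $\xi_h$ continuous at the midpoint of each interior edge, and $\int_e\xi_h\,d\sigma=0$ for all $e\in\mathcal{E}_h^b$; and $\mathcal{B}^3(\mathcal{T}_h)=\{\xi_h\in L^2(\Omega):\xi_h|_K\in P_3(K),\ \xi_h|_{\partial K}=0\ \forall K\}$. For $\xi_h\in\mathcal{N}_h$ and $e\in\mathcal{E}_h^i$ the integral $\int_e\xi_h\,d\sigma$ does not depend on the side from which the trace is taken. Boundary extension. $\tilde g\in W^{1,s'}(\Omega)$ is a fixed function with $\int_e\tilde g\,d\sigma=\int_e g\,d\sigma$ for all $e\in\mathcal{E}_h^b$. Projections. $P_{Q_h}\varphi$ is the piecewise constant function whose value on $K$ is the mean of $\varphi$ over $K$. $P_{\Lambda_h}\varphi$ is the function whose value on each $e\in\mathcal{E}_h$ is the mean of $\varphi$ over $e$. The map $\widetilde{\mathcal{S}}_h^{\tilde g}:\mathcal{N}_h+\tilde g\to Q_h\times\Lambda_h^g$, $\psi_h\mapsto(P_{Q_h}\psi_h,P_{\Lambda_h}\psi_h)$, is a bijection. For $\mathbf{u}\in(L^s(\Omega))^2$, $\widetilde P_{W_h}\mathbf{u}\in W_h$ is the unique element with $a(\widetilde P_{W_h}\mathbf{u},\mathbf{v}_h)=a(\mathbf{u},\mathbf{v}_h)$ for all $\mathbf{v}_h\in W_h$. Nonconforming problem (N): find $\psi_h\in\mathcal{N}_h+\tilde g$ such that for all $\xi_h\in\mathcal{N}_h$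 $$c(P_{Q_h}\psi_h,P_{Q_h}\xi_h)+\sum_{K\in\mathcal{T}_h}\int_K\widetilde P_{W_h}G^{-1}(\nabla\psi_h)\cdot\nabla\xi_h\,d\mathbf{x}=f(P_{Q_h}\xi_h),$$ with gradients taken elementwise. *)

theory Defs
  imports "HOL-Analysis.Analysis"
begin

type_synonym pt = "real^2"

section \<open>Lebesgue spaces and operators on them\<close>

text \<open>Elements of Lebesgue spaces are represented by functions; equality in the space is equality
  almost everywhere. For \<open>\<Omega>\<close> in the plane the measure is \<^term>\<open>lebesgue_on \<Omega>\<close>.\<close>

definition Lp :: "'a measure \<Rightarrow> real \<Rightarrow> ('a \<Rightarrow> 'b::euclidean_space) set" where
  "Lp M p = {u \<in> borel_measurable M. integrable M (\<lambda>x. norm (u x) powr p)}"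

definition Lp_norm :: "'a measure \<Rightarrow> real \<Rightarrow> ('a \<Rightarrow> 'b::euclidean_space) \<Rightarrow> real" where
  "Lp_norm M p u = (LINT x|M. norm (u x) powr p) powr (1 / p)"

text \<open>Since \<open>Lp_norm\<close> only sees almost-everywhere classes, the following continuity also says that
  the operator respects equality almost everywhere (no linearity is required).\<close>

definition Lp_continuous ::
  "'a measure \<Rightarrow> real \<Rightarrow> real \<Rightarrow> (('a \<Rightarrow> 'b::euclidean_space) \<Rightarrow> ('a \<Rightarrow> 'b)) \<Rightarrow> bool" where
  "Lp_continuous M p q T \<longleftrightarrow>
     (\<forall>u \<in> Lp M p. T u \<in> Lp M q) \<and>
     (\<forall>u \<in> Lp M p. \<forall>\<epsilon>>0. \<exists>\<delta>>0. \<forall>v \<in> Lp M p.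
        Lp_norm M p (\<lambda>x. v x - u x) < \<delta> \<longrightarrow> Lp_norm M q (\<lambda>x. T v x - T u x) < \<epsilon>)"

definition Lp_coercive ::
  "'a measure \<Rightarrow> real \<Rightarrow> (('a \<Rightarrow> 'b::euclidean_space) \<Rightarrow> ('a \<Rightarrow> 'b)) \<Rightarrow> bool" where
  "Lp_coercive M p T \<longleftrightarrow>
     (\<forall>C. \<exists>\<rho>. \<forall>u \<in> Lp M p. Lp_norm M p u \<ge> \<rho> \<longrightarrow> (LINT x|M. T u x \<bullet> u x) \<ge> C * Lp_norm M p u)"

definition Lp_strictly_monotone ::
  "'a measure \<Rightarrow> real \<Rightarrow> (('a \<Rightarrow> 'b::euclidean_space) \<Rightarrow> ('a \<Rightarrow> 'b)) \<Rightarrow> bool" where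
  "Lp_strictly_monotone M p T \<longleftrightarrow>
     (\<forall>u \<in> Lp M p. \<forall>v \<in> Lp M p. \<not> (AE x in M. u x = v x) \<longrightarrow>
        (LINT x|M. (T u x - T v x) \<bullet> (u x - v x)) > 0)"

definition Lp_bijective ::
  "'a measure \<Rightarrow> real \<Rightarrow> real \<Rightarrow> (('a \<Rightarrow> 'b::euclidean_space) \<Rightarrow> ('a \<Rightarrow> 'b)) \<Rightarrow> bool" where
  "Lp_bijective M p q T \<longleftrightarrow>
     (\<forall>w \<in> Lp M q. \<exists>u \<in> Lp M p. AE x in M. T u x = w x) \<and>
     (\<forall>u \<in> Lp M p. \<forall>v \<in> Lp M p. (AE x in M. T u x = T v x) \<longrightarrow> (AE x in M. u x = v x))"

definition Lp_inverse ::
  "'a measure \<Rightarrow> real \<Rightarrow> (('a \<Rightarrow> 'b::euclidean_space) \<Rightarrow> ('a \<Rightarrow> 'b)) \<Rightarrow> ('a \<Rightarrow> 'b) \<Rightarrow> ('a \<Rightarrow> 'b)" where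
  "Lp_inverse M p T w = (SOME u. u \<in> Lp M p \<and> (AE x in M. T u x = w x))"

definition Lp_linear_form :: "'a measure \<Rightarrow> real \<Rightarrow> (('a \<Rightarrow> real) \<Rightarrow> real) \<Rightarrow> bool" where
  "Lp_linear_form M p f \<longleftrightarrow>
     (\<forall>u \<in> Lp M p. \<forall>v \<in> Lp M p. \<forall>a b. f (\<lambda>x. a * u x + b * v x) = a * f u + b * f v) \<and>
     (\<forall>u \<in> Lp M p. \<forall>v \<in> Lp M p. (AE x in M. u x = v x) \<longrightarrow> f u = f v)"

section \<open>Domain and mesh\<close>

text \<open>The condition \<open>\<Omega> = interior (closure \<Omega>)\<close> says that \<open>\<Omega>\<close> has no slits and no punctures, i.e. it
  does not lie on both sides of a piece of its boundary.\<close>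

definition polygonal_domain :: "pt set \<Rightarrow> bool" where
  "polygonal_domain \<Omega> \<longleftrightarrow>
     open \<Omega> \<and> connected \<Omega> \<and> bounded \<Omega> \<and> \<Omega> \<noteq> {} \<and> \<Omega> = interior (closure \<Omega>) \<and>
     (\<exists>S. finite S \<and> frontier \<Omega> = (\<Union>(a, b)\<in>S. closed_segment a b))"

definition conforming_mesh :: "pt set \<Rightarrow> pt set set \<Rightarrow> bool" where
  "conforming_mesh \<Omega> \<T> \<longleftrightarrow> triangulation \<T> \<and> (\<forall>K\<in>\<T>. 2 simplex K) \<and> \<Union>\<T> = closure \<Omega>"

definition edges :: "pt set set \<Rightarrow> pt set set" where
  "edges \<T> = {e. \<exists>K\<in>\<T>. e edge_of K}"

definition bdry_edges :: "pt set \<Rightarrow> pt set set \<Rightarrow> pt set set" where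
  "bdry_edges \<Omega> \<T> = {e \<in> edges \<T>. e \<subseteq> frontier \<Omega>}"

definition int_edges :: "pt set \<Rightarrow> pt set set \<Rightarrow> pt set set" where
  "int_edges \<Omega> \<T> = edges \<T> - bdry_edges \<Omega> \<T>"

definition outer_normal :: "pt set \<Rightarrow> pt set \<Rightarrow> pt" where
  "outer_normal K e = (THE n. norm n = 1 \<and> (\<forall>x\<in>e. \<forall>y\<in>e. n \<bullet> (y - x) = 0) \<and>
                                 (\<forall>x\<in>e. \<forall>y\<in>K. n \<bullet> (y - x) \<le> 0))"

section \<open>Integration along edges\<close>

text \<open>Arc length on an edge \<open>e\<close> is transported from \<open>{0..1}\<close> by an affine parametrization. The
  order in which the end points are chosen does not affect any notion below.\<close>

definition edge_ends :: "pt set \<Rightarrow> pt \<times> pt" where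
  "edge_ends e = (SOME ab. e = closed_segment (fst ab) (snd ab))"

definition edge_path :: "pt set \<Rightarrow> real \<Rightarrow> pt" where
  "edge_path e = linepath (fst (edge_ends e)) (snd (edge_ends e))"

definition edge_mid :: "pt set \<Rightarrow> pt" where
  "edge_mid e = midpoint (fst (edge_ends e)) (snd (edge_ends e))"

definition edge_length :: "pt set \<Rightarrow> real" where
  "edge_length e = dist (fst (edge_ends e)) (snd (edge_ends e))"

definition edge_integrable :: "pt set \<Rightarrow> (pt \<Rightarrow> real) \<Rightarrow> bool" where
  "edge_integrable e \<phi> \<longleftrightarrow> integrable (lebesgue_on {0..1}) (\<lambda>t. \<phi> (edge_path e t))"

definition edge_integral :: "pt set \<Rightarrow> (pt \<Rightarrow> real) \<Rightarrow> real" where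
  "edge_integral e \<phi> = edge_length e * (LINT t|lebesgue_on {0..1}. \<phi> (edge_path e t))"

section \<open>Weak gradients, Sobolev spaces and traces\<close>

definition C1_with_gradient :: "(pt \<Rightarrow> real) \<Rightarrow> (pt \<Rightarrow> pt) \<Rightarrow> bool" where
  "C1_with_gradient \<phi> D \<longleftrightarrow> (\<forall>x. GDERIV \<phi> x :> D x) \<and> continuous_on UNIV D"

text \<open>As in Gilbarg--Trudinger, test functions for first weak derivatives are the compactly supported
  functions of class \<open>C\<^sup>1\<close>.\<close>

definition weak_gradient :: "pt set \<Rightarrow> (pt \<Rightarrow> real) \<Rightarrow> (pt \<Rightarrow> pt) \<Rightarrow> bool" where
  "weak_gradient U u D \<longleftrightarrow>
     (\<forall>C. compact C \<and> C \<subseteq> U \<longrightarrow> integrable (lebesgue_on C) u \<and> integrable (lebesgue_on C) D) \<and>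
     (\<forall>\<eta> \<eta>'. C1_with_gradient \<eta> \<eta>' \<and> compact (closure {x. \<eta> x \<noteq> 0}) \<and> closure {x. \<eta> x \<noteq> 0} \<subseteq> U \<longrightarrow>
        (LINT x|lebesgue_on U. u x *\<^sub>R \<eta>' x) = - (LINT x|lebesgue_on U. \<eta> x *\<^sub>R D x))"

definition wgrad :: "pt set \<Rightarrow> (pt \<Rightarrow> real) \<Rightarrow> (pt \<Rightarrow> pt)" where
  "wgrad U u = (SOME D. weak_gradient U u D)"

definition sobolev1 :: "pt set \<Rightarrow> real \<Rightarrow> (pt \<Rightarrow> real) set" where
  "sobolev1 U p = {u \<in> Lp (lebesgue_on U) p. \<exists>D \<in> Lp (lebesgue_on U) p. weak_gradient U u D}"

text \<open>The trace operator from \<open>W\<^sup>1\<^sup>,\<^sup>1(K)\<close> to \<open>L\<^sup>1(\<partial>K)\<close> is the continuous extension of the restriction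
  \<open>\<phi> \<mapsto> \<phi>|\<^bsub>\<partial>K\<^esub>\<close> of functions that are \<open>C\<^sup>1\<close> up to the boundary. As \<open>K\<close> is bounded, it restricts to
  the trace operator of \<open>W\<^sup>1\<^sup>,\<^sup>p(K)\<close> for every \<open>p \<ge> 1\<close>.\<close>

definition is_trace :: "pt set \<Rightarrow> (pt \<Rightarrow> real) \<Rightarrow> (pt \<Rightarrow> real) \<Rightarrow> bool" where
  "is_trace K u \<tau> \<longleftrightarrow>
     u \<in> sobolev1 (interior K) 1 \<and> (\<forall>e. e edge_of K \<longrightarrow> edge_integrable e \<tau>) \<and>
     (\<exists>\<phi> D. (\<forall>n::nat. C1_with_gradient (\<phi> n) (D n)) \<and>
        (\<lambda>n. LINT x|lebesgue_on (interior K). \<bar>\<phi> n x - u x\<bar>) \<longlonglongrightarrow> 0 \<and>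
        (\<lambda>n. LINT x|lebesgue_on (interior K). norm (D n x - wgrad (interior K) u x)) \<longlonglongrightarrow> 0 \<and>
        (\<forall>e. e edge_of K \<longrightarrow> (\<lambda>n. edge_integral e (\<lambda>x. \<bar>\<phi> n x - \<tau> x\<bar>)) \<longlonglongrightarrow> 0))"

definition trace_on :: "pt set \<Rightarrow> (pt \<Rightarrow> real) \<Rightarrow> (pt \<Rightarrow> real)" where
  "trace_on K u = (SOME \<tau>. is_trace K u \<tau>)"

text \<open>Integral of a piecewise Sobolev function over an edge of the mesh. The trace is taken from an
  unspecified adjacent triangle; it is only applied to functions for which the side is irrelevant.\<close>

definition edge_trace_integral :: "pt set set \<Rightarrow> pt set \<Rightarrow> (pt \<Rightarrow> real) \<Rightarrow> real" where
  "edge_trace_integral \<T> e u = edge_integral e (trace_on (SOME K. K \<in> \<T> \<and> e edge_of K) u)"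

definition broken_grad :: "pt set set \<Rightarrow> (pt \<Rightarrow> real) \<Rightarrow> (pt \<Rightarrow> pt)" where
  "broken_grad \<T> u = (\<lambda>x. \<Sum>K\<in>\<T>. indicator (interior K) x *\<^sub>R wgrad (interior K) u x)"

section \<open>Finite element spaces\<close>

definition polys :: "nat \<Rightarrow> (pt \<Rightarrow> real) set" where
  "polys k = {\<phi>. \<exists>c. \<phi> = (\<lambda>x. \<Sum>i\<le>k. \<Sum>j\<le>k - i. c i j * (x $ 1) ^ i * (x $ 2) ^ j)}"

definition RT0 :: "(pt \<Rightarrow> pt) set" where
  "RT0 = {\<phi>. \<exists>a b. \<phi> = (\<lambda>x. a + b *\<^sub>R x)}"

text \<open>\<open>in_on P K v\<close> expresses \<open>v|\<^sub>K \<in> P(K)\<close>; \<open>rep P K v\<close> is then the (polynomial) representative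
  of \<open>v|\<^sub>K\<close>, which is needed for point values, traces and divergences.\<close>

definition in_on :: "(pt \<Rightarrow> 'b) set \<Rightarrow> pt set \<Rightarrow> (pt \<Rightarrow> 'b) \<Rightarrow> bool" where
  "in_on P K v \<longleftrightarrow> (\<exists>\<phi>\<in>P. AE x in lebesgue_on K. v x = \<phi> x)"

definition rep :: "(pt \<Rightarrow> 'b) set \<Rightarrow> pt set \<Rightarrow> (pt \<Rightarrow> 'b) \<Rightarrow> (pt \<Rightarrow> 'b)" where
  "rep P K v = (THE \<phi>. \<phi> \<in> P \<and> (AE x in lebesgue_on K. v x = \<phi> x))"

definition divergence :: "(pt \<Rightarrow> pt) \<Rightarrow> pt \<Rightarrow> real" where
  "divergence w x = (\<Sum>i\<in>UNIV. frechet_derivative w (at x) (axis i 1) $ i)"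

definition W_space :: "pt set \<Rightarrow> pt set set \<Rightarrow> real \<Rightarrow> (pt \<Rightarrow> pt) set" where
  "W_space \<Omega> \<T> s = {v \<in> Lp (lebesgue_on \<Omega>) s. \<forall>K\<in>\<T>. in_on RT0 K v}"

definition Q_space :: "pt set \<Rightarrow> pt set set \<Rightarrow> real \<Rightarrow> (pt \<Rightarrow> real) set" where
  "Q_space \<Omega> \<T> r = {q \<in> Lp (lebesgue_on \<Omega>) r. \<forall>K\<in>\<T>. in_on (polys 0) K q}"

definition Lam_space :: "pt set set \<Rightarrow> (pt \<Rightarrow> real) set" where
  "Lam_space \<T> = {l. \<forall>e\<in>edges \<T>. (\<lambda>t. l (edge_path e t)) \<in> Lp (lebesgue_on {0..1}) 2 \<and>
                        (\<exists>c. AE t in lebesgue_on {0..1}. l (edge_path e t) = c)}"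

definition Lam_space_bc :: "pt set \<Rightarrow> pt set set \<Rightarrow> (pt \<Rightarrow> real) \<Rightarrow> (pt \<Rightarrow> real) set" where
  "Lam_space_bc \<Omega> \<T> \<gamma> =
     {l \<in> Lam_space \<T>. \<forall>e\<in>bdry_edges \<Omega> \<T>. edge_integral e (\<lambda>x. l x - \<gamma> x) = 0}"

definition CR_space :: "pt set \<Rightarrow> pt set set \<Rightarrow> (pt \<Rightarrow> real) set" where
  "CR_space \<Omega> \<T> = {\<xi> \<in> Lp (lebesgue_on \<Omega>) 2.
     (\<forall>K\<in>\<T>. in_on (polys 1) K \<xi>) \<and>
     (\<forall>e\<in>int_edges \<Omega> \<T>. \<forall>K\<in>\<T>. \<forall>K'\<in>\<T>. e edge_of K \<and> e edge_of K' \<longrightarrow>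
        rep (polys 1) K \<xi> (edge_mid e) = rep (polys 1) K' \<xi> (edge_mid e)) \<and>
     (\<forall>e\<in>bdry_edges \<Omega> \<T>. \<forall>K\<in>\<T>. e edge_of K \<longrightarrow> edge_integral e (rep (polys 1) K \<xi>) = 0)}"

definition bubble_space :: "pt set \<Rightarrow> pt set set \<Rightarrow> (pt \<Rightarrow> real) set" where
  "bubble_space \<Omega> \<T> = {\<xi> \<in> Lp (lebesgue_on \<Omega>) 2.
     \<forall>K\<in>\<T>. in_on (polys 3) K \<xi> \<and> (\<forall>x\<in>frontier K. rep (polys 3) K \<xi> x = 0)}"

definition N_space :: "pt set \<Rightarrow> pt set set \<Rightarrow> (pt \<Rightarrow> real) set" where
  "N_space \<Omega> \<T> = {\<lambda>x. \<xi> x + \<beta> x | \<xi> \<beta>. \<xi> \<in> CR_space \<Omega> \<T> \<and> \<beta> \<in> bubble_space \<Omega> \<T>}"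

definition proj_Q :: "pt set set \<Rightarrow> (pt \<Rightarrow> real) \<Rightarrow> (pt \<Rightarrow> real)" where
  "proj_Q \<T> \<phi> = (\<lambda>x. \<Sum>K\<in>\<T>. indicator (interior K) x *
                       ((LINT y|lebesgue_on K. \<phi> y) / measure lebesgue K))"

definition proj_Lam :: "pt set set \<Rightarrow> (pt \<Rightarrow> real) \<Rightarrow> (pt \<Rightarrow> real)" where
  "proj_Lam \<T> \<phi> = (\<lambda>x. \<Sum>e\<in>edges \<T>. indicator (rel_interior e) x *
                         (edge_trace_integral \<T> e \<phi> / edge_length e))"

definition S_map :: "pt set set \<Rightarrow> (pt \<Rightarrow> real) \<Rightarrow> (pt \<Rightarrow> real) \<times> (pt \<Rightarrow> real)" where
  "S_map \<T> \<psi> = (proj_Q \<T> \<psi>, proj_Lam \<T> \<psi>)"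

section \<open>The discrete problems\<close>

definition a_form :: "pt set \<Rightarrow> ((pt \<Rightarrow> pt) \<Rightarrow> (pt \<Rightarrow> pt)) \<Rightarrow> (pt \<Rightarrow> pt) \<Rightarrow> (pt \<Rightarrow> pt) \<Rightarrow> real" where
  "a_form \<Omega> G u v = (LINT x|lebesgue_on \<Omega>. G u x \<bullet> v x)"

definition c_form :: "pt set \<Rightarrow> ((pt \<Rightarrow> real) \<Rightarrow> (pt \<Rightarrow> real)) \<Rightarrow> (pt \<Rightarrow> real) \<Rightarrow> (pt \<Rightarrow> real) \<Rightarrow> real" where
  "c_form \<Omega> R p q = (LINT x|lebesgue_on \<Omega>. R p x * q x)"

definition div_form :: "pt set set \<Rightarrow> (pt \<Rightarrow> pt) \<Rightarrow> (pt \<Rightarrow> real) \<Rightarrow> real" where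
  "div_form \<T> v q = (\<Sum>K\<in>\<T>. LINT x|lebesgue_on K. divergence (rep RT0 K v) x * q x)"

definition skeleton_form :: "pt set set \<Rightarrow> (pt \<Rightarrow> real) \<Rightarrow> (pt \<Rightarrow> pt) \<Rightarrow> real" where
  "skeleton_form \<T> l v =
     (\<Sum>K\<in>\<T>. \<Sum>e | e edge_of K. edge_integral e (\<lambda>x. l x * (rep RT0 K v x \<bullet> outer_normal K e)))"

definition hybrid_solution ::
  "pt set \<Rightarrow> pt set set \<Rightarrow> real \<Rightarrow> real \<Rightarrow> ((pt \<Rightarrow> real) \<Rightarrow> (pt \<Rightarrow> real)) \<Rightarrow> ((pt \<Rightarrow> pt) \<Rightarrow> (pt \<Rightarrow> pt)) \<Rightarrow>
   ((pt \<Rightarrow> real) \<Rightarrow> real) \<Rightarrow> (pt \<Rightarrow> real) \<Rightarrow> (pt \<Rightarrow> pt) \<Rightarrow> (pt \<Rightarrow> real) \<Rightarrow> (pt \<Rightarrow> real) \<Rightarrow> bool" where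
  "hybrid_solution \<Omega> \<T> r s R G f g u p \<mu> \<longleftrightarrow>
     u \<in> W_space \<Omega> \<T> s \<and> p \<in> Q_space \<Omega> \<T> r \<and> \<mu> \<in> Lam_space_bc \<Omega> \<T> g \<and>
     (\<forall>v \<in> W_space \<Omega> \<T> s. a_form \<Omega> G u v - div_form \<T> v p + skeleton_form \<T> \<mu> v = 0) \<and>
     (\<forall>q \<in> Q_space \<Omega> \<T> r. c_form \<Omega> R p q + div_form \<T> u q = f q) \<and>
     (\<forall>l \<in> Lam_space_bc \<Omega> \<T> (\<lambda>_. 0). skeleton_form \<T> l u = 0)"

text \<open>The third clause is uniqueness in the space, i.e. up to equality almost everywhere.\<close>

definition is_W_projection ::
  "pt set \<Rightarrow> pt set set \<Rightarrow> real \<Rightarrow> ((pt \<Rightarrow> pt) \<Rightarrow> (pt \<Rightarrow> pt)) \<Rightarrow> ((pt \<Rightarrow> pt) \<Rightarrow> (pt \<Rightarrow> pt)) \<Rightarrow> bool" where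
  "is_W_projection \<Omega> \<T> s G PW \<longleftrightarrow>
     (\<forall>u \<in> Lp (lebesgue_on \<Omega>) s.
        PW u \<in> W_space \<Omega> \<T> s \<and>
        (\<forall>v \<in> W_space \<Omega> \<T> s. a_form \<Omega> G (PW u) v = a_form \<Omega> G u v) \<and>
        (\<forall>w \<in> W_space \<Omega> \<T> s. (\<forall>v \<in> W_space \<Omega> \<T> s. a_form \<Omega> G w v = a_form \<Omega> G u v) \<longrightarrow>
           (AE x in lebesgue_on \<Omega>. w x = PW u x)))"

definition nonconforming_solution ::
  "pt set \<Rightarrow> pt set set \<Rightarrow> real \<Rightarrow> ((pt \<Rightarrow> real) \<Rightarrow> (pt \<Rightarrow> real)) \<Rightarrow> ((pt \<Rightarrow> pt) \<Rightarrow> (pt \<Rightarrow> pt)) \<Rightarrow>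
   ((pt \<Rightarrow> pt) \<Rightarrow> (pt \<Rightarrow> pt)) \<Rightarrow> ((pt \<Rightarrow> real) \<Rightarrow> real) \<Rightarrow> (pt \<Rightarrow> real) \<Rightarrow> (pt \<Rightarrow> real) \<Rightarrow> bool" where
  "nonconforming_solution \<Omega> \<T> s R G PW f gt \<psi> \<longleftrightarrow>
     \<psi> \<in> {\<lambda>x. \<xi> x + gt x | \<xi>. \<xi> \<in> N_space \<Omega> \<T>} \<and>
     (\<forall>\<xi> \<in> N_space \<Omega> \<T>.
        c_form \<Omega> R (proj_Q \<T> \<psi>) (proj_Q \<T> \<xi>) +
        (\<Sum>K\<in>\<T>. LINT x|lebesgue_on K.
           PW (Lp_inverse (lebesgue_on \<Omega>) s G (broken_grad \<T> \<psi>)) x \<bullet> broken_grad \<T> \<xi> x)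
        = f (proj_Q \<T> \<xi>))"

end

(* Everything about traces rests on one identity. If K is the triangle with vertices a, b, c, then for
   every C1 function phi the divergence theorem for the field x - a reads
     integral over K of (2 phi + grad phi . (x - a))  =  |det (b - a, c - a)| * (mean of phi over [b, c]),
   and it follows from polar-type coordinates centred at a. The fields x - a, with a running through the
   vertices, span RT0, so that this one identity gives Green's formula on K for all of RT0; applied to
   sqrt (phi^2 + eps^2) it gives the trace inequality, and, by density of C1 functions, the existence of
   traces on W^{1,1}(K) together with an explicit volume formula for their edge means. Hence the edge
   means of a function in W^{1,1}(Omega) are the same from both sides of an edge.

   Green's formula for psi, together with the oddness of G, is then the first equation of (H). For the
   other two, (N) is tested with functions having prescribed cell means and edge means: a
   Crouzeix-Raviart function interpolates the edge means at the midpoints, and cubic bubbles correct the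
   cell means without affecting the edge means. *)
theory Submission
  imports Defs
begin

section \<open>Mollification in the Lebesgue space of integrable functions\<close>

text \<open>The field x - a is tangent to the two sides of K that meet in a, so the divergence
  theorem for phi (x - a) sees only the opposite side; this is why one edge mean at a time can be
  isolated. An obstacle is that \<open>wgrad\<close>, \<open>trace_on\<close>,
  \<open>edge_trace_integral\<close> and \<open>Lp_inverse\<close> are arbitrary choices: each is
  used only through a property shared by all admissible choices, which requires uniqueness of weak
  gradients and a formula valid for every trace. Density of C1 functions up to the boundary cannot
  come from plain convolution, since a kernel centred near the boundary leaves the domain. The point
  is therefore first contracted towards a star centre c by x -> (1 - t) x + t c, which is why
  L1-continuity is proved for maps x -> l x + b and not only for translations. For a single triangle
  any interior point serves as c; for two triangles with a common edge the midpoint of that edge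
  serves both, and one approximating sequence on the union makes the two edge means equal. Oddness
  of G reconciles the signs of Green's formula and of (H).\<close>

lemma lborel_affine_map:
  fixes F :: "'a::euclidean_space \<Rightarrow> 'b::{banach,second_countable_topology}" and b :: 'a
  assumes "l \<noteq> 0" and F: "integrable lborel F"
  shows "integrable lborel (\<lambda>x. F (l *\<^sub>R x + b))"
    and "(LINT x|lborel. F (l *\<^sub>R x + b)) = (1 / \<bar>l\<bar> ^ DIM('a)) *\<^sub>R (LINT x|lborel. F x)"
proof -
  have m: "F \<in> borel_measurable borel"
    using F by auto
  have meas: "(\<lambda>x. b + l *\<^sub>R x) \<in> borel_measurable (borel :: 'a measure)"
    by measurable
  have eq: "(lborel :: 'a measure) = density (distr lborel borel (\<lambda>x. b + l *\<^sub>R x)) (\<lambda>_. ennreal (\<bar>l\<bar> ^ DIM('a)))"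
    using lborel_affine[OF assms(1), of b] by (simp add: prod_constant ennreal_power)
  have "integrable (density (distr lborel borel (\<lambda>x. b + l *\<^sub>R x)) (\<lambda>_. ennreal (\<bar>l\<bar> ^ DIM('a)))) F"
    using F eq by simp
  then have "integrable lborel (\<lambda>x. (\<bar>l\<bar> ^ DIM('a)) *\<^sub>R F (b + l *\<^sub>R x))"
    using m meas by (subst (asm) integrable_density) (auto simp: integrable_distr_eq)
  then show "integrable lborel (\<lambda>x. F (l *\<^sub>R x + b))"
    using assms(1) integrable_scaleR_right[of "1 / \<bar>l\<bar> ^ DIM('a)" lborel "\<lambda>x. (\<bar>l\<bar> ^ DIM('a)) *\<^sub>R F (b + l *\<^sub>R x)"] by (simp add: add.commute)
  have "(LINT x|lborel. F x) = (LINT x|density (distr lborel borel (\<lambda>x. b + l *\<^sub>R x)) (\<lambda>_. ennreal (\<bar>l\<bar> ^ DIM('a))). F x)"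
    using eq by simp
  also have "\<dots> = (LINT x|lborel. (\<bar>l\<bar> ^ DIM('a)) *\<^sub>R F (b + l *\<^sub>R x))"
    using m meas by (subst integral_density) (auto simp: integral_distr)
  finally show "(LINT x|lborel. F (l *\<^sub>R x + b)) = (1 / \<bar>l\<bar> ^ DIM('a)) *\<^sub>R (LINT x|lborel. F x)"
    using assms(1) integrable_scaleR_right[of "1 / \<bar>l\<bar> ^ DIM('a)" lborel "\<lambda>x. (\<bar>l\<bar> ^ DIM('a)) *\<^sub>R F (b + l *\<^sub>R x)"] by (simp add: add.commute)
qed

text \<open>For indicators |I_A - I_B| = I_A + I_B - 2 I_A I_B, so L1 convergence reduces to two
  limits: that of the measures, which is scaling, and that of the overlaps. In the second a point of
  the open set \<open>U\<close> stays in \<open>U\<close> under small affine perturbations.\<close>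

lemma open_indicator_affine_L1:
  fixes U :: "'a::euclidean_space set"
  assumes U: "open U" "emeasure lborel U < \<infinity>"
    and l: "l \<longlonglongrightarrow> (1::real)" and b: "b \<longlonglongrightarrow> 0" and l0: "\<And>n. l n \<noteq> 0"
  shows "(\<lambda>n. LINT x|lborel. \<bar>indicator U (l n *\<^sub>R x + b n) - indicator U x :: real\<bar>) \<longlonglongrightarrow> 0"
proof -
  let ?I = "\<lambda>x. indicator U x :: real"
  have I: "integrable lborel ?I"
    using U by (intro integrable_real_indicator) auto
  have Il: "integrable lborel (\<lambda>x. ?I (l n *\<^sub>R x + b n))" for n
    by (rule lborel_affine_map(1)[OF l0 I])
  have Im: "integrable lborel (\<lambda>x. ?I x * ?I (l n *\<^sub>R x + b n))" for n
    by (rule Bochner_Integration.integrable_bound[OF I]) (use I Il in \<open>auto simp: indicator_def\<close>)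
  have 1: "(\<lambda>n. LINT x|lborel. ?I (l n *\<^sub>R x + b n)) \<longlonglongrightarrow> (LINT x|lborel. ?I x)"
  proof -
    have "(\<lambda>n. (1 / \<bar>l n\<bar> ^ DIM('a)) * (LINT x|lborel. ?I x)) \<longlonglongrightarrow> (1 / \<bar>1\<bar> ^ DIM('a)) * (LINT x|lborel. ?I x)"
      by (intro tendsto_intros l) auto
    then show ?thesis
      using lborel_affine_map(2)[OF l0 I] by simp
  qed
  \<comment> \<open>Off \<open>U\<close> the product vanishes identically, so pointwise convergence
    needs an argument only at points of \<open>U\<close>.\<close>
  have 2: "(\<lambda>n. LINT x|lborel. ?I x * ?I (l n *\<^sub>R x + b n)) \<longlonglongrightarrow> (LINT x|lborel. ?I x)"
  proof (rule integral_dominated_convergence[where w="?I"])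
    show "AE x in lborel. (\<lambda>n. ?I x * ?I (l n *\<^sub>R x + b n)) \<longlonglongrightarrow> ?I x"
    proof (intro AE_I2)
      fix x :: 'a
      show "(\<lambda>n. ?I x * ?I (l n *\<^sub>R x + b n)) \<longlonglongrightarrow> ?I x"
      proof (cases "x \<in> U")
        case True
        have "(\<lambda>n. l n *\<^sub>R x + b n) \<longlonglongrightarrow> 1 *\<^sub>R x + 0"
          by (intro tendsto_intros l b)
        then have "\<forall>\<^sub>F n in sequentially. l n *\<^sub>R x + b n \<in> U"
          using U(1) True by (simp add: topological_tendstoD)
        then show ?thesis
          by (intro tendsto_eventually) (auto elim!: eventually_mono simp: True)
      qed simp
    qed
  qed (use I Im in \<open>auto simp: indicator_def\<close>)
  have "(\<lambda>n. (LINT x|lborel. ?I (l n *\<^sub>R x + b n)) + (LINT x|lborel. ?I x)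
            - 2 * (LINT x|lborel. ?I x * ?I (l n *\<^sub>R x + b n))) \<longlonglongrightarrow>
         (LINT x|lborel. ?I x) + (LINT x|lborel. ?I x) - 2 * (LINT x|lborel. ?I x)"
    by (intro tendsto_intros 1 2)
  moreover have "(LINT x|lborel. \<bar>?I (l n *\<^sub>R x + b n) - ?I x\<bar>) =
      (LINT x|lborel. ?I (l n *\<^sub>R x + b n)) + (LINT x|lborel. ?I x)
            - 2 * (LINT x|lborel. ?I x * ?I (l n *\<^sub>R x + b n))" for n
  proof -
    have "(LINT x|lborel. \<bar>?I (l n *\<^sub>R x + b n) - ?I x\<bar>) =
      (LINT x|lborel. ?I (l n *\<^sub>R x + b n) + ?I x - 2 * (?I x * ?I (l n *\<^sub>R x + b n)))"
      by (intro Bochner_Integration.integral_cong) (auto simp: indicator_def)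
    then show ?thesis
      using I Il[of n] Im[of n] by simp
  qed
  ultimately show ?thesis by simp
qed

text \<open>Three-term estimate: replacing \<open>F\<close> by \<open>G i\<close> costs their
  distance twice, once after the affine substitution, whose Jacobian factor 1 / |l|^DIM is
  eventually below 2. The total is three times that distance plus the error for \<open>G i\<close>,
  which is why both are kept below e / 4.\<close>

lemma affine_L1_closure:
  fixes F :: "'a::euclidean_space \<Rightarrow> 'b::{banach,second_countable_topology}"
  assumes F: "integrable lborel F" and G: "\<And>i::nat. integrable lborel (G i)"
    and GF: "(\<lambda>i. LINT x|lborel. norm (G i x - F x)) \<longlonglongrightarrow> 0"
    and l: "l \<longlonglongrightarrow> (1::real)" and l0: "\<And>n. l n \<noteq> 0"
    and G0: "\<And>i. (\<lambda>n. LINT x|lborel. norm (G i (l n *\<^sub>R x + b n) - G i x)) \<longlonglongrightarrow> 0"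
  shows "(\<lambda>n. LINT x|lborel. norm (F (l n *\<^sub>R x + b n) - F x)) \<longlonglongrightarrow> 0"
proof (rule LIMSEQ_I)
  fix e :: real assume "0 < e"
  obtain i where i: "\<bar>LINT x|lborel. norm (G i x - F x)\<bar> < e / 4"
    using LIMSEQ_D[OF GF, of "e/4"] \<open>0 < e\<close> by auto
  define d where "d = (LINT x|lborel. norm (G i x - F x))"
  have d: "d \<ge> 0" "d < e/4"
    using i unfolding d_def by auto
  have GFi: "integrable lborel (\<lambda>x. norm (G i x - F x))"
    using F G by auto
  have "(\<lambda>n. 1 / \<bar>l n\<bar> ^ DIM('a)) \<longlonglongrightarrow> 1 / \<bar>1\<bar> ^ DIM('a)"
    by (intro tendsto_intros l) auto
  then have ev1: "\<forall>\<^sub>F n in sequentially. 1 / \<bar>l n\<bar> ^ DIM('a) < 2"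
    by (rule order_tendstoD) auto
  have ev2: "\<forall>\<^sub>F n in sequentially. (LINT x|lborel. norm (G i (l n *\<^sub>R x + b n) - G i x)) < e/4"
    using \<open>0 < e\<close> by (intro order_tendstoD[OF G0]) auto
  have "\<forall>\<^sub>F n in sequentially. norm ((LINT x|lborel. norm (F (l n *\<^sub>R x + b n) - F x)) - 0) < e"
    using ev1 ev2
  proof eventually_elim
    case (elim n)
    have int1: "integrable lborel (\<lambda>x. norm (G i (l n *\<^sub>R x + b n) - F (l n *\<^sub>R x + b n)))"
      using lborel_affine_map(1)[OF l0 GFi] .
    have int2: "integrable lborel (\<lambda>x. norm (G i (l n *\<^sub>R x + b n) - G i x))"
      using lborel_affine_map(1)[OF l0 G] G by (intro integrable_norm Bochner_Integration.integrable_diff)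
    have int3: "integrable lborel (\<lambda>x. norm (F (l n *\<^sub>R x + b n) - F x))"
      using lborel_affine_map(1)[OF l0 F] F by (intro integrable_norm Bochner_Integration.integrable_diff)
    have "(LINT x|lborel. norm (F (l n *\<^sub>R x + b n) - F x)) \<le>
      (LINT x|lborel. norm (G i (l n *\<^sub>R x + b n) - F (l n *\<^sub>R x + b n)) + (norm (G i (l n *\<^sub>R x + b n) - G i x)
         + norm (G i x - F x)))"
    proof (rule integral_mono)
      fix x
      show "norm (F (l n *\<^sub>R x + b n) - F x) \<le> norm (G i (l n *\<^sub>R x + b n) - F (l n *\<^sub>R x + b n)) + (norm (G i (l n *\<^sub>R x + b n) - G i x)
         + norm (G i x - F x))"
        by norm
    qed (use int1 int2 int3 GFi in auto)
    also have "\<dots> = (1 / \<bar>l n\<bar> ^ DIM('a)) * d + ((LINT x|lborel. norm (G i (l n *\<^sub>R x + b n) - G i x)) + d)"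
      using int1 int2 GFi lborel_affine_map(2)[OF l0 GFi, of n "b n"] by (simp add: d_def)
    also have "\<dots> \<le> 2 * d + (e/4 + d)"
      using elim d by (intro add_mono mult_right_mono) auto
    also have "\<dots> < e"
      using d by auto
    finally show ?case by simp
  qed
  then show "\<exists>no. \<forall>n\<ge>no. norm ((LINT x|lborel. norm (F (l n *\<^sub>R x + b n) - F x)) - 0) < e"
    by (simp add: eventually_sequentially)
qed

text \<open>Outer regularity replaces a measurable set by open supersets, for which convergence of
  the perturbed indicators is known; sums and dominated limits then follow the standard induction on
  integrable functions.\<close>

lemma affine_L1_continuous:
  fixes F :: "'a::euclidean_space \<Rightarrow> 'b::{banach,second_countable_topology}"
  assumes F: "integrable lborel F"
    and l: "l \<longlonglongrightarrow> (1::real)" and b: "b \<longlonglongrightarrow> 0" and l0: "\<And>n. l n \<noteq> 0"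
  shows "(\<lambda>n. LINT x|lborel. norm (F (l n *\<^sub>R x + b n) - F x)) \<longlonglongrightarrow> 0"
  using F
proof (induction rule: integrable_induct)
  case (base A c)
  let ?I = "\<lambda>A x. indicator A x :: real"
  have A: "A \<in> sets lebesgue" "emeasure lebesgue A < \<infinity>"
    using base by auto
  have "\<exists>T. open T \<and> A \<subseteq> T \<and> (T - A) \<in> lmeasurable \<and> emeasure lebesgue (T - A) < ennreal (1 / real (Suc i))" for i
    by (rule sets_lebesgue_outer_open[OF A(1), of "1 / real (Suc i)"]) auto
  then obtain T where T: "\<And>i. open (T i)" "\<And>i. A \<subseteq> T i" "\<And>i. (T i - A) \<in> lmeasurable"
    "\<And>i. emeasure lebesgue (T i - A) < ennreal (1 / real (Suc i))"
    by metis
  have TA: "emeasure lborel (T i - A) < ennreal (1 / real (Suc i))" for i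
    using T(4)[of i] base(1) T(1)[of i] by (simp add: emeasure_completion)
  have "emeasure lborel (T i) = emeasure lborel (T i - A) + emeasure lborel A" for i
    using T(2)[of i] T(1)[of i] base(1) by (subst plus_emeasure) (auto intro!: arg_cong[where f="emeasure lborel"])
  then have Tfin: "emeasure lborel (T i) < \<infinity>" for i
    using TA[of i] base(2) by (simp add: order_less_trans)
  have iT: "integrable lborel (\<lambda>x. indicator (T i) x *\<^sub>R c)" for i
    using Tfin T(1) by (intro integrable_scaleR_left integrable_real_indicator) auto
  show ?case
  proof (rule affine_L1_closure[OF _ _ _ l l0])
    show "integrable lborel (\<lambda>x. indicator A x *\<^sub>R c)"
      using base by (intro integrable_scaleR_left integrable_real_indicator) auto
    show "integrable lborel (\<lambda>x. indicator (T i) x *\<^sub>R c)" for i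
      by (rule iT)
    show "(\<lambda>n. LINT x|lborel. norm (indicator (T i) (l n *\<^sub>R x + b n) *\<^sub>R c - indicator (T i) x *\<^sub>R c)) \<longlonglongrightarrow> 0" for i
    proof -
      have "(\<lambda>n. (LINT x|lborel. \<bar>?I (T i) (l n *\<^sub>R x + b n) - ?I (T i) x\<bar>) * norm c) \<longlonglongrightarrow> 0 * norm c"
        by (intro tendsto_intros open_indicator_affine_L1 T Tfin l b l0)
      moreover have "norm (indicator (T i) (l n *\<^sub>R x + b n) *\<^sub>R c - indicator (T i) x *\<^sub>R c)
          = \<bar>?I (T i) (l n *\<^sub>R x + b n) - ?I (T i) x\<bar> * norm c" for n x
        by (metis norm_scaleR scaleR_diff_left)
      ultimately show ?thesis by simp
    qed
    have eq: "(LINT x|lborel. norm (indicator (T i) x *\<^sub>R c - indicator A x *\<^sub>R c)) = measure lborel (T i - A) * norm c" for i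
    proof -
      have "(LINT x|lborel. norm (indicator (T i) x *\<^sub>R c - indicator A x *\<^sub>R c)) = (LINT x|lborel. ?I (T i - A) x * norm c)"
        using T(2)[of i] by (intro Bochner_Integration.integral_cong) (auto simp: indicator_def)
      then show ?thesis by simp
    qed
    have "measure lborel (T i - A) \<le> 1 / real (Suc i)" for i
      using TA[of i] unfolding measure_def by (metis enn2real_leI less_imp_le of_nat_0_le_iff zero_le_divide_1_iff)
    then have "(\<lambda>i. measure lborel (T i - A)) \<longlonglongrightarrow> 0"
      using LIMSEQ_inverse_real_of_nat
      by (intro tendsto_sandwich[OF _ _ tendsto_const LIMSEQ_inverse_real_of_nat]) (auto simp: inverse_eq_divide)
    then show "(\<lambda>i. LINT x|lborel. norm (indicator (T i) x *\<^sub>R c - indicator A x *\<^sub>R c)) \<longlonglongrightarrow> 0"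
      unfolding eq by (rule tendsto_mult_left_zero)
  qed
next
  case (add f g)
  have lim: "(\<lambda>n. (LINT x|lborel. norm (f (l n *\<^sub>R x + b n) - f x)) + (LINT x|lborel. norm (g (l n *\<^sub>R x + b n) - g x))) \<longlonglongrightarrow> 0 + 0"
    by (intro tendsto_intros add)
  have le: "(LINT x|lborel. norm (f (l n *\<^sub>R x + b n) + g (l n *\<^sub>R x + b n) - (f x + g x))) \<le>
     (LINT x|lborel. norm (f (l n *\<^sub>R x + b n) - f x)) + (LINT x|lborel. norm (g (l n *\<^sub>R x + b n) - g x))" for n
  proof -
    note ff = lborel_affine_map(1)[OF l0 add(1), of n "b n"] add(1)
    note gg = lborel_affine_map(1)[OF l0 add(2), of n "b n"] add(2)
    have "(LINT x|lborel. norm (f (l n *\<^sub>R x + b n) + g (l n *\<^sub>R x + b n) - (f x + g x))) \<le>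
      (LINT x|lborel. norm (f (l n *\<^sub>R x + b n) - f x) + norm (g (l n *\<^sub>R x + b n) - g x))"
      using ff gg by (intro integral_mono) (auto simp: add_diff_add norm_triangle_ineq)
    then show ?thesis using ff gg by simp
  qed
  have nn: "0 \<le> (LINT x|lborel. norm (f (l n *\<^sub>R x + b n) + g (l n *\<^sub>R x + b n) - (f x + g x)))" for n
    by (rule integral_nonneg_AE) simp
  show ?case
    by (rule tendsto_sandwich[OF always_eventually always_eventually tendsto_const lim[unfolded add_0_left]])
       (blast intro: le nn)+
next
  case (lim f s)
  show ?case
  proof (rule affine_L1_closure[OF _ _ _ l l0])
    show "(\<lambda>i. LINT x|lborel. norm (s i x - f x)) \<longlonglongrightarrow> 0"
    proof -
      have "(\<lambda>i. LINT x|lborel. norm (s i x - f x)) \<longlonglongrightarrow> (LINT x|(lborel :: 'a measure). 0::real)"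
      proof (rule integral_dominated_convergence[where w="\<lambda>x. 3 * norm (f x)"])
        show "AE x in lborel. (\<lambda>i. norm (s i x - f x)) \<longlonglongrightarrow> 0"
          using lim(2) by (intro AE_I2) (simp add: tendsto_norm_zero LIM_zero)
        show "AE x in lborel. norm (norm (s i x - f x)) \<le> 3 * norm (f x)" for i
        proof (intro AE_I2)
          fix x :: 'a assume "x \<in> space lborel"
          then have "norm (s i x) \<le> 2 * norm (f x)" using lim(3) by auto
          then show "norm (norm (s i x - f x)) \<le> 3 * norm (f x)"
            using norm_triangle_ineq4[of "s i x" "f x"] by simp
        qed
      qed (use lim in auto)
      then show ?thesis by simp
    qed
  qed (use lim in auto)
qed

lemma affine_L1_uniform:
  fixes F :: "'a::euclidean_space \<Rightarrow> 'b::{banach,second_countable_topology}"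
  assumes F: "integrable lborel F" and "0 < (e::real)"
  obtains d where "0 < d" "d < 1" "\<And>l b. \<bar>l - 1\<bar> < d \<Longrightarrow> norm b < d \<Longrightarrow> (LINT x|lborel. norm (F (l *\<^sub>R x + b) - F x)) < e"
proof -
  let ?w = "\<lambda>l b. (LINT x|lborel. norm (F (l *\<^sub>R x + b) - F x))"
  have "\<exists>d. 0 < d \<and> d < 1 \<and> (\<forall>l b. \<bar>l - 1\<bar> < d \<longrightarrow> norm b < d \<longrightarrow> ?w l b < e)"
  proof (rule ccontr)
    assume "\<not> ?thesis"
    then have *: "\<exists>l b. \<bar>l - 1\<bar> < d \<and> norm b < d \<and> \<not> ?w l b < e" if "0 < d" "d < 1" for d
      using that by blast
    \<comment> \<open>The offset 2 keeps the radius strictly below 1, as \<open>*\<close> demands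
      already for n = 0.\<close>
    have "\<exists>l b. \<bar>l - 1\<bar> < 1 / real (n + 2) \<and> norm b < 1 / real (n + 2) \<and> \<not> ?w l b < e" for n
      by (rule *) auto
    then have "\<forall>n. \<exists>p. \<bar>fst p - 1\<bar> < 1 / real (n + 2) \<and> norm (snd p) < 1 / real (n + 2) \<and> \<not> ?w (fst p) (snd p) < e"
      by (simp add: split_paired_Ex)
    from choice[OF this] obtain p where p: "\<bar>fst (p n) - 1\<bar> < 1 / real (n + 2)" "norm (snd (p n)) < 1 / real (n + 2)"
      "\<not> ?w (fst (p n)) (snd (p n)) < e" for n
      by blast
    define l where "l n = fst (p n)" for n
    define b where "b n = snd (p n)" for n
    have l: "\<bar>l n - 1\<bar> < 1 / real (n + 2)" and b: "norm (b n) < 1 / real (n + 2)" and w: "\<not> ?w (l n) (b n) < e" for n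
      using p by (auto simp: l_def b_def)
    have lim: "(\<lambda>n. 1 / real (n + 2)) \<longlonglongrightarrow> 0"
      using LIMSEQ_ignore_initial_segment[OF lim_inverse_n', of 2] by simp
    have l1: "l \<longlonglongrightarrow> 1"
    proof (rule LIM_zero_cancel, rule Lim_null_comparison[OF _ lim])
      show "\<forall>\<^sub>F n in sequentially. norm (l n - 1) \<le> 1 / real (n + 2)"
        using l by (auto simp: less_imp_le)
    qed
    have b0: "b \<longlonglongrightarrow> 0"
    proof (rule Lim_null_comparison[OF _ lim])
      show "\<forall>\<^sub>F n in sequentially. norm (b n) \<le> 1 / real (n + 2)"
        using b by (auto simp: less_imp_le)
    qed
    have l0: "l n \<noteq> 0" for n
    proof
      assume "l n = 0"
      then have "1 < 1 / real (n + 2)" using l[of n] by simp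
      then show False by (simp add: field_simps)
    qed
    have "\<forall>\<^sub>F n in sequentially. ?w (l n) (b n) < e"
      using affine_L1_continuous[OF F l1 b0 l0] \<open>0 < e\<close> by (rule order_tendstoD)
    then show False
      using w by (auto simp: eventually_sequentially)
  qed
  then show ?thesis using that by blast
qed

lemma integrable_bounded_scaleR:
  fixes G :: "'a \<Rightarrow> 'b::{banach,second_countable_topology}"
  assumes "integrable M G" "k \<in> borel_measurable M" "\<And>y. \<bar>k y\<bar> \<le> L"
  shows "integrable M (\<lambda>y. k y *\<^sub>R G y)"
proof (rule Bochner_Integration.integrable_bound)
  show "integrable M (\<lambda>y. L * norm (G y))" using assms(1) by simp
  show "AE y in M. norm (k y *\<^sub>R G y) \<le> norm (L * norm (G y))"
  proof (intro AE_I2)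
    fix y
    have "\<bar>k y\<bar> \<le> \<bar>L\<bar>" using assms(3)[of y] by linarith
    then show "norm (k y *\<^sub>R G y) \<le> norm (L * norm (G y))"
      by (simp add: abs_mult mult_right_mono)
  qed
qed (use assms in auto)

text \<open>The smoothed function at x is the average of F (l x + b + w) with probability density
  \<open>k\<close>. By exchanging the integrals, its L1 distance from \<open>F\<close> is at most
  the \<open>k\<close>-average of the distances between F (l x + b + w) and F x, so only offsets w
  with \<open>k w\<close> nonzero have to be controlled. The upper bound on \<open>k\<close> makes
  the product with \<open>F\<close> integrable.\<close>

lemma mollify_L1_bound:
  fixes F :: "'a::euclidean_space \<Rightarrow> 'b::{banach,second_countable_topology}" and k :: "'a \<Rightarrow> real"
  assumes F: "integrable lborel F" and l: "l \<noteq> 0"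
    and k: "integrable lborel k" "\<And>w. 0 \<le> k w" "(LINT w|lborel. k w) = 1" "\<And>w. k w \<le> L"
    and e: "\<And>w. k w \<noteq> 0 \<Longrightarrow> (LINT x|lborel. norm (F (l *\<^sub>R x + (b + w)) - F x)) \<le> e"
  shows "integrable lborel (\<lambda>x. (LINT y|lborel. k (y - l *\<^sub>R x - b) *\<^sub>R F y) - F x)"
    and "(LINT x|lborel. norm ((LINT y|lborel. k (y - l *\<^sub>R x - b) *\<^sub>R F y) - F x)) \<le> e"
proof -
  have mF[measurable]: "F \<in> borel_measurable borel" and mk[measurable]: "k \<in> borel_measurable borel"
    using F k by auto
  let ?T = "\<lambda>x. (LINT y|lborel. k (y - l *\<^sub>R x - b) *\<^sub>R F y)"
  have e0: "0 \<le> e"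
  proof -
    have "\<exists>w. k w \<noteq> 0"
    proof (rule ccontr)
      assume "\<not> ?thesis"
      then have "k = (\<lambda>_. 0)" by auto
      then show False using k(3) by simp
    qed
    then obtain w where "k w \<noteq> 0" by blast
    from order_trans[OF _ e[OF this]] show ?thesis by simp
  qed
  have ikF: "integrable lborel (\<lambda>y. k (y - z) *\<^sub>R F y)" for z
    by (rule integrable_bounded_scaleR[OF F, of _ L]) (use k in auto)
  have shift: "(LINT y|lborel. k (y - z) *\<^sub>R F y) = (LINT w|lborel. k w *\<^sub>R F (z + w))" for z
    using lborel_affine_map(2)[OF _ ikF[of z], of 1 z] by (simp add: add.commute)
  have ishift: "integrable lborel (\<lambda>w. k w *\<^sub>R F (z + w))" for z
    using lborel_affine_map(1)[OF _ ikF[of z], of 1 z] by (simp add: add.commute)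
  have diff: "?T x - F x = (LINT w|lborel. k w *\<^sub>R (F (l *\<^sub>R x + (b + w)) - F x))" for x
  proof -
    have "?T x = (LINT w|lborel. k w *\<^sub>R F (l *\<^sub>R x + b + w))"
      using shift[of "l *\<^sub>R x + b"] by (simp add: diff_diff_eq)
    moreover have "F x = (LINT w|lborel. k w *\<^sub>R F x)"
      using k by simp
    moreover have "integrable lborel (\<lambda>w. k w *\<^sub>R F x)"
      using k by simp
    ultimately show ?thesis
      using ishift[of "l *\<^sub>R x + b"]
      by (simp add: scaleR_diff_right Bochner_Integration.integral_diff add.assoc)
  qed
  have bnd: "(\<integral>\<^sup>+ x. ennreal (norm (?T x - F x)) \<partial>lborel) \<le> ennreal e"
  proof -
    have "(\<integral>\<^sup>+ x. ennreal (norm (?T x - F x)) \<partial>lborel) \<le>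
      (\<integral>\<^sup>+ x. (\<integral>\<^sup>+ w. ennreal (k w * norm (F (l *\<^sub>R x + (b + w)) - F x)) \<partial>lborel) \<partial>lborel)"
      unfolding diff
    proof (rule nn_integral_mono)
      fix x
      have "integrable lborel (\<lambda>w. k w *\<^sub>R (F (l *\<^sub>R x + (b + w)) - F x))"
        using ishift[of "l *\<^sub>R x + b"] k by (simp add: scaleR_diff_right add.assoc)
      from integral_norm_bound_ennreal[OF this]
      show "ennreal (norm (LINT w|lborel. k w *\<^sub>R (F (l *\<^sub>R x + (b + w)) - F x))) \<le>
        (\<integral>\<^sup>+ w. ennreal (k w * norm (F (l *\<^sub>R x + (b + w)) - F x)) \<partial>lborel)"
        using k(2) by simp
    qed
    also have "\<dots> = (\<integral>\<^sup>+ w. (\<integral>\<^sup>+ x. ennreal (k w * norm (F (l *\<^sub>R x + (b + w)) - F x)) \<partial>lborel) \<partial>lborel)"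
      by (rule lborel_pair.Fubini') measurable
    also have "\<dots> \<le> (\<integral>\<^sup>+ w. ennreal (k w * e) \<partial>lborel)"
    proof (rule nn_integral_mono)
      fix w :: 'a
      have "integrable lborel (\<lambda>x. norm (F (l *\<^sub>R x + (b + w)) - F x))"
        using lborel_affine_map(1)[OF l F] F by (intro integrable_norm Bochner_Integration.integrable_diff)
      then have "(\<integral>\<^sup>+ x. ennreal (k w * norm (F (l *\<^sub>R x + (b + w)) - F x)) \<partial>lborel) =
         ennreal (k w * (LINT x|lborel. norm (F (l *\<^sub>R x + (b + w)) - F x)))"
        using k(2) by (subst nn_integral_eq_integral) auto
      also have "\<dots> \<le> ennreal (k w * e)"
        using e[of w] k(2)[of w] by (cases "k w = 0") (auto intro!: ennreal_leI mult_left_mono)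
      finally show "(\<integral>\<^sup>+ x. ennreal (k w * norm (F (l *\<^sub>R x + (b + w)) - F x)) \<partial>lborel) \<le> ennreal (k w * e)" .
    qed
    also have "\<dots> = ennreal (LINT w|lborel. k w * e)"
      using k e0 by (intro nn_integral_eq_integral) auto
    finally show ?thesis using k by simp
  qed
  have meas: "(\<lambda>x. ?T x - F x) \<in> borel_measurable borel"
    by measurable
  show int: "integrable lborel (\<lambda>x. ?T x - F x)"
    using bnd meas by (intro integrableI_bounded) (auto simp: less_top[symmetric] top_unique)
  have "ennreal (LINT x|lborel. norm (?T x - F x)) \<le> ennreal e"
    using bnd int by (subst nn_integral_eq_integral[symmetric]) auto
  then show "(LINT x|lborel. norm (?T x - F x)) \<le> e"
    using e0 by simp
qed

section \<open>Calculus of C1 functions, mollifiers, and differentiation under the integral\<close>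

lemma C1_with_gradient_continuous:
  assumes "C1_with_gradient \<phi> \<phi>'"
  shows "continuous_on A \<phi>" "continuous_on A \<phi>'"
proof -
  have "(\<phi> has_derivative (\<lambda>h. h \<bullet> \<phi>' x)) (at x within A)" for x
    using assms unfolding C1_with_gradient_def gderiv_def by (blast intro: has_derivative_at_withinI)
  then show "continuous_on A \<phi>" by (rule has_derivative_continuous_on)
  show "continuous_on A \<phi>'"
    using assms unfolding C1_with_gradient_def by (blast intro: continuous_on_subset)
qed

lemma C1_with_gradient_const: "C1_with_gradient (\<lambda>_. c) (\<lambda>_. 0)"
  by (auto simp: C1_with_gradient_def GDERIV_const)

lemma C1_with_gradient_add:
  "C1_with_gradient \<phi> \<phi>' \<Longrightarrow> C1_with_gradient \<psi> \<psi>' \<Longrightarrow> C1_with_gradient (\<lambda>x. \<phi> x + \<psi> x) (\<lambda>x. \<phi>' x + \<psi>' x)"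
  unfolding C1_with_gradient_def by (blast intro: GDERIV_add continuous_on_add)

lemma C1_with_gradient_diff:
  "C1_with_gradient \<phi> \<phi>' \<Longrightarrow> C1_with_gradient \<psi> \<psi>' \<Longrightarrow> C1_with_gradient (\<lambda>x. \<phi> x - \<psi> x) (\<lambda>x. \<phi>' x - \<psi>' x)"
  unfolding C1_with_gradient_def by (blast intro: GDERIV_diff continuous_on_diff)

lemma C1_with_gradient_mult:
  assumes "C1_with_gradient \<phi> \<phi>'" "C1_with_gradient \<psi> \<psi>'"
  shows "C1_with_gradient (\<lambda>x. \<phi> x * \<psi> x) (\<lambda>x. \<phi> x *\<^sub>R \<psi>' x + \<psi> x *\<^sub>R \<phi>' x)"
  unfolding C1_with_gradient_def
proof (intro conjI allI)
  show "GDERIV (\<lambda>x. \<phi> x * \<psi> x) x :> \<phi> x *\<^sub>R \<psi>' x + \<psi> x *\<^sub>R \<phi>' x" for x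
    using assms by (intro GDERIV_mult) (auto simp: C1_with_gradient_def)
  show "continuous_on UNIV (\<lambda>x. \<phi> x *\<^sub>R \<psi>' x + \<psi> x *\<^sub>R \<phi>' x)"
    by (intro continuous_intros C1_with_gradient_continuous[OF assms(1)] C1_with_gradient_continuous[OF assms(2)])
qed

lemma C1_with_gradient_zero_outside_support:
  assumes C1: "C1_with_gradient \<eta> \<eta>'" and x: "x \<notin> closure {x. \<eta> x \<noteq> 0}"
  shows "\<eta> x = 0" "\<eta>' x = 0"
proof -
  show "\<eta> x = 0" using x closure_subset[of "{x. \<eta> x \<noteq> 0}"] by blast
  have d: "(\<eta> has_derivative (\<lambda>h. h \<bullet> \<eta>' x)) (at x)"
    using C1 by (simp add: C1_with_gradient_def gderiv_def)
  have "((\<lambda>_. 0::real) has_derivative (\<lambda>h. h \<bullet> \<eta>' x)) (at x)"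
  proof (rule has_derivative_transform_within_open[OF d])
    show "open (- closure {x. \<eta> x \<noteq> 0})" by auto
    show "x \<in> - closure {x. \<eta> x \<noteq> 0}" using x by simp
    show "\<And>y. y \<in> - closure {x. \<eta> x \<noteq> 0} \<Longrightarrow> \<eta> y = 0"
      using closure_subset[of "{x. \<eta> x \<noteq> 0}"] by blast
  qed
  then have "(\<lambda>h. h \<bullet> \<eta>' x) = (\<lambda>h. 0)"
    by (rule has_derivative_unique) simp
  then have "\<eta>' x \<bullet> \<eta>' x = 0" by (rule fun_cong)
  then show "\<eta>' x = 0" by simp
qed

lemma C1_with_gradient_affine:
  assumes C1: "C1_with_gradient \<phi> \<phi>'"
  shows "C1_with_gradient (\<lambda>x. \<phi> (l *\<^sub>R x + z)) (\<lambda>x. l *\<^sub>R \<phi>' (l *\<^sub>R x + z))"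
  unfolding C1_with_gradient_def
proof (intro conjI allI)
  fix x
  have "(\<phi> has_derivative (\<lambda>h. h \<bullet> \<phi>' (l *\<^sub>R x + z))) (at (l *\<^sub>R x + z))"
    using C1 by (simp add: C1_with_gradient_def gderiv_def)
  then have "((\<lambda>x. \<phi> (l *\<^sub>R x + z)) has_derivative (\<lambda>h. (l *\<^sub>R h) \<bullet> \<phi>' (l *\<^sub>R x + z))) (at x)"
    by (intro has_derivative_compose[of "\<lambda>x. l *\<^sub>R x + z" _ x UNIV \<phi>]) (auto intro!: derivative_eq_intros)
  then show "GDERIV (\<lambda>x. \<phi> (l *\<^sub>R x + z)) x :> l *\<^sub>R \<phi>' (l *\<^sub>R x + z)" by (simp add: gderiv_def)
  show "continuous_on UNIV (\<lambda>x. l *\<^sub>R \<phi>' (l *\<^sub>R x + z))"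
    by (intro continuous_intros continuous_on_compose2[OF C1_with_gradient_continuous(2)[OF C1, of UNIV]]) auto
qed

text \<open>Squaring removes the kink of the positive part; this supplies the C1 cut-off in the
  mollifier.\<close>

lemma max_square_DERIV: "((\<lambda>t::real. (max 0 t)\<^sup>2) has_real_derivative 2 * max 0 t) (at t)"
proof -
  consider "t > 0" | "t < 0" | "t = 0" by linarith
  then show ?thesis
  proof cases
    case 1
    have "((\<lambda>t::real. t\<^sup>2) has_real_derivative 2 * t) (at t)"
      by (auto intro!: derivative_eq_intros)
    then have "((\<lambda>t::real. (max 0 t)\<^sup>2) has_real_derivative 2 * t) (at t)"
      by (rule has_field_derivative_transform_within_open[where S="{0<..}"]) (use 1 in auto)
    then show ?thesis using 1 by simp
  next
    case 2
    have "((\<lambda>t::real. 0) has_real_derivative 0) (at t)"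
      by auto
    then have "((\<lambda>t::real. (max 0 t)\<^sup>2) has_real_derivative 0) (at t)"
      by (rule has_field_derivative_transform_within_open[where S="{..<0}"]) (use 2 in auto)
    then show ?thesis using 2 by simp
  next
    case 3
    have "((\<lambda>h. ((max 0 (0 + h))\<^sup>2 - (max 0 0)\<^sup>2) / h) \<longlongrightarrow> 0) (at (0::real))"
    proof (rule Lim_null_comparison)
      show "\<forall>\<^sub>F h in at (0::real). norm (((max 0 (0 + h))\<^sup>2 - (max 0 0)\<^sup>2) / h) \<le> \<bar>h\<bar>"
        by (auto intro!: always_eventually simp: max_def power2_eq_square)
      show "((\<lambda>h. \<bar>h\<bar>) \<longlongrightarrow> 0) (at (0::real))"
        by (auto intro!: tendsto_eq_intros)
    qed
    then show ?thesis
      unfolding DERIV_def using 3 by simp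
  qed
qed

text \<open>Test functions are C1 here, so the normalised square of max 0 (e^2 - |w|^2) can serve as
  kernel, with elementary bounds on its values and its gradient.\<close>

lemma mollifier_exists:
  assumes "0 < (e::real)"
  obtains k :: "pt \<Rightarrow> real" and k' L where "C1_with_gradient k k'" "\<And>w. 0 \<le> k w" "\<And>w. k w \<le> L" "\<And>w. norm (k' w) \<le> L"
    "\<And>w. e \<le> norm w \<Longrightarrow> k w = 0" "integrable lborel k" "(LINT w|lborel. k w) = 1"
proof -
  define m where "m w = max 0 (e\<^sup>2 - w \<bullet> w)" for w :: pt
  define q where "q w = (m w)\<^sup>2" for w
  have m: "0 \<le> m w" "m w \<le> e\<^sup>2" for w
    by (auto simp: m_def)
  have m0: "m w = 0" if "e \<le> norm w" for w
  proof -
    have "e\<^sup>2 \<le> w \<bullet> w" using that assms by (simp add: dot_square_norm power_mono)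
    then show ?thesis by (simp add: m_def)
  qed
  have contm: "continuous_on UNIV m"
    unfolding m_def by (intro continuous_intros)
  have contq: "continuous_on UNIV q"
    unfolding q_def by (intro continuous_intros contm)
  have grad: "GDERIV q w :> (2 * m w) *\<^sub>R (- (2 *\<^sub>R w))" for w
  proof -
    have "GDERIV (\<lambda>w. e\<^sup>2 - w \<bullet> w) w :> (- (2 *\<^sub>R w))"
      unfolding gderiv_def
      by (auto intro!: derivative_eq_intros simp: inner_commute)
    from GDERIV_DERIV_compose[OF this max_square_DERIV] show ?thesis
      by (simp add: q_def[abs_def] m_def)
  qed
  have qint: "integrable lborel q"
  proof -
    have "integrable lborel (\<lambda>x. indicator (cball 0 e) x *\<^sub>R q x)"
      by (intro borel_integrable_compact continuous_on_subset[OF contq]) auto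
    moreover have "indicator (cball 0 e) x *\<^sub>R q x = q x" for x
      using m0[of x] by (auto simp: indicator_def q_def)
    ultimately have "(\<lambda>x. indicator (cball 0 e) x *\<^sub>R q x) = q" by blast
    with \<open>integrable lborel (\<lambda>x. indicator (cball 0 e) x *\<^sub>R q x)\<close> show ?thesis by simp
  qed
  define c where "c = (LINT w|lborel. q w)"
  \<comment> \<open>A vanishing mass would make the open ball of radius \<open>e\<close>, where
    \<open>q\<close> is positive, negligible.\<close>
  have "c > 0"
  proof -
    have "0 \<le> c" unfolding c_def by (rule integral_nonneg_AE) (simp add: q_def)
    moreover have "c \<noteq> 0"
    proof
      assume "c = 0"
      then have "AE w in lborel. q w = 0"
        using integral_nonneg_eq_0_iff_AE[OF qint] unfolding c_def by (simp add: q_def)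
      then have "AE w in lebesgue. q w = 0"
        by (rule AE_completion)
      then have "AE w in lebesgue. w \<notin> ball (0::pt) e"
      proof (rule AE_mp)
        show "AE w in lebesgue. q w = 0 \<longrightarrow> w \<notin> ball 0 e"
        proof (intro AE_I2 impI notI)
          fix w assume "q w = 0" "w \<in> ball (0::pt) e"
          moreover have "w \<bullet> w < e\<^sup>2" using \<open>w \<in> ball 0 e\<close> by (simp add: dot_square_norm power_strict_mono)
          ultimately show False by (simp add: q_def m_def)
        qed
      qed
      then have "negligible (ball (0::pt) e)"
        by (simp add: negligible_iff_null_sets AE_iff_null_sets)
      then show False
        using open_not_negligible[of "ball (0::pt) e"] assms by auto
    qed
    ultimately show ?thesis by simp
  qed
  define k where "k w = q w / c" for w
  define k' where "k' w = (1/c) *\<^sub>R ((2 * m w) *\<^sub>R (- (2 *\<^sub>R w)))" for w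
  have k'b: "norm (k' w) \<le> 4 * e^3 / c" for w
  proof (cases "e \<le> norm w")
    case False
    have "m w * norm w \<le> e\<^sup>2 * e" using m[of w] False by (intro mult_mono) auto
    then show ?thesis using \<open>c > 0\<close> m[of w] by (simp add: k'_def divide_right_mono power3_eq_cube power2_eq_square)
  qed (use assms \<open>c > 0\<close> in \<open>auto simp: k'_def m0\<close>)
  show thesis
  \<comment> \<open>The two summands bound \<open>k\<close> and its gradient separately; their sum
    is one bound for both.\<close>
  proof (rule that[of k k' "e^4/c + 4 * e^3 / c"])
    show "C1_with_gradient k k'"
      unfolding C1_with_gradient_def
    proof (intro conjI allI)
      fix w
      show "GDERIV k w :> k' w"
        using grad[of w] unfolding gderiv_def k_def[abs_def] k'_def
        by (auto intro!: derivative_eq_intros ext simp: divide_inverse mult.commute)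
      show "continuous_on UNIV k'"
        unfolding k'_def by (intro continuous_intros contm)
    qed
    show "0 \<le> k w" for w using \<open>c > 0\<close> by (simp add: k_def q_def)
    show "norm (k' w) \<le> e^4/c + 4 * e^3 / c" for w
      using k'b[of w] \<open>c > 0\<close> assms by (smt (verit) divide_nonneg_pos zero_le_power)
    show "k w \<le> e^4/c + 4 * e^3 / c" for w
    proof -
      have "q w \<le> (e\<^sup>2)\<^sup>2" unfolding q_def by (rule power_mono) (use m in auto)
      then have "k w \<le> e^4/c" using \<open>c > 0\<close> by (simp add: k_def divide_right_mono)
      moreover have "0 \<le> 4 * e^3/c" using \<open>c > 0\<close> assms by simp
      ultimately show ?thesis by linarith
    qed
    show "e \<le> norm w \<Longrightarrow> k w = 0" for w by (simp add: k_def q_def m0)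
    show "integrable lborel k" unfolding k_def using qint by simp
    show "(LINT w|lborel. k w) = 1" unfolding k_def using \<open>c > 0\<close> by (simp add: c_def[symmetric])
  qed
qed

text \<open>The bound \<open>L\<close> on the gradients makes each \<open>k y\<close> Lipschitz, so
  the remainder quotients are dominated by 2 L |F|. Differentiability and continuity of the
  derivative then both follow by dominated convergence.\<close>

lemma C1_with_gradient_integral:
  fixes F :: "pt \<Rightarrow> real"
  assumes F: "integrable lborel F"
    and k: "\<And>y. C1_with_gradient (k y) (k' y)" and kb: "\<And>y x. \<bar>k y x\<bar> \<le> L" and k'b: "\<And>y x. norm (k' y x) \<le> L"
    and mk[measurable]: "\<And>x. (\<lambda>y. k y x) \<in> borel_measurable borel"
    and mk'[measurable]: "\<And>x. (\<lambda>y. k' y x) \<in> borel_measurable borel"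
  shows "C1_with_gradient (\<lambda>x. LINT y|lborel. F y * k y x) (\<lambda>x. LINT y|lborel. F y *\<^sub>R k' y x)"
  unfolding C1_with_gradient_def
proof (intro conjI allI)
  have mF[measurable]: "F \<in> borel_measurable borel" using F by auto
  have iF: "integrable lborel (\<lambda>y. L * \<bar>F y\<bar>)"
    using F by (intro integrable_mult_right integrable_abs)
  have L0: "0 \<le> L" using kb[of undefined undefined] by linarith
  have ik: "integrable lborel (\<lambda>y. F y * k y x)" for x
    by (rule Bochner_Integration.integrable_bound[OF iF])
       (use kb L0 in \<open>auto intro!: AE_I2 mult_left_mono simp: abs_mult mult.commute[of L]\<close>)
  have ik': "integrable lborel (\<lambda>y. F y *\<^sub>R k' y x)" for x
    by (rule Bochner_Integration.integrable_bound[OF iF])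
       (use k'b L0 in \<open>auto intro!: AE_I2 mult_left_mono simp: abs_mult mult.commute[of L]\<close>)
  have g: "GDERIV (k y) x :> k' y x" and ck': "continuous_on UNIV (k' y)" for y x
    using k by (auto simp: C1_with_gradient_def)
  have lip: "\<bar>k y (x + h) - k y x\<bar> \<le> L * norm h" for y x h
  proof -
    have "norm (k y (x + h) - k y x) \<le> L * norm (x + h - x)"
    proof (rule differentiable_bound[of UNIV "k y" "\<lambda>x h. h \<bullet> k' y x"])
      show "(k y has_derivative (\<lambda>h. h \<bullet> k' y x)) (at x within UNIV)" for x
        using g[of y x] by (simp add: gderiv_def)
      show "onorm (\<lambda>h. h \<bullet> k' y x) \<le> L" for x
        by (rule onorm_bound) (use L0 k'b[of y x] in \<open>auto intro!: order_trans[OF Cauchy_Schwarz_ineq2] simp: mult.commute[of L] mult_left_mono\<close>)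
    qed auto
    then show ?thesis by simp
  qed
  show "continuous_on UNIV (\<lambda>x. LINT y|lborel. F y *\<^sub>R k' y x)"
    unfolding continuous_on_sequentially
  proof (intro allI ballI impI, elim conjE)
    fix xs :: "nat \<Rightarrow> pt" and x assume xs: "xs \<longlonglongrightarrow> x"
    have "(\<lambda>n. LINT y|lborel. F y *\<^sub>R k' y (xs n)) \<longlonglongrightarrow> (LINT y|lborel. F y *\<^sub>R k' y x)"
    proof (rule integral_dominated_convergence[OF _ _ iF])
      show "AE y in lborel. (\<lambda>n. F y *\<^sub>R k' y (xs n)) \<longlonglongrightarrow> F y *\<^sub>R k' y x"
        using xs ck' by (intro AE_I2 tendsto_intros continuous_on_tendsto_compose[where f="k' _" and s=UNIV]) auto
      show "AE y in lborel. norm (F y *\<^sub>R k' y (xs n)) \<le> L * \<bar>F y\<bar>" for n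
        using k'b by (auto simp: mult.commute[of L] intro!: mult_left_mono)
    qed auto
    then show "((\<lambda>x. LINT y|lborel. F y *\<^sub>R k' y x) \<circ> xs) \<longlonglongrightarrow> (LINT y|lborel. F y *\<^sub>R k' y x)"
      by (simp add: o_def)
  qed
  fix x
  let ?f = "\<lambda>x. LINT y|lborel. F y * k y x" and ?D = "LINT y|lborel. F y *\<^sub>R k' y x"
  show "GDERIV ?f x :> ?D"
    unfolding gderiv_def has_derivative_at
  proof (intro conjI)
    show "bounded_linear (\<lambda>h. h \<bullet> ?D)" by (rule bounded_linear_inner_left)
    show "(\<lambda>h. norm (?f (x + h) - ?f x - h \<bullet> ?D) / norm h) \<midarrow>0\<rightarrow> 0"
      unfolding tendsto_at_iff_sequentially
    proof (intro allI impI)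
      fix h :: "nat \<Rightarrow> pt" assume h0: "\<forall>i. h i \<in> UNIV - {0}" and h: "h \<longlonglongrightarrow> 0"
      let ?r = "\<lambda>n y. F y * ((k y (x + h n) - k y x - h n \<bullet> k' y x) / norm (h n))"
      have eq: "?f (x + h n) - ?f x - h n \<bullet> ?D = (LINT y|lborel. ?r n y) * norm (h n)" for n
      proof -
        have i3: "integrable lborel (\<lambda>y. F y * (h n \<bullet> k' y x))"
          using integrable_inner_right[of "h n", OF ik'[of x]] by simp
        have "h n \<bullet> ?D = (LINT y|lborel. h n \<bullet> (F y *\<^sub>R k' y x))"
          by (rule integral_inner_right[symmetric]) (use ik' in auto)
        then have "?f (x + h n) - ?f x - h n \<bullet> ?D = (LINT y|lborel. F y * k y (x + h n) - F y * k y x - F y * (h n \<bullet> k' y x))"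
          using ik i3 by simp
        also have "\<dots> = (LINT y|lborel. ?r n y * norm (h n))"
        proof (intro Bochner_Integration.integral_cong refl)
          fix y
          have "norm (h n) \<noteq> 0" using h0 by simp
          then show "F y * k y (x + h n) - F y * k y x - F y * (h n \<bullet> k' y x) = ?r n y * norm (h n)"
            by (simp add: right_diff_distrib)
        qed
        finally show ?thesis by simp
      qed
      have "(\<lambda>n. LINT y|lborel. ?r n y) \<longlonglongrightarrow> (LINT y|(lborel::pt measure). 0)"
      proof (rule integral_dominated_convergence[where w="\<lambda>y. 2 * (L * \<bar>F y\<bar>)"])
        show "AE y in lborel. (\<lambda>n. ?r n y) \<longlonglongrightarrow> 0"
        proof (intro AE_I2)
          fix y
          have "(\<lambda>h. norm (k y (x + h) - k y x - h \<bullet> k' y x) / norm h) \<midarrow>0\<rightarrow> 0"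
            using g[of y x] unfolding gderiv_def has_derivative_at by simp
          then have "(\<lambda>n. norm (k y (x + h n) - k y x - h n \<bullet> k' y x) / norm (h n)) \<longlonglongrightarrow> 0"
            using h0 h by (auto simp: tendsto_at_iff_sequentially o_def)
          then have "(\<lambda>n. norm ((k y (x + h n) - k y x - h n \<bullet> k' y x) / norm (h n))) \<longlonglongrightarrow> 0"
            by simp
          then show "(\<lambda>n. ?r n y) \<longlonglongrightarrow> 0"
            by (intro tendsto_mult_right_zero) (simp only: tendsto_norm_zero_iff)
        qed
        show "AE y in lborel. norm (?r n y) \<le> 2 * (L * \<bar>F y\<bar>)" for n
        proof (intro AE_I2)
          fix y
          have "\<bar>h n \<bullet> k' y x\<bar> \<le> L * norm (h n)"
            using k'b[of y x] by (intro order_trans[OF Cauchy_Schwarz_ineq2]) (simp add: mult.commute[of L] mult_left_mono)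
          then have "\<bar>k y (x + h n) - k y x - h n \<bullet> k' y x\<bar> \<le> 2 * L * norm (h n)"
            using lip[of y x "h n"] by linarith
          then have "\<bar>(k y (x + h n) - k y x - h n \<bullet> k' y x) / norm (h n)\<bar> \<le> 2 * L"
            using h0 by (simp add: divide_le_eq)
          then have "\<bar>F y\<bar> * \<bar>(k y (x + h n) - k y x - h n \<bullet> k' y x) / norm (h n)\<bar> \<le> \<bar>F y\<bar> * (2 * L)"
            by (rule mult_left_mono) simp
          then show "norm (?r n y) \<le> 2 * (L * \<bar>F y\<bar>)"
            by (simp only: real_norm_def abs_mult) (simp add: ac_simps)
        qed
      qed (use iF in auto)
      then have "(\<lambda>n. \<bar>LINT y|lborel. ?r n y\<bar>) \<longlonglongrightarrow> 0"
        by (intro tendsto_rabs_zero) (simp only: integral_zero)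
      moreover have "(\<lambda>h. norm (?f (x + h) - ?f x - h \<bullet> ?D) / norm h) \<circ> h = (\<lambda>n. \<bar>LINT y|lborel. ?r n y\<bar>)"
      proof
        fix n
        have "norm (h n) \<noteq> 0" using h0 by simp
        then show "((\<lambda>h. norm (?f (x + h) - ?f x - h \<bullet> ?D) / norm h) \<circ> h) n = \<bar>LINT y|lborel. ?r n y\<bar>"
          unfolding o_def eq real_norm_def abs_mult abs_norm_cancel by (rule nonzero_mult_div_cancel_right)
      qed
      ultimately show "((\<lambda>h. norm (?f (x + h) - ?f x - h \<bullet> ?D) / norm h) \<circ> h) \<longlonglongrightarrow> 0"
        by (simp only: )
    qed
  qed
qed

section \<open>Restricted Lebesgue measure and Borel representatives\<close>

lemma integrable_lebesgue_on_iff: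
  fixes f :: "'a::euclidean_space \<Rightarrow> 'b::{banach, second_countable_topology}"
  assumes "A \<in> sets lebesgue"
  shows "integrable (lebesgue_on A) f \<longleftrightarrow> integrable lebesgue (\<lambda>x. indicator A x *\<^sub>R f x)"
  using assms by (intro integrable_restrict_space) auto

lemma integral_lebesgue_on_eq:
  fixes f :: "'a::euclidean_space \<Rightarrow> 'b::{banach, second_countable_topology}"
  assumes "A \<in> sets lebesgue"
  shows "(LINT x|lebesgue_on A. f x) = (LINT x|lebesgue. indicator A x *\<^sub>R f x)"
  using assms by (intro integral_restrict_space) auto

lemma integrable_lebesgue_on_subset:
  fixes h :: "'a::euclidean_space \<Rightarrow> 'c::{banach,second_countable_topology}"
  assumes "integrable (lebesgue_on A) h" "A \<in> sets lebesgue" "B \<in> sets lebesgue" "B \<subseteq> A"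
  shows "integrable (lebesgue_on B) h"
proof -
  have "integrable lebesgue (\<lambda>x. indicator B x *\<^sub>R (indicator A x *\<^sub>R h x))"
    using assms by (intro integrable_mult_indicator[where f="\<lambda>x. indicator A x *\<^sub>R h x"]) (auto simp: integrable_lebesgue_on_iff)
  moreover have "(\<lambda>x. indicator B x *\<^sub>R (indicator A x *\<^sub>R h x)) = (\<lambda>x. indicator B x *\<^sub>R h x)"
    using assms(4) by (auto simp: indicator_def fun_eq_iff)
  ultimately show ?thesis using assms by (simp only: integrable_lebesgue_on_iff)
qed

lemma AE_lebesgue_on_iff:
  assumes "A \<in> sets lebesgue"
  shows "(AE x in lebesgue_on A. P x) \<longleftrightarrow> (AE x in lebesgue. x \<in> A \<longrightarrow> P x)"
  using assms by (intro AE_restrict_space_iff) auto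

text \<open>Affine substitution and Fubini are used for \<open>lborel\<close>, whereas the functions
  of the problem are only Lebesgue measurable; a modification on a null set, made component by
  component, bridges the two.\<close>

lemma borel_representative:
  fixes f :: "'a::euclidean_space \<Rightarrow> 'b::euclidean_space"
  assumes f: "integrable lebesgue f"
  obtains F where "integrable lborel F" "AE x in lebesgue. F x = f x"
proof -
  have fm: "f \<in> borel_measurable lebesgue" using f by auto
  have "\<forall>b\<in>Basis. \<exists>g. g \<in> borel_measurable lborel \<and> (AE x in lborel. f x \<bullet> b = g x)"
  proof
    fix b :: 'b assume "b \<in> Basis"
    have "(\<lambda>x. f x \<bullet> b) \<in> borel_measurable (completion lborel)"
      using fm by (intro borel_measurable_inner) auto
    from completion_ex_borel_measurable_real[OF this]
    show "\<exists>g. g \<in> borel_measurable lborel \<and> (AE x in lborel. f x \<bullet> b = g x)" by blast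
  qed
  then obtain g where g: "\<And>b. b \<in> Basis \<Longrightarrow> g b \<in> borel_measurable lborel"
    "\<And>b. b \<in> Basis \<Longrightarrow> AE x in lborel. f x \<bullet> b = g b x"
    by metis
  define F where "F x = (\<Sum>b\<in>Basis. g b x *\<^sub>R b)" for x
  have Fm: "F \<in> borel_measurable lborel"
    unfolding F_def using g by (intro borel_measurable_sum borel_measurable_scaleR) auto
  have "AE x in lborel. \<forall>b\<in>Basis. f x \<bullet> b = g b x"
    using g(2) by (intro AE_finite_allI) auto
  then have "AE x in lborel. F x = f x"
  proof (rule AE_mp, intro AE_I2 impI)
    fix x assume "\<forall>b\<in>Basis. f x \<bullet> b = g b x"
    then have "F x = (\<Sum>b\<in>Basis. (f x \<bullet> b) *\<^sub>R b)"
      unfolding F_def by (intro sum.cong) auto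
    then show "F x = f x" by (simp add: euclidean_representation)
  qed
  then have ae: "AE x in lebesgue. F x = f x" by (rule AE_completion)
  have "integrable lebesgue F"
    using integrable_cong_AE_imp[OF f, of F] ae measurable_completion[OF Fm] by (simp add: eq_commute)
  then have "integrable lborel F"
    using integrable_completion[OF Fm] by simp
  then show ?thesis using ae that by blast
qed

lemma borel_representative_on:
  fixes f :: "'a::euclidean_space \<Rightarrow> 'b::euclidean_space"
  assumes "integrable (lebesgue_on U) f" "U \<in> sets lebesgue"
  obtains F where "integrable lborel F" "AE x in lebesgue. F x = indicator U x *\<^sub>R f x"
  using assms borel_representative[of "\<lambda>x. indicator U x *\<^sub>R f x"] by (auto simp: integrable_lebesgue_on_iff)

section \<open>Weak gradients tested with mollifiers, and density of C1 functions\<close>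

lemma weak_gradient_test:
  assumes "weak_gradient U u D" "C1_with_gradient \<eta> \<eta>'" "compact (closure {x. \<eta> x \<noteq> 0})" "closure {x. \<eta> x \<noteq> 0} \<subseteq> U"
  shows "(LINT x|lebesgue_on U. u x *\<^sub>R \<eta>' x) = - (LINT x|lebesgue_on U. \<eta> x *\<^sub>R D x)"
  using assms(1)[unfolded weak_gradient_def, THEN conjunct2, rule_format, of \<eta> \<eta>'] assms(2-4) by simp

text \<open>As a function of y, k (y - z) is an admissible test function, because its support lies
  in \<open>cball z e\<close>. The identity is the defining one of the weak gradient, read on Borel
  representatives of the functions extended by zero.\<close>

lemma weak_gradient_mollifier:
  fixes z :: pt
  assumes U: "open U" and wg: "weak_gradient U u D"
    and iu: "integrable (lebesgue_on U) u" and iD: "integrable (lebesgue_on U) D"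
    and F: "integrable lborel F" "AE x in lebesgue. F x = indicator U x *\<^sub>R u x"
    and G: "integrable lborel G" "AE x in lebesgue. G x = indicator U x *\<^sub>R D x"
    and k: "C1_with_gradient k k'" and supp: "\<And>w. e \<le> norm w \<Longrightarrow> k w = 0" and z: "cball z e \<subseteq> U"
  shows "(LINT y|lborel. F y *\<^sub>R k' (y - z)) = - (LINT y|lborel. k (y - z) *\<^sub>R G y)"
proof -
  have Us: "U \<in> sets lebesgue" using U by auto
  have mF[measurable]: "F \<in> borel_measurable borel" and mG[measurable]: "G \<in> borel_measurable borel"
    using F G by auto
  have mu: "(\<lambda>x. indicator U x *\<^sub>R u x) \<in> borel_measurable lebesgue"
    and mD: "(\<lambda>x. indicator U x *\<^sub>R D x) \<in> borel_measurable lebesgue"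
    using iu iD Us by (auto simp: integrable_lebesgue_on_iff)
  note ck = C1_with_gradient_continuous[OF k, of UNIV]
  have [measurable]: "k \<in> borel_measurable borel" "k' \<in> borel_measurable borel"
    using ck by (auto intro: borel_measurable_continuous_onI)
  have eta: "C1_with_gradient (\<lambda>y. k (y - z)) (\<lambda>y. k' (y - z))"
    using C1_with_gradient_affine[OF k, of 1 "- z"] by simp
  have "{x. k (x - z) \<noteq> 0} \<subseteq> cball z e"
  proof
    fix x assume "x \<in> {x. k (x - z) \<noteq> 0}"
    then have "norm (x - z) < e" using supp[of "x - z"] by force
    then show "x \<in> cball z e" by (simp add: dist_norm norm_minus_commute)
  qed
  then have cl: "closure {x. k (x - z) \<noteq> 0} \<subseteq> cball z e"
    by (intro closure_minimal) auto
  then have comp: "compact (closure {x. k (x - z) \<noteq> 0})"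
    using bounded_subset[OF bounded_cball cl] by (simp add: compact_eq_bounded_closed)
  have eq: "(LINT x|lebesgue_on U. u x *\<^sub>R k' (x - z)) = - (LINT x|lebesgue_on U. k (x - z) *\<^sub>R D x)"
    by (rule weak_gradient_test[OF wg eta comp order_trans[OF cl z]])
  have "(LINT x|lebesgue_on U. u x *\<^sub>R k' (x - z)) = (LINT x|lebesgue. (indicator U x *\<^sub>R u x) *\<^sub>R k' (x - z))"
    using Us by (simp add: integral_lebesgue_on_eq)
  also have "\<dots> = (LINT x|lebesgue. F x *\<^sub>R k' (x - z))"
  proof (rule integral_cong_AE)
    show "AE x in lebesgue. (indicator U x *\<^sub>R u x) *\<^sub>R k' (x - z) = F x *\<^sub>R k' (x - z)"
      using F(2) by eventually_elim simp
    show "(\<lambda>x. F x *\<^sub>R k' (x - z)) \<in> borel_measurable lebesgue"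
      by (rule measurable_completion) measurable
    have "(\<lambda>x. k' (x - z)) \<in> borel_measurable lebesgue"
      by (rule measurable_completion) measurable
    then show "(\<lambda>x. (indicator U x *\<^sub>R u x) *\<^sub>R k' (x - z)) \<in> borel_measurable lebesgue"
      by (rule borel_measurable_scaleR[OF mu])
  qed
  also have "\<dots> = (LINT x|lborel. F x *\<^sub>R k' (x - z))"
    by (rule integral_completion) measurable
  finally have 1: "(LINT x|lebesgue_on U. u x *\<^sub>R k' (x - z)) = (LINT x|lborel. F x *\<^sub>R k' (x - z))" .
  have "(LINT x|lebesgue_on U. k (x - z) *\<^sub>R D x) = (LINT x|lebesgue. k (x - z) *\<^sub>R (indicator U x *\<^sub>R D x))"
    using Us by (simp add: integral_lebesgue_on_eq mult.commute)
  also have "\<dots> = (LINT x|lebesgue. k (x - z) *\<^sub>R G x)"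
  proof (rule integral_cong_AE)
    show "AE x in lebesgue. k (x - z) *\<^sub>R (indicator U x *\<^sub>R D x) = k (x - z) *\<^sub>R G x"
      using G(2) by eventually_elim simp
    show "(\<lambda>x. k (x - z) *\<^sub>R G x) \<in> borel_measurable lebesgue"
      by (rule measurable_completion) measurable
    have "(\<lambda>x. k (x - z)) \<in> borel_measurable lebesgue"
      by (rule measurable_completion) measurable
    then show "(\<lambda>x. k (x - z) *\<^sub>R (indicator U x *\<^sub>R D x)) \<in> borel_measurable lebesgue"
      by (rule borel_measurable_scaleR[OF _ mD])
  qed
  also have "\<dots> = (LINT x|lborel. k (x - z) *\<^sub>R G x)"
    by (rule integral_completion) measurable
  finally show ?thesis using eq 1 by simp
qed

lemma integral_lebesgue_on_le_lborel:
  fixes H :: "'a::euclidean_space \<Rightarrow> real"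
  assumes "A \<in> sets lebesgue" "integrable lborel H" "AE x in lebesgue. x \<in> A \<longrightarrow> h x \<le> H x" "\<And>x. 0 \<le> H x"
  shows "(LINT x|lebesgue_on A. h x) \<le> (LINT x|lborel. H x)"
proof -
  have Hm: "H \<in> borel_measurable lborel" using assms by auto
  have "(LINT x|lebesgue_on A. h x) = (LINT x|lebesgue. indicator A x *\<^sub>R h x)"
    using assms by (simp add: integral_lebesgue_on_eq)
  also have "\<dots> \<le> (LINT x|lebesgue. H x)"
  proof (rule integral_mono_AE')
    show "integrable lebesgue H" using assms integrable_completion[OF Hm] by simp
    show "AE x in lebesgue. indicator A x *\<^sub>R h x \<le> H x"
      using assms(3) by eventually_elim (use assms(4) in \<open>auto simp: indicator_def\<close>)
  qed (use assms in auto)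
  also have "\<dots> = (LINT x|lborel. H x)"
    using Hm by (rule integral_completion)
  finally show ?thesis .
qed

text \<open>The contracted copy of the compact set \<open>S\<close> lies in the open set
  \<open>U\<close>, so closed balls of one fixed radius around its points do too, and kernels
  centred there are admissible. The star condition excludes t = 0, so that \<open>S\<close> may
  touch the boundary of \<open>U\<close>.\<close>

lemma W11_approx_step:
  fixes u :: "pt \<Rightarrow> real" and D :: "pt \<Rightarrow> pt"
  assumes S: "compact S" and U: "open U" and wg: "weak_gradient U u D"
    and iu: "integrable (lebesgue_on U) u" and iD: "integrable (lebesgue_on U) D"
    and star: "\<And>x t. x \<in> S \<Longrightarrow> 0 < t \<Longrightarrow> t \<le> 1 \<Longrightarrow> (1 - t) *\<^sub>R x + t *\<^sub>R c \<in> U"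
    and e: "0 < e"
  obtains \<phi> \<phi>' where "C1_with_gradient \<phi> \<phi>'"
    "(LINT x|lebesgue_on (S \<inter> U). \<bar>\<phi> x - u x\<bar>) \<le> e"
    "(LINT x|lebesgue_on (S \<inter> U). norm (\<phi>' x - D x)) \<le> e"
proof -
  have Us: "U \<in> sets lebesgue" and SUs: "S \<inter> U \<in> sets lebesgue"
    using U S by (auto intro!: sets.Int simp: compact_imp_closed borel_closed)
  obtain F where F: "integrable lborel F" "AE x in lebesgue. F x = indicator U x *\<^sub>R u x"
    using borel_representative_on[OF iu Us] .
  obtain G where G: "integrable lborel G" "AE x in lebesgue. G x = indicator U x *\<^sub>R D x"
    using borel_representative_on[OF iD Us] .
  have mF[measurable]: "F \<in> borel_measurable borel" and mG[measurable]: "G \<in> borel_measurable borel"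
    using F G by auto
  have e2: "0 < e/2" using e by simp
  obtain d1 where d1: "0 < d1" "d1 < 1" "\<And>l b. \<bar>l - 1\<bar> < d1 \<Longrightarrow> norm b < d1 \<Longrightarrow> (LINT x|lborel. norm (F (l *\<^sub>R x + b) - F x)) < e/2"
    using affine_L1_uniform[OF F(1) e2] by blast
  obtain d2 where d2: "0 < d2" "d2 < 1" "\<And>l b. \<bar>l - 1\<bar> < d2 \<Longrightarrow> norm b < d2 \<Longrightarrow> (LINT x|lborel. norm (G (l *\<^sub>R x + b) - G x)) < e/2"
    using affine_L1_uniform[OF G(1) e2] by blast
  define d where "d = min d1 d2"
  have d: "0 < d" "d < 1" using d1 d2 by (auto simp: d_def)
  define I where "I = (LINT x|lborel. norm (G x))"
  have I0: "0 \<le> I" unfolding I_def by simp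
  \<comment> \<open>The first bound keeps the shift t c and the change 1 - l small compared with
    \<open>d\<close>. The second pays for the factor l = 1 - t that the chain rule puts in front of
    the gradient, an error of t times the L1 norm \<open>I\<close>. The added 1 keeps both
    denominators positive.\<close>
  define t where "t = min (d / (2 * (1 + norm c))) (e / (2 * (1 + I)))"
  have c1: "0 < 1 + norm c" by (simp add: add_pos_nonneg)
  have t0: "0 < t" using d e I0 c1 by (simp add: t_def)
  have "t * (1 + norm c) \<le> d / 2"
  proof -
    have "t * (1 + norm c) \<le> (d / (2 * (1 + norm c))) * (1 + norm c)"
      by (rule mult_right_mono) (simp_all add: t_def add_nonneg_nonneg)
    also have "\<dots> = d / 2" using c1 by (simp add: field_simps)
    finally show ?thesis .
  qed
  then have td: "t + t * norm c \<le> d / 2" by (simp add: algebra_simps)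
  have tn: "0 \<le> t * norm c" using t0 by simp
  have tc: "t * norm c < d / 2 \<and> t \<le> d / 2" using td t0 tn by linarith
  have t1: "t < d" "t < 1" using tc d by auto
  have tI: "t * I \<le> e / 2"
  proof -
    have "t * (1 + I) \<le> (e / (2 * (1 + I))) * (1 + I)"
      by (rule mult_right_mono) (use I0 in \<open>auto simp: t_def\<close>)
    also have "\<dots> = e / 2" using I0 by (simp add: field_simps)
    finally have "t * (1 + I) \<le> e/2" .
    then show ?thesis using t0 by (simp add: algebra_simps)
  qed
  define l where "l = 1 - t"
  have l: "l \<noteq> 0" "0 < l" "l \<le> 1" "\<bar>l - 1\<bar> < d" using t0 t1 by (auto simp: l_def)
  have "compact ((\<lambda>x. l *\<^sub>R x + t *\<^sub>R c) ` S)"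
    by (intro compact_continuous_image S continuous_intros)
  moreover have "(\<lambda>x. l *\<^sub>R x + t *\<^sub>R c) ` S \<subseteq> U"
    using star t0 t1 by (auto simp: l_def)
  ultimately obtain \<delta> where \<delta>: "\<delta> > 0" "(\<Union>x\<in>(\<lambda>x. l *\<^sub>R x + t *\<^sub>R c) ` S. cball x \<delta>) \<subseteq> U"
    using compact_subset_open_imp_cball_epsilon_subset U by metis
  define \<epsilon> where "\<epsilon> = min \<delta> (d/2)"
  have \<epsilon>: "0 < \<epsilon>" "\<epsilon> \<le> d/2" using \<delta> d by (auto simp: \<epsilon>_def)
  have ball: "cball (l *\<^sub>R x + t *\<^sub>R c) \<epsilon> \<subseteq> U" if "x \<in> S" for x
    using \<delta>(2) that by (force simp: \<epsilon>_def)
  obtain k k' L where k: "C1_with_gradient k k'" "\<And>w. 0 \<le> k w" "\<And>w. k w \<le> L" "\<And>w. norm (k' w) \<le> L"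
    "\<And>w. \<epsilon> \<le> norm w \<Longrightarrow> k w = 0" "integrable lborel k" "(LINT w|lborel. k w) = 1"
    using mollifier_exists[OF \<epsilon>(1)] by blast
  note ck = C1_with_gradient_continuous[OF k(1), of UNIV]
  have [measurable]: "k \<in> borel_measurable borel" "k' \<in> borel_measurable borel"
    using ck by (auto intro: borel_measurable_continuous_onI)
  define b where "b = t *\<^sub>R c"
  have small: "norm (b + w) < d" if "k w \<noteq> 0" for w
  proof -
    have "norm w < \<epsilon>" using that k(5) by force
    moreover have "norm b < d/2" using tc t0 by (simp add: b_def)
    ultimately show ?thesis using \<epsilon> norm_triangle_ineq[of b w] by linarith
  qed
  have eF: "(LINT x|lborel. norm (F (l *\<^sub>R x + (b + w)) - F x)) \<le> e/2" if "k w \<noteq> 0" for w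
    using d1(3)[of l "b + w"] small[OF that] l by (force simp: d_def)
  have eG: "(LINT x|lborel. norm (G (l *\<^sub>R x + (b + w)) - G x)) \<le> e/2" if "k w \<noteq> 0" for w
    using d2(3)[of l "b + w"] small[OF that] l by (force simp: d_def)
  note mollF = mollify_L1_bound[OF F(1) l(1) k(6,2,7,3) eF]
  note mollG = mollify_L1_bound[OF G(1) l(1) k(6,2,7,3) eG]
  define TF where "TF x = (LINT y|lborel. k (y - l *\<^sub>R x - b) *\<^sub>R F y)" for x
  define TG where "TG x = (LINT y|lborel. k (y - l *\<^sub>R x - b) *\<^sub>R G y)" for x
  define \<phi> where "\<phi> x = (LINT y|lborel. F y * k (y - l *\<^sub>R x - b))" for x
  define \<phi>' where "\<phi>' x = (LINT y|lborel. F y *\<^sub>R (- l *\<^sub>R k' (y - l *\<^sub>R x - b)))" for x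
  have \<phi>TF: "\<phi> x = TF x" for x by (simp add: \<phi>_def TF_def mult.commute)
  \<comment> \<open>Differentiating the kernel in x produces -l k'; the weak gradient moves the
    derivative onto \<open>G\<close>. This is the point where the ball around the contracted point
    must lie in \<open>U\<close>, hence the restriction to \<open>S\<close>.\<close>
  have \<phi>'TG: "\<phi>' x = l *\<^sub>R TG x" if "x \<in> S" for x
  proof -
    have "\<phi>' x = - l *\<^sub>R (LINT y|lborel. F y *\<^sub>R k' (y - (l *\<^sub>R x + b)))"
      unfolding \<phi>'_def by (simp only: integral_scaleR_right[symmetric]) (simp add: mult.commute diff_diff_eq)
    also have "\<dots> = l *\<^sub>R TG x"
      using weak_gradient_mollifier[OF U wg iu iD F G k(1) k(5) ball[OF that]]
      by (simp add: TG_def b_def diff_diff_eq)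
    finally show ?thesis .
  qed
  have C1: "C1_with_gradient \<phi> \<phi>'"
    unfolding \<phi>_def \<phi>'_def
  proof (rule C1_with_gradient_integral[OF F(1), where L=L])
    fix y
    show "C1_with_gradient (\<lambda>x. k (y - l *\<^sub>R x - b)) (\<lambda>x. - l *\<^sub>R k' (y - l *\<^sub>R x - b))"
      using C1_with_gradient_affine[OF k(1), of "- l" "y - b"] by (simp add: algebra_simps)
    show "\<bar>k (y - l *\<^sub>R x - b)\<bar> \<le> L" for x using k(2,3) by simp
    show "norm (- l *\<^sub>R k' (y - l *\<^sub>R x - b)) \<le> L" for x
    proof -
      have "l * norm (k' (y - l *\<^sub>R x - b)) \<le> 1 * L" using l k(4) by (intro mult_mono) auto
      then show ?thesis using l by simp
    qed
  qed measurable
  show thesis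
  proof (rule that[OF C1])
    have "(LINT x|lebesgue_on (S \<inter> U). \<bar>\<phi> x - u x\<bar>) \<le> (LINT x|lborel. norm (TF x - F x))"
    proof (rule integral_lebesgue_on_le_lborel[OF SUs])
      show "integrable lborel (\<lambda>x. norm (TF x - F x))"
        unfolding TF_def by (rule integrable_norm[OF mollF(1)])
      show "AE x in lebesgue. x \<in> S \<inter> U \<longrightarrow> \<bar>\<phi> x - u x\<bar> \<le> norm (TF x - F x)"
        using F(2) by eventually_elim (auto simp: \<phi>TF)
    qed auto
    also have "\<dots> \<le> e/2" unfolding TF_def by (rule mollF(2))
    finally show "(LINT x|lebesgue_on (S \<inter> U). \<bar>\<phi> x - u x\<bar>) \<le> e" using e by simp
    have iTG: "integrable lborel (\<lambda>x. norm (TG x - G x))"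
      unfolding TG_def by (rule integrable_norm[OF mollG(1)])
    have iG: "integrable lborel (\<lambda>x. norm (G x))" using G(1) by (rule integrable_norm)
    have "(LINT x|lebesgue_on (S \<inter> U). norm (\<phi>' x - D x)) \<le> (LINT x|lborel. norm (TG x - G x) + t * norm (G x))"
    proof (rule integral_lebesgue_on_le_lborel[OF SUs])
      show "integrable lborel (\<lambda>x. norm (TG x - G x) + t * norm (G x))"
        using iTG iG by simp
      show "AE x in lebesgue. x \<in> S \<inter> U \<longrightarrow> norm (\<phi>' x - D x) \<le> norm (TG x - G x) + t * norm (G x)"
        using G(2)
      proof (eventually_elim, intro impI)
        fix x assume Gx: "G x = indicator U x *\<^sub>R D x" and x: "x \<in> S \<inter> U"
        then have "\<phi>' x - D x = l *\<^sub>R (TG x - G x) - t *\<^sub>R G x"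
          by (simp add: \<phi>'TG l_def algebra_simps)
        also have "norm \<dots> \<le> norm (l *\<^sub>R (TG x - G x)) + norm (t *\<^sub>R G x)" by (rule norm_triangle_ineq4)
        also have "\<dots> = l * norm (TG x - G x) + t * norm (G x)" using l t0 by simp
        also have "\<dots> \<le> 1 * norm (TG x - G x) + t * norm (G x)" using l by (intro add_right_mono mult_right_mono) auto
        finally show "norm (\<phi>' x - D x) \<le> norm (TG x - G x) + t * norm (G x)" by simp
      qed
      show "0 \<le> norm (TG x - G x) + t * norm (G x)" for x using t0 by simp
    qed
    also have "\<dots> = (LINT x|lborel. norm (TG x - G x)) + t * I"
      using iTG iG by (simp add: I_def)
    also have "\<dots> \<le> e/2 + e/2"
      using mollG(2) tI unfolding TG_def by (intro add_mono)
    finally show "(LINT x|lebesgue_on (S \<inter> U). norm (\<phi>' x - D x)) \<le> e" by simp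
  qed
qed

lemma W11_approx:
  fixes u :: "pt \<Rightarrow> real" and D :: "pt \<Rightarrow> pt"
  assumes "compact S" "open U" "weak_gradient U u D"
    "integrable (lebesgue_on U) u" "integrable (lebesgue_on U) D"
    "\<And>x t. x \<in> S \<Longrightarrow> 0 < t \<Longrightarrow> t \<le> 1 \<Longrightarrow> (1 - t) *\<^sub>R x + t *\<^sub>R c \<in> U"
  obtains \<phi> \<phi>' where "\<And>n::nat. C1_with_gradient (\<phi> n) (\<phi>' n)"
    "(\<lambda>n. LINT x|lebesgue_on (S \<inter> U). \<bar>\<phi> n x - u x\<bar>) \<longlonglongrightarrow> 0"
    "(\<lambda>n. LINT x|lebesgue_on (S \<inter> U). norm (\<phi>' n x - D x)) \<longlonglongrightarrow> 0"
proof -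
  have "\<forall>n::nat. \<exists>p. C1_with_gradient (fst p) (snd p) \<and>
    (LINT x|lebesgue_on (S \<inter> U). \<bar>fst p x - u x\<bar>) \<le> 1 / Suc n \<and>
    (LINT x|lebesgue_on (S \<inter> U). norm (snd p x - D x)) \<le> 1 / Suc n"
  proof
    fix n :: nat
    have "0 < 1 / real (Suc n)" by simp
    from W11_approx_step[OF assms this] obtain \<phi> \<phi>' where "C1_with_gradient \<phi> \<phi>'"
      "(LINT x|lebesgue_on (S \<inter> U). \<bar>\<phi> x - u x\<bar>) \<le> 1 / Suc n"
      "(LINT x|lebesgue_on (S \<inter> U). norm (\<phi>' x - D x)) \<le> 1 / Suc n" by blast
    then show "\<exists>p. C1_with_gradient (fst p) (snd p) \<and>
    (LINT x|lebesgue_on (S \<inter> U). \<bar>fst p x - u x\<bar>) \<le> 1 / Suc n \<and>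
    (LINT x|lebesgue_on (S \<inter> U). norm (snd p x - D x)) \<le> 1 / Suc n"
      by (intro exI[of _ "(\<phi>, \<phi>')"]) auto
  qed
  from choice[OF this] obtain p where p: "\<And>n::nat. C1_with_gradient (fst (p n)) (snd (p n))"
    "\<And>n. (LINT x|lebesgue_on (S \<inter> U). \<bar>fst (p n) x - u x\<bar>) \<le> 1 / Suc n"
    "\<And>n. (LINT x|lebesgue_on (S \<inter> U). norm (snd (p n) x - D x)) \<le> 1 / Suc n"
    by blast
  have lim: "(\<lambda>n. 1 / real (Suc n)) \<longlonglongrightarrow> 0"
    using LIMSEQ_inverse_real_of_nat by (simp add: inverse_eq_divide)
  show thesis
  proof (rule that[of "\<lambda>n. fst (p n)" "\<lambda>n. snd (p n)"])
    show "(\<lambda>n. LINT x|lebesgue_on (S \<inter> U). \<bar>fst (p n) x - u x\<bar>) \<longlonglongrightarrow> 0"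
      by (rule tendsto_sandwich[OF _ _ tendsto_const lim]) (use p(2) in \<open>auto intro!: always_eventually\<close>)
    show "(\<lambda>n. LINT x|lebesgue_on (S \<inter> U). norm (snd (p n) x - D x)) \<longlonglongrightarrow> 0"
      by (rule tendsto_sandwich[OF _ _ tendsto_const lim]) (use p(3) in \<open>auto intro!: always_eventually\<close>)
  qed (rule p)
qed

section \<open>Weak gradients\<close>

lemma borel_measurable_lebesgue_on_AE:
  fixes f g :: "'a::euclidean_space \<Rightarrow> 'b::euclidean_space"
  assumes A: "A \<in> sets lebesgue" and f: "f \<in> borel_measurable (lebesgue_on A)" and eq: "AE x in lebesgue_on A. f x = g x"
  shows "g \<in> borel_measurable (lebesgue_on A)"
proof -
  have "(\<lambda>x. indicator A x *\<^sub>R f x) \<in> borel_measurable lebesgue"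
    using f A by (subst (asm) borel_measurable_restrict_space_iff) (auto simp: mult.commute)
  moreover have "AE x in lebesgue. indicator A x *\<^sub>R f x = indicator A x *\<^sub>R g x"
    using eq unfolding AE_lebesgue_on_iff[OF A] by eventually_elim (auto simp: indicator_def)
  ultimately have "(\<lambda>x. indicator A x *\<^sub>R g x) \<in> borel_measurable lebesgue"
    by (rule borel_measurable_AE)
  then show ?thesis
    using A by (subst borel_measurable_restrict_space_iff) (auto simp: mult.commute)
qed

lemma integrable_lebesgue_on_AE:
  fixes f g :: "'a::euclidean_space \<Rightarrow> 'b::euclidean_space"
  assumes A: "A \<in> sets lebesgue" and f: "integrable (lebesgue_on A) f" and eq: "AE x in lebesgue_on A. f x = g x"
  shows "integrable (lebesgue_on A) g"
  by (rule integrable_cong_AE_imp[OF f borel_measurable_lebesgue_on_AE[OF A borel_measurable_integrable[OF f] eq] eq])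

text \<open>Holds without any measurability condition: Lebesgue measure is complete, so both
  functions are measurable or neither is, and in the latter case both integrals have the default
  value 0.\<close>

lemma integral_lebesgue_on_AE:
  fixes f g :: "'a::euclidean_space \<Rightarrow> 'b::euclidean_space"
  assumes A: "A \<in> sets lebesgue" and eq: "AE x in lebesgue_on A. f x = g x"
  shows "(LINT x|lebesgue_on A. f x) = (LINT x|lebesgue_on A. g x)"
proof (cases "f \<in> borel_measurable (lebesgue_on A)")
  case True
  then show ?thesis using borel_measurable_lebesgue_on_AE[OF A True eq] eq by (intro integral_cong_AE) auto
next
  case False
  then have "g \<notin> borel_measurable (lebesgue_on A)"
    using borel_measurable_lebesgue_on_AE[OF A, of g f] eq by (auto simp: eq_commute)
  then have "\<not> integrable (lebesgue_on A) f" "\<not> integrable (lebesgue_on A) g" using False by auto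
  then show ?thesis by (simp add: not_integrable_integral_eq)
qed

text \<open>A directional derivative is the limit of difference quotients, whose integrals vanish by
  translation invariance; a Lipschitz bound on a large ball dominates the quotients.\<close>

lemma C1_gradient_integral_zero:
  assumes C1: "C1_with_gradient \<psi> \<psi>'" and r: "\<And>x. r \<le> norm x \<Longrightarrow> \<psi> x = 0"
  shows "(LINT x|lborel. \<psi>' x) = 0"
proof (cases "integrable lborel \<psi>'")
  \<comment> \<open>The integral of a function that is not integrable is 0 by default, so only the
    other case has content.\<close>
  case False
  then show ?thesis by (rule not_integrable_integral_eq)
next
  case int: True
  have c: "continuous_on UNIV \<psi>" "continuous_on UNIV \<psi>'" using C1_with_gradient_continuous[OF C1] by auto
  have [measurable]: "\<psi> \<in> borel_measurable borel" using c by (auto intro: borel_measurable_continuous_onI)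
  have ipsi: "integrable lborel \<psi>"
  proof -
    have "integrable lborel (\<lambda>x. indicator (cball 0 r) x *\<^sub>R \<psi> x)"
      by (intro borel_integrable_compact continuous_on_subset[OF c(1)]) auto
    moreover have "(\<lambda>x. indicator (cball 0 r) x *\<^sub>R \<psi> x) = \<psi>"
      using r by (fastforce simp: indicator_def)
    ultimately show ?thesis by simp
  qed
  have "(LINT x|lborel. \<psi>' x) \<bullet> v = 0" for v
  proof -
    define h where "h n = inverse (real (Suc n))" for n
    have h0: "h n > 0" "h n \<le> 1" for n by (auto simp: h_def inverse_le_1_iff)
    have hlim: "h \<longlonglongrightarrow> 0" unfolding h_def by (rule LIMSEQ_inverse_real_of_nat)
    \<comment> \<open>The quotients vanish for x beyond radius |r| + |v|; one further |v| keeps x +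
      h v inside \<open>B\<close> for the remaining x, as h is at most 1.\<close>
    define B where "B = cball (0::pt) (\<bar>r\<bar> + 2 * norm v)"
    have "bounded (\<psi>' ` B)"
      unfolding B_def by (intro compact_imp_bounded compact_continuous_image continuous_on_subset[OF c(2)]) auto
    then obtain M where M: "\<And>x. x \<in> B \<Longrightarrow> norm (\<psi>' x) \<le> M" "0 < M"
      by (auto simp: bounded_pos)
    have bnd: "\<bar>(\<psi> (x + h n *\<^sub>R v) - \<psi> x) / h n\<bar> \<le> M * norm v * indicator (cball 0 (\<bar>r\<bar> + norm v)) x" for n x
    proof (cases "x \<in> cball 0 (\<bar>r\<bar> + norm v)")
      case True
      have hv: "norm (h n *\<^sub>R v) \<le> norm v" using h0[of n] by (simp add: mult_left_le_one_le)
      have xB: "x \<in> B" "x + h n *\<^sub>R v \<in> B"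
        using True hv norm_triangle_ineq[of x "h n *\<^sub>R v"] norm_ge_zero[of v] unfolding B_def mem_cball_0 by linarith+
      have "norm (\<psi> (x + h n *\<^sub>R v) - \<psi> x) \<le> M * norm (x + h n *\<^sub>R v - x)"
      proof (rule differentiable_bound[of B \<psi> "\<lambda>x h. h \<bullet> \<psi>' x"])
        show "(\<psi> has_derivative (\<lambda>h. h \<bullet> \<psi>' x)) (at x within B)" for x
          using C1 by (auto simp: C1_with_gradient_def gderiv_def intro: has_derivative_at_withinI)
        show "onorm (\<lambda>h. h \<bullet> \<psi>' x) \<le> M" if "x \<in> B" for x
          by (rule onorm_bound) (use M(1)[OF that] M(2) in \<open>auto intro!: order_trans[OF Cauchy_Schwarz_ineq2] simp: mult.commute[of M] mult_left_mono\<close>)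
      qed (use xB in \<open>auto simp: B_def\<close>)
      then have "\<bar>\<psi> (x + h n *\<^sub>R v) - \<psi> x\<bar> \<le> (M * norm v) * h n" using h0[of n] by (simp add: ac_simps)
      then have "\<bar>(\<psi> (x + h n *\<^sub>R v) - \<psi> x) / h n\<bar> \<le> M * norm v"
        using h0[of n] by (simp add: divide_le_eq)
      then show ?thesis using True by simp
    next
      case False
      have hv: "norm (h n *\<^sub>R v) \<le> norm v" using h0[of n] by (simp add: mult_left_le_one_le)
      have "r \<le> norm x" "r \<le> norm (x + h n *\<^sub>R v)"
        using False hv norm_triangle_ineq4[of "x + h n *\<^sub>R v" "h n *\<^sub>R v"] norm_ge_zero[of v] unfolding mem_cball_0 add_diff_cancel_right' by linarith+
      then show ?thesis using False r by simp
    qed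
    have lim: "(\<lambda>n. LINT x|lborel. (\<psi> (x + h n *\<^sub>R v) - \<psi> x) / h n) \<longlonglongrightarrow> (LINT x|lborel. v \<bullet> \<psi>' x)"
    proof (rule integral_dominated_convergence[where w="\<lambda>x. M * norm v * indicator (cball 0 (\<bar>r\<bar> + norm v)) x"])
      show "integrable lborel (\<lambda>x. M * norm v * indicator (cball 0 (\<bar>r\<bar> + norm v)) x)"
        by (intro integrable_mult_right integrable_real_indicator) (use emeasure_lborel_cball_finite in auto)
      show "AE x in lborel. (\<lambda>n. (\<psi> (x + h n *\<^sub>R v) - \<psi> x) / h n) \<longlonglongrightarrow> v \<bullet> \<psi>' x"
      proof (rule AE_I2)
        fix x
        have "((\<lambda>t. \<psi> (x + t *\<^sub>R v)) has_derivative (\<lambda>t. (t *\<^sub>R v) \<bullet> \<psi>' x)) (at 0)"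
        proof (rule has_derivative_compose[of "\<lambda>t. x + t *\<^sub>R v" "\<lambda>t. t *\<^sub>R v" 0 UNIV \<psi>])
          show "((\<lambda>t. x + t *\<^sub>R v) has_derivative (\<lambda>t. t *\<^sub>R v)) (at 0)"
            by (auto intro!: derivative_eq_intros)
          show "(\<psi> has_derivative (\<lambda>h. h \<bullet> \<psi>' x)) (at (x + 0 *\<^sub>R v))"
            using C1 by (simp add: C1_with_gradient_def gderiv_def)
        qed
        then have "((\<lambda>t. \<psi> (x + t *\<^sub>R v)) has_real_derivative (v \<bullet> \<psi>' x)) (at 0)"
          by (simp add: has_field_derivative_def mult_commute_abs)
        then have "(\<lambda>t. (\<psi> (x + t *\<^sub>R v) - \<psi> x) / t) \<midarrow>0\<rightarrow> v \<bullet> \<psi>' x"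
          by (simp add: DERIV_def)
        then show "(\<lambda>n. (\<psi> (x + h n *\<^sub>R v) - \<psi> x) / h n) \<longlonglongrightarrow> v \<bullet> \<psi>' x"
          using hlim h0 unfolding tendsto_at_iff_sequentially o_def by (simp add: less_imp_neq[THEN not_sym])
      qed
      show "AE x in lborel. norm ((\<psi> (x + h n *\<^sub>R v) - \<psi> x) / h n) \<le> M * norm v * indicator (cball 0 (\<bar>r\<bar> + norm v)) x" for n
        using bnd by simp
    qed (use int in auto)
    have "(\<lambda>n. LINT x|lborel. (\<psi> (x + h n *\<^sub>R v) - \<psi> x) / h n) = (\<lambda>n. 0)"
      using lborel_affine_map[OF _ ipsi, of 1] ipsi by simp
    then have "(LINT x|lborel. v \<bullet> \<psi>' x) = 0"
      using lim LIMSEQ_unique tendsto_const by metis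
    moreover have "(LINT x|lborel. v \<bullet> \<psi>' x) = v \<bullet> (LINT x|lborel. \<psi>' x)"
      using int by (intro integral_inner_right) auto
    ultimately show ?thesis by (simp add: inner_commute)
  qed
  then show ?thesis using inner_eq_zero_iff by blast
qed

lemma integral_lebesgue_on_lborel_support:
  fixes f :: "'a::euclidean_space \<Rightarrow> 'b::{banach,second_countable_topology}"
  assumes "open U" "f \<in> borel_measurable borel" "\<And>x. x \<notin> U \<Longrightarrow> f x = 0"
  shows "(LINT x|lebesgue_on U. f x) = (LINT x|lborel. f x)"
proof -
  have "(LINT x|lebesgue_on U. f x) = (LINT x|lebesgue. indicator U x *\<^sub>R f x)"
    using assms by (intro integral_lebesgue_on_eq) auto
  also have "(\<lambda>x. indicator U x *\<^sub>R f x) = f"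
    using assms(3) by (fastforce simp: indicator_def)
  finally show ?thesis using assms(2) by (simp add: integral_completion)
qed

text \<open>Integration by parts without boundary term: the product with a test function has compact
  support, so its gradient integrates to zero.\<close>

lemma C1_weak_gradient:
  assumes U: "open U" and C1: "C1_with_gradient \<phi> \<phi>'"
  shows "weak_gradient U \<phi> \<phi>'"
  unfolding weak_gradient_def
proof (intro conjI allI impI; (elim conjE)?)
  note c = C1_with_gradient_continuous[OF C1]
  have int: "integrable (lebesgue_on C) f" if "compact C" "continuous_on UNIV f" for C and f :: "pt \<Rightarrow> 'b::{banach,second_countable_topology}"
  proof -
    have "integrable lborel (\<lambda>x. indicator C x *\<^sub>R f x)"
      using that by (intro borel_integrable_compact continuous_on_subset[OF that(2)]) auto
    then have "integrable lebesgue (\<lambda>x. indicator C x *\<^sub>R f x)"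
      by (subst integrable_completion) auto
    then show ?thesis
      using that by (subst integrable_lebesgue_on_iff) (auto simp: compact_imp_closed)
  qed
  show "integrable (lebesgue_on C) \<phi>" "integrable (lebesgue_on C) \<phi>'" if "compact C" for C
    using int that c by blast+
  fix \<eta> \<eta>' assume \<eta>: "C1_with_gradient \<eta> \<eta>'" and comp: "compact (closure {x. \<eta> x \<noteq> 0})" and sub: "closure {x. \<eta> x \<noteq> 0} \<subseteq> U"
  define C where "C = closure {x. \<eta> x \<noteq> 0}"
  note e = C1_with_gradient_continuous[OF \<eta>]
  note z = C1_with_gradient_zero_outside_support[OF \<eta>, folded C_def]
  note comp = comp[folded C_def] and sub = sub[folded C_def]
  obtain r where r: "C \<subseteq> ball 0 r" using comp by (meson bounded_subset_ballD compact_imp_bounded)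
  have int2: "integrable lborel f" if "continuous_on UNIV f" "\<And>x. x \<notin> C \<Longrightarrow> f x = 0" for f :: "pt \<Rightarrow> pt"
  proof -
    have "integrable lborel (\<lambda>x. indicator C x *\<^sub>R f x)"
      by (intro borel_integrable_compact comp continuous_on_subset[OF that(1)]) auto
    moreover have "(\<lambda>x. indicator C x *\<^sub>R f x) = f"
      using that(2) by (fastforce simp: indicator_def)
    ultimately show ?thesis by simp
  qed
  have c1: "continuous_on UNIV (\<lambda>x. \<phi> x *\<^sub>R \<eta>' x)" and c2: "continuous_on UNIV (\<lambda>x. \<eta> x *\<^sub>R \<phi>' x)"
    by (intro continuous_intros c e)+
  have i1: "integrable lborel (\<lambda>x. \<phi> x *\<^sub>R \<eta>' x)" and i2: "integrable lborel (\<lambda>x. \<eta> x *\<^sub>R \<phi>' x)"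
    by (intro int2 c1 c2, simp add: z)+
  have "(LINT x|lborel. \<phi> x *\<^sub>R \<eta>' x + \<eta> x *\<^sub>R \<phi>' x) = 0"
  proof (rule C1_gradient_integral_zero[OF C1_with_gradient_mult[OF C1 \<eta>]])
    show "\<phi> x * \<eta> x = 0" if "r \<le> norm x" for x
      using z(1)[of x] r that by force
  qed
  then have "(LINT x|lborel. \<phi> x *\<^sub>R \<eta>' x) = - (LINT x|lborel. \<eta> x *\<^sub>R \<phi>' x)"
    using i1 i2 by (simp add: eq_neg_iff_add_eq_0)
  moreover have "(LINT x|lebesgue_on U. \<phi> x *\<^sub>R \<eta>' x) = (LINT x|lborel. \<phi> x *\<^sub>R \<eta>' x)"
    using z sub by (intro integral_lebesgue_on_lborel_support U borel_measurable_continuous_onI c1) auto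
  moreover have "(LINT x|lebesgue_on U. \<eta> x *\<^sub>R \<phi>' x) = (LINT x|lborel. \<eta> x *\<^sub>R \<phi>' x)"
    using z sub by (intro integral_lebesgue_on_lborel_support U borel_measurable_continuous_onI c2) auto
  ultimately show "(LINT x|lebesgue_on U. \<phi> x *\<^sub>R \<eta>' x) = - (LINT x|lebesgue_on U. \<eta> x *\<^sub>R \<phi>' x)"
    by simp
qed

lemma integrable_lebesgue_on_compact_support:
  fixes f :: "pt \<Rightarrow> 'b::euclidean_space" and g :: "pt \<Rightarrow> 'c::{banach,second_countable_topology}"
  assumes U: "open U" and C: "compact C" "C \<subseteq> U" and f: "integrable (lebesgue_on C) f"
    and h: "\<And>x. x \<notin> C \<Longrightarrow> h x = 0" "h \<in> borel_measurable (lebesgue_on C)" "\<And>x. x \<in> C \<Longrightarrow> norm (h x) \<le> M * norm (f x)"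
  shows "integrable (lebesgue_on U) (h :: pt \<Rightarrow> 'c::{banach,second_countable_topology})"
proof -
  have Cs: "C \<in> sets lebesgue" and Us: "U \<in> sets lebesgue" using C U by (auto simp: compact_imp_closed)
  have "integrable (lebesgue_on C) h"
  proof (rule Bochner_Integration.integrable_bound)
    show "integrable (lebesgue_on C) (\<lambda>x. M * norm (f x))" using f by (intro integrable_mult_right integrable_norm)
    show "AE x in lebesgue_on C. norm (h x) \<le> norm (M * norm (f x))"
      using h(3) by (intro AE_I2) (fastforce simp: space_restrict_space intro: order_trans)
  qed (rule h(2))
  then have "integrable lebesgue (\<lambda>x. indicator C x *\<^sub>R h x)" using Cs by (simp add: integrable_lebesgue_on_iff)
  moreover have "(\<lambda>x. indicator C x *\<^sub>R h x) = (\<lambda>x. indicator U x *\<^sub>R h x)"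
    using h(1) C(2) by (fastforce simp: indicator_def)
  ultimately show ?thesis using Us by (simp add: integrable_lebesgue_on_iff)
qed

lemma weak_gradient_integrable:
  assumes "weak_gradient U u D" "compact C" "C \<subseteq> U"
  shows "integrable (lebesgue_on C) u" "integrable (lebesgue_on C) D"
  using assms(1)[unfolded weak_gradient_def, THEN conjunct1, rule_format, of C] assms(2,3) by auto

lemma weak_gradient_test_integrable:
  assumes U: "open U" and wg: "weak_gradient U u D"
    and \<eta>: "C1_with_gradient \<eta> \<eta>'" and comp: "compact (closure {x. \<eta> x \<noteq> 0})" and sub: "closure {x. \<eta> x \<noteq> 0} \<subseteq> U"
  shows "integrable (lebesgue_on U) (\<lambda>x. u x *\<^sub>R \<eta>' x)" "integrable (lebesgue_on U) (\<lambda>x. \<eta> x *\<^sub>R D x)"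
proof -
  define C where "C = closure {x. \<eta> x \<noteq> 0}"
  note e = C1_with_gradient_continuous[OF \<eta>]
  note z = C1_with_gradient_zero_outside_support[OF \<eta>, folded C_def]
  note comp = comp[folded C_def] and sub = sub[folded C_def]
  have iu: "integrable (lebesgue_on C) u" and iD: "integrable (lebesgue_on C) D"
    by (rule weak_gradient_integrable[OF wg comp sub])+
  have "bounded (\<eta>' ` C)" "bounded (\<eta> ` C)"
    using comp by (intro compact_imp_bounded compact_continuous_image e; simp)+
  then obtain M N where M: "\<And>x. x \<in> C \<Longrightarrow> norm (\<eta>' x) \<le> M" and N: "\<And>x. x \<in> C \<Longrightarrow> norm (\<eta> x) \<le> N"
    unfolding bounded_iff by blast
  have m: "\<eta> \<in> borel_measurable (lebesgue_on C)" "\<eta>' \<in> borel_measurable (lebesgue_on C)"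
    by (intro measurable_restrict_space1 measurable_completion; simp add: borel_measurable_continuous_onI e)+
  show "integrable (lebesgue_on U) (\<lambda>x. u x *\<^sub>R \<eta>' x)"
  proof (rule integrable_lebesgue_on_compact_support[OF U comp sub iu])
    show "norm (u x *\<^sub>R \<eta>' x) \<le> M * norm (u x)" if "x \<in> C" for x
      using M[OF that] by (simp add: mult.commute[of M] mult_left_mono)
  qed (use z m iu in auto)
  show "integrable (lebesgue_on U) (\<lambda>x. \<eta> x *\<^sub>R D x)"
  proof (rule integrable_lebesgue_on_compact_support[OF U comp sub iD])
    show "norm (\<eta> x *\<^sub>R D x) \<le> N * norm (D x)" if "x \<in> C" for x
      using N[OF that] by (simp add: mult_right_mono)
  qed (use z m iD in auto)
qed

lemma weak_gradient_add:
  assumes U: "open U" and 1: "weak_gradient U u D" and 2: "weak_gradient U v E"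
  shows "weak_gradient U (\<lambda>x. u x + v x) (\<lambda>x. D x + E x)"
  unfolding weak_gradient_def
proof (intro conjI allI impI; (elim conjE)?)
  fix C assume "compact C" "C \<subseteq> U"
  then show "integrable (lebesgue_on C) (\<lambda>x. u x + v x)" "integrable (lebesgue_on C) (\<lambda>x. D x + E x)"
    using weak_gradient_integrable[OF 1] weak_gradient_integrable[OF 2] by (simp_all add: Bochner_Integration.integrable_add)
next
  fix \<eta> \<eta>' assume \<eta>: "C1_with_gradient \<eta> \<eta>'" "compact (closure {x. \<eta> x \<noteq> 0})" "closure {x. \<eta> x \<noteq> 0} \<subseteq> U"
  note t1 = weak_gradient_test[OF 1 \<eta>] weak_gradient_test_integrable[OF U 1 \<eta>]
  note t2 = weak_gradient_test[OF 2 \<eta>] weak_gradient_test_integrable[OF U 2 \<eta>]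
  show "(LINT x|lebesgue_on U. (u x + v x) *\<^sub>R \<eta>' x) = - (LINT x|lebesgue_on U. \<eta> x *\<^sub>R (D x + E x))"
    using t1 t2 by (simp add: scaleR_add_left scaleR_add_right)
qed

text \<open>Test functions live on the whole plane, so one supported in \<open>V\<close> is also one
  for \<open>U\<close>, and both integrals see only its support.\<close>

lemma weak_gradient_subset:
  assumes U: "open U" and V: "open V" "V \<subseteq> U" and wg: "weak_gradient U u D"
  shows "weak_gradient V u D"
  unfolding weak_gradient_def
proof (intro conjI allI impI; (elim conjE)?)
  fix C assume "compact C" "C \<subseteq> V"
  then show "integrable (lebesgue_on C) u" "integrable (lebesgue_on C) D"
    using weak_gradient_integrable[OF wg] V by auto
next
  fix \<eta> \<eta>' assume \<eta>: "C1_with_gradient \<eta> \<eta>'" and comp: "compact (closure {x. \<eta> x \<noteq> 0})" and sub: "closure {x. \<eta> x \<noteq> 0} \<subseteq> V"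
  note z = C1_with_gradient_zero_outside_support[OF \<eta>]
  have Us: "U \<in> sets lebesgue" and Vs: "V \<in> sets lebesgue" using U V by auto
  have "indicator U x *\<^sub>R (u x *\<^sub>R \<eta>' x) = indicator V x *\<^sub>R (u x *\<^sub>R \<eta>' x)" for x
    using z[of x] sub V by (cases "x \<in> closure {x. \<eta> x \<noteq> 0}") (auto simp: indicator_def)
  moreover have "indicator U x *\<^sub>R (\<eta> x *\<^sub>R D x) = indicator V x *\<^sub>R (\<eta> x *\<^sub>R D x)" for x
    using z[of x] sub V by (cases "x \<in> closure {x. \<eta> x \<noteq> 0}") (auto simp: indicator_def)
  ultimately show "(LINT x|lebesgue_on V. u x *\<^sub>R \<eta>' x) = - (LINT x|lebesgue_on V. \<eta> x *\<^sub>R D x)"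
    using weak_gradient_test[OF wg \<eta> comp order_trans[OF sub V(2)]]
    by (simp only: integral_lebesgue_on_eq[OF Us] integral_lebesgue_on_eq[OF Vs])
qed

lemma weak_gradient_AE:
  assumes U: "open U" and wg: "weak_gradient U u D" and eq: "AE x in lebesgue_on U. u x = v x"
  shows "weak_gradient U v D"
  unfolding weak_gradient_def
proof (intro conjI allI impI; (elim conjE)?)
  have Us: "U \<in> sets lebesgue" using U by auto
  {
    fix C assume C: "compact C" "C \<subseteq> U"
    then show "integrable (lebesgue_on C) D" by (rule weak_gradient_integrable(2)[OF wg])
    have Cs: "C \<in> sets lebesgue" using C by (auto simp: compact_imp_closed)
    have "AE x in lebesgue_on C. u x = v x"
      using eq C(2) unfolding AE_lebesgue_on_iff[OF Us] AE_lebesgue_on_iff[OF Cs] by (auto elim!: eventually_mono)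
    moreover have "integrable (lebesgue_on C) u"
      by (rule weak_gradient_integrable(1)[OF wg C])
    ultimately show "integrable (lebesgue_on C) v"
      by (rule integrable_lebesgue_on_AE[OF Cs, rotated])
  }
  fix \<eta> \<eta>' assume \<eta>: "C1_with_gradient \<eta> \<eta>'" "compact (closure {x. \<eta> x \<noteq> 0})" "closure {x. \<eta> x \<noteq> 0} \<subseteq> U"
  have "AE x in lebesgue_on U. u x *\<^sub>R \<eta>' x = v x *\<^sub>R \<eta>' x"
    using eq by eventually_elim simp
  then have "(LINT x|lebesgue_on U. u x *\<^sub>R \<eta>' x) = (LINT x|lebesgue_on U. v x *\<^sub>R \<eta>' x)"
    by (rule integral_lebesgue_on_AE[OF Us])
  then show "(LINT x|lebesgue_on U. v x *\<^sub>R \<eta>' x) = - (LINT x|lebesgue_on U. \<eta> x *\<^sub>R D x)"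
    using weak_gradient_test[OF wg \<eta>] by simp
qed

text \<open>Near each point the mollifications of \<open>D\<close> and \<open>D'\<close> coincide,
  both being minus the integral of \<open>u\<close> against the gradient of the kernel. As the
  kernel shrinks, the difference of the two gradients has arbitrarily small L1 norm on a small ball.
  This makes the arbitrary choice in \<open>wgrad\<close> harmless.\<close>

lemma weak_gradient_unique:
  assumes U: "open U" and wg: "weak_gradient U u D" "weak_gradient U u D'"
  shows "AE x in lebesgue_on U. D x = D' x"
proof -
  define N where "N = {x \<in> U. D x \<noteq> D' x}"
  have "\<exists>V. openin (top_of_set N) V \<and> x \<in> V \<and> negligible V" if x: "x \<in> N" for x
  proof -
    obtain r where r: "0 < r" "cball x r \<subseteq> U"
      using U x by (auto simp: N_def open_contains_cball)
    \<comment> \<open>Kernels of radius at most r / 2 that are centred in \<open>?B\<close> stay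
      inside \<open>?V\<close>.\<close>
    let ?V = "ball x r" and ?B = "ball x (r/2)"
    have sub: "?V \<subseteq> cball x r" by auto
    have V: "open ?V" "?V \<subseteq> U" "?V \<in> sets lebesgue" using r by auto
    note wgV = weak_gradient_subset[OF U V(1,2) wg(1)] weak_gradient_subset[OF U V(1,2) wg(2)]
    have iu: "integrable (lebesgue_on ?V) u" and iD: "integrable (lebesgue_on ?V) D" "integrable (lebesgue_on ?V) D'"
      using weak_gradient_integrable[OF wg(1) compact_cball r(2)] weak_gradient_integrable(2)[OF wg(2) compact_cball r(2)]
      by (auto intro: integrable_lebesgue_on_subset[OF _ _ V(3) sub])
    obtain F where F: "integrable lborel F" "AE y in lebesgue. F y = indicator ?V y *\<^sub>R u y"
      using borel_representative_on[OF iu V(3)] .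
    obtain G where G: "integrable lborel G" "AE y in lebesgue. G y = indicator ?V y *\<^sub>R D y"
      using borel_representative_on[OF iD(1) V(3)] .
    obtain G' where G': "integrable lborel G'" "AE y in lebesgue. G' y = indicator ?V y *\<^sub>R D' y"
      using borel_representative_on[OF iD(2) V(3)] .
    define H where "H y = G y - G' y" for y
    have H: "integrable lborel H" unfolding H_def using G(1) G'(1) by (rule Bochner_Integration.integrable_diff)
    have iH: "integrable lborel (\<lambda>y. norm (indicator ?B y *\<^sub>R H y))"
      using H by (intro integrable_norm integrable_mult_indicator) auto
    have small: "(LINT y|lborel. norm (indicator ?B y *\<^sub>R H y)) \<le> e" if e: "0 < e" for e
    proof -
      obtain d where d: "0 < d" "d < 1" "\<And>l b. \<bar>l - 1\<bar> < d \<Longrightarrow> norm b < d \<Longrightarrow> (LINT x|lborel. norm (H (l *\<^sub>R x + b) - H x)) < e"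
        using affine_L1_uniform[OF H e] by blast
      define \<epsilon> where "\<epsilon> = min d (r/2)"
      have \<epsilon>: "0 < \<epsilon>" "\<epsilon> \<le> d" "\<epsilon> \<le> r/2" using d r by (auto simp: \<epsilon>_def)
      obtain k k' L where k: "C1_with_gradient k k'" "\<And>w. 0 \<le> k w" "\<And>w. k w \<le> L" "\<And>w. norm (k' w) \<le> L"
        "\<And>w. \<epsilon> \<le> norm w \<Longrightarrow> k w = 0" "integrable lborel k" "(LINT w|lborel. k w) = 1"
        using mollifier_exists[OF \<epsilon>(1)] by blast
      have [measurable]: "k \<in> borel_measurable borel"
        using C1_with_gradient_continuous(1)[OF k(1)] by (rule borel_measurable_continuous_onI)
      have eH: "(LINT y|lborel. norm (H (1 *\<^sub>R y + (0 + w)) - H y)) \<le> e" if "k w \<noteq> 0" for w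
      proof -
        have "norm w < \<epsilon>" using that k(5) by force
        then show ?thesis using d(3)[of 1 w] d(1) \<epsilon> by simp
      qed
      note moll = mollify_L1_bound[OF H one_neq_zero k(6,2,7,3) eH]
      define T where "T z = (LINT y|lborel. k (y - 1 *\<^sub>R z - 0) *\<^sub>R H y)" for z
      have T0: "T z = 0" if z: "z \<in> ?B" for z
      proof -
        have zV: "cball z \<epsilon> \<subseteq> ?V"
        proof
          fix y assume "y \<in> cball z \<epsilon>"
          then show "y \<in> ?V" using z \<epsilon> dist_triangle[of x y z] by auto
        qed
        have kG: "integrable lborel (\<lambda>y. k (y - z) *\<^sub>R B y)" if "integrable lborel B" for B :: "pt \<Rightarrow> pt"
          by (rule integrable_bounded_scaleR[OF that, of _ L]) (use k in auto)
        have "(LINT y|lborel. k (y - z) *\<^sub>R G y) = (LINT y|lborel. k (y - z) *\<^sub>R G' y)"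
          using weak_gradient_mollifier[OF V(1) wgV(1) iu iD(1) F G k(1) k(5) zV]
            weak_gradient_mollifier[OF V(1) wgV(2) iu iD(2) F G' k(1) k(5) zV] by simp
        then show ?thesis
          using kG[OF G(1)] kG[OF G'(1)] by (simp add: T_def H_def scaleR_diff_right)
      qed
      have "(LINT y|lborel. norm (indicator ?B y *\<^sub>R H y)) \<le> (LINT y|lborel. norm (T y - H y))"
      proof (rule integral_mono[OF iH])
        show "integrable lborel (\<lambda>y. norm (T y - H y))"
          unfolding T_def by (rule integrable_norm[OF moll(1)])
        show "norm (indicator ?B y *\<^sub>R H y) \<le> norm (T y - H y)" for y
          using T0[of y] by (auto simp: indicator_def)
      qed
      also have "\<dots> \<le> e" unfolding T_def by (rule moll(2))
      finally show ?thesis .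
    qed
    have "(LINT y|lborel. norm (indicator ?B y *\<^sub>R H y)) = 0"
      using field_le_epsilon[of _ "0::real"] small by (intro antisym) auto
    then have "AE y in lborel. norm (indicator ?B y *\<^sub>R H y) = 0"
      using integral_nonneg_eq_0_iff_AE[OF iH] by simp
    then have "AE y in lebesgue. norm (indicator ?B y *\<^sub>R H y) = 0"
      by (rule AE_completion)
    then have "AE y in lebesgue. y \<notin> N \<inter> ?B"
      using G(2) G'(2)
    proof eventually_elim
      case (elim y)
      then show ?case using r by (auto simp: indicator_def H_def N_def split: if_splits)
    qed
    then have "negligible (N \<inter> ?B)"
      by (simp add: negligible_iff_null_sets completion.null_sets_iff_AE)
    then show ?thesis
      using x r by (intro exI[of _ "N \<inter> ?B"]) (auto simp: openin_open_Int)
  qed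
  then have "negligible N" using locally_negligible_alt[of N] by blast
  then have "AE x in lebesgue. x \<notin> N"
    by (simp add: negligible_iff_null_sets AE_not_in)
  then have "AE x in lebesgue. x \<in> U \<longrightarrow> D x = D' x"
    by eventually_elim (auto simp: N_def)
  then show ?thesis using U by (subst AE_lebesgue_on_iff) auto
qed

lemma wgrad_AE:
  assumes "open U" "weak_gradient U u D"
  shows "weak_gradient U u (wgrad U u)" "AE x in lebesgue_on U. D x = wgrad U u x"
proof -
  show "weak_gradient U u (wgrad U u)" unfolding wgrad_def by (rule someI[where P="weak_gradient U u", OF assms(2)])
  then show "AE x in lebesgue_on U. D x = wgrad U u x" using weak_gradient_unique[OF assms(1) assms(2)] by simp
qed

section \<open>The radial formula on a triangle and traces\<close>

text \<open>Twice the signed area of the triangle. The quotients by \<open>tdet a b c\<close> with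
  one vertex replaced by x are the barycentric coordinates of x, so the identities below amount to
  Cramer's rule.\<close>

definition tdet :: "pt \<Rightarrow> pt \<Rightarrow> pt \<Rightarrow> real" where
  "tdet a b c = (b $ 1 - a $ 1) * (c $ 2 - a $ 2) - (b $ 2 - a $ 2) * (c $ 1 - a $ 1)"

lemma tdet_sum: "tdet x b c + tdet a x c + tdet a b x = tdet a b c"
  by (simp add: tdet_def algebra_simps)

lemma tdet_repr: "tdet a b c *\<^sub>R x = tdet x b c *\<^sub>R a + tdet a x c *\<^sub>R b + tdet a b x *\<^sub>R c"
  by (simp add: vec_eq_iff forall_2 tdet_def algebra_simps)

lemma tdet_rotate: "tdet b c a = tdet a b c" and tdet_swap: "tdet a c b = - tdet a b c"
  by (simp_all add: tdet_def algebra_simps)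

lemma tdet_same [simp]: "tdet a a c = 0" "tdet a b a = 0" "tdet a b b = 0"
  by (simp_all add: tdet_def)

lemma tdet_affine:
  assumes "u + v + w = 1"
  shows "tdet (u *\<^sub>R a + v *\<^sub>R b + w *\<^sub>R c) b c = u * tdet a b c"
    "tdet a (u *\<^sub>R a + v *\<^sub>R b + w *\<^sub>R c) c = v * tdet a b c"
    "tdet a b (u *\<^sub>R a + v *\<^sub>R b + w *\<^sub>R c) = w * tdet a b c"
proof -
  have u: "u = 1 - v - w" using assms by simp
  show "tdet (u *\<^sub>R a + v *\<^sub>R b + w *\<^sub>R c) b c = u * tdet a b c"
    "tdet a (u *\<^sub>R a + v *\<^sub>R b + w *\<^sub>R c) c = v * tdet a b c"
    "tdet a b (u *\<^sub>R a + v *\<^sub>R b + w *\<^sub>R c) = w * tdet a b c"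
    unfolding u by (simp_all add: tdet_def algebra_simps)
qed

lemma tdet_continuous [continuous_intros]:
  fixes f g h :: "'a::topological_space \<Rightarrow> pt"
  shows "continuous_on S f \<Longrightarrow> continuous_on S g \<Longrightarrow> continuous_on S h \<Longrightarrow> continuous_on S (\<lambda>x. tdet (f x) (g x) (h x))"
  unfolding tdet_def by (intro continuous_intros)

lemma tdet_combination:
  assumes "tdet a b c \<noteq> 0"
  shows "x = (tdet x b c / tdet a b c) *\<^sub>R a + (tdet a x c / tdet a b c) *\<^sub>R b + (tdet a b x / tdet a b c) *\<^sub>R c"
    "tdet x b c / tdet a b c + tdet a x c / tdet a b c + tdet a b x / tdet a b c = 1"
proof -
  have "x = (1 / tdet a b c) *\<^sub>R (tdet a b c *\<^sub>R x)" using assms by simp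
  also have "\<dots> = (tdet x b c / tdet a b c) *\<^sub>R a + (tdet a x c / tdet a b c) *\<^sub>R b + (tdet a b x / tdet a b c) *\<^sub>R c"
    by (simp only: tdet_repr[of a b c x] scaleR_add_right scaleR_scaleR times_divide_eq_left mult_1)
  finally show "x = (tdet x b c / tdet a b c) *\<^sub>R a + (tdet a x c / tdet a b c) *\<^sub>R b + (tdet a b x / tdet a b c) *\<^sub>R c" .
  show "tdet x b c / tdet a b c + tdet a x c / tdet a b c + tdet a b x / tdet a b c = 1"
    unfolding add_divide_distrib[symmetric] tdet_sum[of x b c a] using assms by simp
qed

lemma in_triangle_iff:
  assumes "tdet a b c \<noteq> 0"
  shows "x \<in> convex hull {a, b, c} \<longleftrightarrow>
    0 \<le> tdet x b c / tdet a b c \<and> 0 \<le> tdet a x c / tdet a b c \<and> 0 \<le> tdet a b x / tdet a b c"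
proof
  assume "x \<in> convex hull {a, b, c}"
  then obtain u v w where "0 \<le> u" "0 \<le> v" "0 \<le> w" "u + v + w = 1" "x = u *\<^sub>R a + v *\<^sub>R b + w *\<^sub>R c"
    unfolding convex_hull_3 by auto
  then show "0 \<le> tdet x b c / tdet a b c \<and> 0 \<le> tdet a x c / tdet a b c \<and> 0 \<le> tdet a b x / tdet a b c"
    using assms tdet_affine[of u v w a b c] by simp
next
  assume "0 \<le> tdet x b c / tdet a b c \<and> 0 \<le> tdet a x c / tdet a b c \<and> 0 \<le> tdet a b x / tdet a b c"
  then show "x \<in> convex hull {a, b, c}"
    unfolding convex_hull_3 mem_Collect_eq using tdet_combination[OF assms, of x] by blast
qed

text \<open>A barycentric coordinate vanishing at an interior point would become negative when the
  point is moved a little away from the vertex where the coordinate is 1. Conversely, the three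
  strict inequalities define an open subset of the triangle.\<close>

lemma interior_triangle_iff:
  assumes J: "tdet a b c \<noteq> 0"
  shows "x \<in> interior (convex hull {a, b, c}) \<longleftrightarrow>
    0 < tdet x b c / tdet a b c \<and> 0 < tdet a x c / tdet a b c \<and> 0 < tdet a b x / tdet a b c"
proof
  let ?J = "tdet a b c" and ?K = "convex hull {a, b, c}"
  have pos: "0 < l x" if x: "x \<in> interior ?K" and l: "\<And>y. y \<in> ?K \<Longrightarrow> 0 \<le> l y" and p: "l p = 1"
    and aff: "\<And>e. l (x + e *\<^sub>R (x - p)) = (1 + e) * l x - e * l p" for l :: "pt \<Rightarrow> real" and p
  proof (rule ccontr)
    assume "\<not> 0 < l x"
    then have l0: "l x = 0" using l[of x] x interior_subset by force
    obtain r where r: "0 < r" "ball x r \<subseteq> ?K" using x unfolding mem_interior by blast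
    have xp: "x \<noteq> p" using l0 p by auto
    define e where "e = r / (2 * norm (x - p))"
    have e: "0 < e" using r xp by (simp add: e_def)
    have "norm (e *\<^sub>R (x - p)) = r / 2" using r xp by (simp add: e_def)
    then have "x + e *\<^sub>R (x - p) \<in> ball x r" using r by (simp add: dist_norm)
    then have "0 \<le> l (x + e *\<^sub>R (x - p))" using r l by blast
    then show False using aff[of e] l0 p e by simp
  qed
  assume x: "x \<in> interior ?K"
  show "0 < tdet x b c / ?J \<and> 0 < tdet a x c / ?J \<and> 0 < tdet a b x / ?J"
  proof (intro conjI)
    show "0 < tdet x b c / ?J"
      by (rule pos[where p=a, OF x]) (use J in_triangle_iff[OF J] in \<open>auto simp: tdet_def divide_simps algebra_simps\<close>)
    show "0 < tdet a x c / ?J"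
      by (rule pos[where p=b, OF x]) (use J in_triangle_iff[OF J] in \<open>auto simp: tdet_def divide_simps algebra_simps\<close>)
    show "0 < tdet a b x / ?J"
      by (rule pos[where p=c, OF x]) (use J in_triangle_iff[OF J] in \<open>auto simp: tdet_def divide_simps algebra_simps\<close>)
  qed
next
  let ?J = "tdet a b c" and ?K = "convex hull {a, b, c}"
  let ?S = "{x. 0 < tdet x b c / ?J} \<inter> {x. 0 < tdet a x c / ?J} \<inter> {x. 0 < tdet a b x / ?J}"
  assume "0 < tdet x b c / ?J \<and> 0 < tdet a x c / ?J \<and> 0 < tdet a b x / ?J"
  then have "x \<in> ?S" by simp
  moreover have "open ?S"
    unfolding divide_inverse
    by (intro open_Int open_Collect_less continuous_on_mult tdet_continuous continuous_on_const continuous_on_id)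
  moreover have "?S \<subseteq> ?K"
  proof
    fix y assume "y \<in> ?S"
    then show "y \<in> ?K" unfolding in_triangle_iff[OF J] by simp
  qed
  ultimately show "x \<in> interior ?K"
    by (meson interiorI)
qed

lemma triangle_interior_nonempty:
  assumes J: "tdet a b c \<noteq> 0"
  shows "(1/3) *\<^sub>R a + (1/3) *\<^sub>R b + (1/3) *\<^sub>R c \<in> interior (convex hull {a, b, c})"
proof -
  have "(1/3::real) + 1/3 + 1/3 = 1" by simp
  from tdet_affine[OF this, of a b c] show ?thesis
    unfolding interior_triangle_iff[OF J] using J by (simp only: nonzero_mult_div_cancel_right) simp
qed

text \<open>Coordinates centred at \<open>a\<close>: the first is the position along a ray from
  \<open>a\<close>, with value 1 on the opposite edge, and the second is the point of [b, c] that
  the ray hits.\<close>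

lemma triangle_interior_param:
  assumes J: "tdet a b c \<noteq> 0"
  shows "interior (convex hull {a, b, c}) = (\<lambda>x::pt. a + (x $ 1) *\<^sub>R ((b - a) + (x $ 2) *\<^sub>R (c - b))) ` box 0 1"
proof (intro set_eqI iffI)
  let ?J = "tdet a b c"
  fix y assume "y \<in> interior (convex hull {a, b, c})"
  then have pos: "0 < tdet y b c / ?J" "0 < tdet a y c / ?J" "0 < tdet a b y / ?J"
    by (auto simp: interior_triangle_iff[OF J])
  define u v w where "u = tdet y b c / ?J" and "v = tdet a y c / ?J" and "w = tdet a b y / ?J"
  have y: "y = u *\<^sub>R a + v *\<^sub>R b + w *\<^sub>R c" "u + v + w = 1"
    unfolding u_def v_def w_def by (fact tdet_combination[OF J])+
  have uvw: "0 < u" "0 < v" "0 < w" using pos by (simp_all add: u_def v_def w_def)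
  \<comment> \<open>The weight of \<open>a\<close> is 1 minus the radius, so the radius is v + w;
    the share of \<open>c\<close> in this remaining weight locates the ray on [b, c].\<close>
  define x :: pt where "x = vector [v + w, w / (v + w)]"
  have x: "x $ 1 = v + w" "x $ 1 * x $ 2 = w" "x $ 2 = w / (v + w)" using uvw by (simp_all add: x_def)
  have "u = 1 - (v + w)" using y(2) by simp
  then have "y = (1 - (v + w)) *\<^sub>R a + v *\<^sub>R b + w *\<^sub>R c" using y(1) by simp
  also have "\<dots> = a + (x $ 1) *\<^sub>R (b - a) + (x $ 1 * x $ 2) *\<^sub>R (c - b)"
    unfolding x(2) unfolding x(1) by (simp add: algebra_simps)
  also have "\<dots> = a + (x $ 1) *\<^sub>R ((b - a) + (x $ 2) *\<^sub>R (c - b))"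
    by (simp add: scaleR_add_right)
  finally have "y = a + (x $ 1) *\<^sub>R ((b - a) + (x $ 2) *\<^sub>R (c - b))" .
  moreover have "x \<in> box 0 1"
    using uvw y(2) x by (simp add: mem_box_cart forall_2)
  ultimately show "y \<in> (\<lambda>x::pt. a + (x $ 1) *\<^sub>R ((b - a) + (x $ 2) *\<^sub>R (c - b))) ` box 0 1" by blast
next
  fix y assume "y \<in> (\<lambda>x::pt. a + (x $ 1) *\<^sub>R ((b - a) + (x $ 2) *\<^sub>R (c - b))) ` box 0 1"
  then obtain x :: pt where x: "x \<in> box 0 1" "y = a + (x $ 1) *\<^sub>R ((b - a) + (x $ 2) *\<^sub>R (c - b))" by blast
  have x2: "0 < x $ 1" "x $ 1 < 1" "0 < x $ 2" "x $ 2 < 1" using x(1) by (auto simp: mem_box_cart)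
  have y: "y = (1 - x $ 1) *\<^sub>R a + (x $ 1 * (1 - x $ 2)) *\<^sub>R b + (x $ 1 * x $ 2) *\<^sub>R c"
    unfolding x(2) by (simp add: algebra_simps)
  have "1 - x $ 1 + x $ 1 * (1 - x $ 2) + x $ 1 * x $ 2 = 1" by (simp add: algebra_simps)
  from tdet_affine[OF this, of a b c] show "y \<in> interior (convex hull {a, b, c})"
    unfolding interior_triangle_iff[OF J] y using J x2 by simp
qed

section \<open>Integration over a triangle in coordinates centred at a vertex\<close>

lemma measurable_vector_2: "(\<lambda>(s::real, t::real). vector [s, t] :: pt) \<in> borel_measurable (lborel \<Otimes>\<^sub>M lborel)"
proof -
  have eq: "(\<lambda>(s::real, t::real). vector [s, t] :: pt) = (\<lambda>p. \<chi> i. if i = 1 then fst p else snd p)"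
    by (auto simp: vec_eq_iff forall_2 fun_eq_iff)
  have "continuous_on UNIV (\<lambda>p::real \<times> real. if i = 1 then fst p else snd p)" for i :: 2
    by (cases "i = 1") (auto intro!: continuous_intros)
  then have "continuous_on UNIV (\<lambda>(s::real, t::real). vector [s, t] :: pt)"
    unfolding eq by (intro continuous_on_vec_lambda)
  then show ?thesis
    by (simp add: lborel_prod borel_measurable_continuous_onI)
qed

text \<open>Fubini's theorem concerns product measures; this transports it to
  \<open>real^2\<close>.\<close>

lemma lborel_real2: "(lborel :: pt measure) = distr (lborel \<Otimes>\<^sub>M lborel) borel (\<lambda>(s, t). vector [s, t])"
proof (rule lborel_eqI)
  note meas = measurable_vector_2
  fix l u :: pt assume lu: "\<And>b. b \<in> Basis \<Longrightarrow> l \<bullet> b \<le> u \<bullet> b"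
  have le: "l $ i \<le> u $ i" for i using lu[of "axis i 1"] by (simp add: inner_axis)
  have "(\<lambda>(s, t). vector [s, t] :: pt) -` box l u \<inter> space (lborel \<Otimes>\<^sub>M lborel) = box (l $ 1) (u $ 1) \<times> box (l $ 2) (u $ 2)"
    by (auto simp: mem_box_cart forall_2 space_pair_measure)
  then have "emeasure (distr (lborel \<Otimes>\<^sub>M lborel) borel (\<lambda>(s, t). vector [s, t])) (box l u) = 
     emeasure (lborel \<Otimes>\<^sub>M lborel) (box (l $ 1) (u $ 1) \<times> box (l $ 2) (u $ 2))"
    using meas by (subst emeasure_distr) auto
  also have "\<dots> = ennreal (u $ 1 - l $ 1) * ennreal (u $ 2 - l $ 2)"
    using le by (subst lborel.emeasure_pair_measure_Times) auto
  also have "\<dots> = ennreal (\<Prod>b\<in>Basis. (u - l) \<bullet> b)"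
  proof -
    have "(\<Prod>b\<in>Basis. (u - l) \<bullet> b) = (\<Prod>i\<in>UNIV. (u - l) $ i)"
      unfolding Basis_vec_def
      by (simp add: UNION_singleton_eq_range, subst prod.reindex) (auto simp: inj_on_def axis_eq_axis inner_axis)
    then show ?thesis using le by (simp add: UNIV_2 ennreal_mult)
  qed
  finally show "emeasure (distr (lborel \<Otimes>\<^sub>M lborel) borel (\<lambda>(s, t). vector [s, t])) (box l u) = ennreal (\<Prod>b\<in>Basis. (u - l) \<bullet> b)" .
qed simp

text \<open>\<open>F\<close> is carried into \<open>real^1\<close>, the value type with which the
  change of variables for absolute integrals is invoked, and is read off again as the single
  component.\<close>

lemma integral_change_of_variables_real2:
  fixes g :: "pt \<Rightarrow> pt" and F :: "pt \<Rightarrow> real"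
  assumes S: "S \<in> sets lebesgue" "g ` S \<in> sets lebesgue"
    and der: "\<And>x. x \<in> S \<Longrightarrow> (g has_derivative g' x) (at x within S)"
    and inj: "inj_on g S" and F: "integrable (lebesgue_on (g ` S)) F"
  shows "integrable (lebesgue_on S) (\<lambda>x. \<bar>det (matrix (g' x))\<bar> * F (g x))"
    "(LINT x|lebesgue_on S. \<bar>det (matrix (g' x))\<bar> * F (g x)) = (LINT x|lebesgue_on (g ` S). F x)"
proof -
  define v where "v x = (vec (F x) :: real^1)" for x
  have abs: "f absolutely_integrable_on T \<longleftrightarrow> integrable (lebesgue_on T) f" if "T \<in> sets lebesgue" for f :: "pt \<Rightarrow> real^1" and T
    unfolding set_integrable_def using that by (simp add: integrable_lebesgue_on_iff)
  have iv: "integrable (lebesgue_on (g ` S)) v"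
    unfolding integrable_iff_component[OF S(2)] v_def using F by simp
  have "v absolutely_integrable_on (g ` S) \<and> integral (g ` S) v = integral (g ` S) v"
    using iv abs S by simp
  then have *: "(\<lambda>x. \<bar>det (matrix (g' x))\<bar> *\<^sub>R v (g x)) absolutely_integrable_on S"
    "integral S (\<lambda>x. \<bar>det (matrix (g' x))\<bar> *\<^sub>R v (g x)) = integral (g ` S) v"
    using has_absolute_integral_change_of_variables[OF S(1) der inj, of v "integral (g ` S) v"] by blast+
  have i1: "integrable (lebesgue_on S) (\<lambda>x. \<bar>det (matrix (g' x))\<bar> *\<^sub>R v (g x))"
    using * abs S by simp
  have comp: "(\<lambda>x. (\<bar>det (matrix (g' x))\<bar> *\<^sub>R v (g x)) $ 1) = (\<lambda>x. \<bar>det (matrix (g' x))\<bar> * F (g x))"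
    by (simp add: v_def)
  show "integrable (lebesgue_on S) (\<lambda>x. \<bar>det (matrix (g' x))\<bar> * F (g x))"
    using integrable_bounded_linear[OF bounded_linear_vec_nth i1, of 1] by (simp only: comp)
  have "(LINT x|lebesgue_on S. \<bar>det (matrix (g' x))\<bar> * F (g x)) = (LINT x|lebesgue_on S. \<bar>det (matrix (g' x))\<bar> *\<^sub>R v (g x)) $ 1"
    using integral_bounded_linear[OF bounded_linear_vec_nth i1, of 1] by (simp only: comp)
  also have "\<dots> = (LINT x|lebesgue_on (g ` S). v x) $ 1"
    using * lebesgue_integral_eq_integral[OF i1 S(1)] lebesgue_integral_eq_integral[OF iv S(2)] by simp
  also have "\<dots> = (LINT x|lebesgue_on (g ` S). v x $ 1)"
    using integral_bounded_linear[OF bounded_linear_vec_nth iv, of 1] by simp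
  finally show "(LINT x|lebesgue_on S. \<bar>det (matrix (g' x))\<bar> * F (g x)) = (LINT x|lebesgue_on (g ` S). F x)"
    by (simp add: v_def)
qed

lemma triangle_interior_bounded: "bounded (interior (convex hull {a, b, c :: pt}))"
  by (meson bounded_convex_hull bounded_subset finite.intros finite_imp_bounded interior_subset)

lemma continuous_integrable_on_bounded_open:
  fixes F :: "pt \<Rightarrow> 'b::{banach,second_countable_topology}"
  assumes F: "continuous_on UNIV F" and U: "open U" "bounded U"
  shows "integrable (lebesgue_on U) F"
proof -
  have "integrable lborel (\<lambda>x. indicator (closure U) x *\<^sub>R F x)"
    using U by (intro borel_integrable_compact continuous_on_subset[OF F]) auto
  then have "integrable lborel (\<lambda>x. indicator U x *\<^sub>R (indicator (closure U) x *\<^sub>R F x))"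
    using U by (intro integrable_mult_indicator[OF _ \<open>integrable lborel (\<lambda>x. indicator (closure U) x *\<^sub>R F x)\<close>]) auto
  moreover have "indicator U x *\<^sub>R (indicator (closure U) x *\<^sub>R F x) = indicator U x *\<^sub>R F x" for x
    using closure_subset[of U] by (auto simp: indicator_def)
  ultimately have "integrable lborel (\<lambda>x. indicator U x *\<^sub>R F x)" by (simp only:)
  moreover have "(\<lambda>x. indicator U x *\<^sub>R F x) \<in> borel_measurable lborel"
    using U borel_measurable_continuous_onI[OF F] by (auto intro!: borel_measurable_scaleR borel_measurable_indicator)
  ultimately have "integrable lebesgue (\<lambda>x. indicator U x *\<^sub>R F x)"
    by (subst integrable_completion) auto
  then show ?thesis using U by (subst integrable_lebesgue_on_iff) auto
qed

lemma triangle_integral_param: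
  fixes F :: "pt \<Rightarrow> real"
  assumes J: "tdet a b c \<noteq> 0" and F: "continuous_on UNIV F"
  shows "(LINT x|lebesgue_on (interior (convex hull {a, b, c})). F x) =
    \<bar>tdet a b c\<bar> * (LINT t|lborel. LINT s|lborel. indicator {0<..<1} t * (indicator {0<..<1} s * (s * F (a + s *\<^sub>R ((b - a) + t *\<^sub>R (c - b))))))"
proof -
  let ?g = "\<lambda>x::pt. a + (x $ 1) *\<^sub>R ((b - a) + (x $ 2) *\<^sub>R (c - b))"
  let ?g' = "\<lambda>x h::pt. (h $ 1) *\<^sub>R ((b - a) + (x $ 2) *\<^sub>R (c - b)) + (x $ 1 * h $ 2) *\<^sub>R (c - b)"
  let ?K = "convex hull {a, b, c}" and ?S = "box 0 1 :: pt set"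
  have img: "?g ` ?S = interior ?K" using triangle_interior_param[OF J] by simp
  have der: "(?g has_derivative ?g' x) (at x within ?S)" for x
    by (auto intro!: derivative_eq_intros bounded_linear.has_derivative[OF bounded_linear_vec_nth] simp: scaleR_add_right algebra_simps)
  \<comment> \<open>The Jacobian is proportional to the radius; this is the weight s that stays in
    the integrand.\<close>
  have det: "det (matrix (?g' x)) = x $ 1 * tdet a b c" for x
    by (simp add: det_2 matrix_def axis_def tdet_def algebra_simps)
  have inj: "inj_on ?g ?S"
  proof (rule inj_onI)
    fix x y :: pt assume x: "x \<in> ?S" and y: "y \<in> ?S" and eq: "?g x = ?g y"
    have coord: "tdet (?g z) b c = (1 - z $ 1) * tdet a b c" "tdet a b (?g z) = (z $ 1 * z $ 2) * tdet a b c" for z :: pt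
      by (simp_all add: tdet_def algebra_simps)
    have "1 - x $ 1 = 1 - y $ 1" using coord(1)[of x] coord(1)[of y] eq J by simp
    moreover have "x $ 1 * x $ 2 = y $ 1 * y $ 2" using coord(2)[of x] coord(2)[of y] eq J by simp
    moreover have "0 < x $ 1" using x by (simp add: mem_box_cart)
    ultimately show "x = y" by (simp add: vec_eq_iff forall_2)
  qed
  have iF: "integrable (lebesgue_on (?g ` ?S)) F"
    unfolding img by (rule continuous_integrable_on_bounded_open[OF F open_interior triangle_interior_bounded])
  have "?S \<in> sets lebesgue" "?g ` ?S \<in> sets lebesgue" unfolding img by auto
  note cov = integral_change_of_variables_real2[OF this der inj iF, unfolded img det]
  let ?h = "\<lambda>x::pt. indicator ?S x *\<^sub>R (\<bar>x $ 1 * tdet a b c\<bar> * F (?g x))"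
  have cont: "continuous_on UNIV (\<lambda>x. \<bar>x $ 1 * tdet a b c\<bar> * F (?g x))"
    by (intro continuous_intros continuous_on_compose2[OF F]) auto
  have hm: "?h \<in> borel_measurable borel"
    by (intro borel_measurable_scaleR borel_measurable_continuous_onI[OF cont] borel_measurable_indicator) auto
  note Pm = measurable_vector_2
  have ih: "integrable lborel ?h"
  proof -
    have "integrable lebesgue ?h"
      using cov(1) by (rule integrable_lebesgue_on_iff[THEN iffD1, rotated]) auto
    then show ?thesis
      by (rule integrable_completion[THEN iffD1, rotated]) (use hm in simp)
  qed
  have hv: "?h (vector [s, t]) = \<bar>tdet a b c\<bar> * (indicator {0<..<1} t * (indicator {0<..<1} s * (s * F (a + s *\<^sub>R ((b - a) + t *\<^sub>R (c - b))))))" for s t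
    by (auto simp: indicator_def mem_box_cart forall_2 abs_mult)
  have "(LINT x|lebesgue_on (interior ?K). F x) = (LINT x|lebesgue_on ?S. \<bar>x $ 1 * tdet a b c\<bar> * F (?g x))"
    using cov(2) by simp
  also have "\<dots> = (LINT x|lborel. ?h x)"
    using hm by (subst integral_lebesgue_on_eq) (auto intro!: integral_completion)
  also have "\<dots> = (LINT p|(lborel \<Otimes>\<^sub>M lborel). ?h (case p of (s, t) \<Rightarrow> vector [s, t]))"
    by (subst lborel_real2) (rule integral_distr[OF Pm], use hm in simp)
  also have "\<dots> = (LINT p|(lborel \<Otimes>\<^sub>M lborel). (case p of (s, t) \<Rightarrow> ?h (vector [s, t])))"
    by (rule Bochner_Integration.integral_cong) auto
  also have "\<dots> = (LINT t|lborel. LINT s|lborel. ?h (vector [s, t]))"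
  proof (rule lborel_pair.integral_snd[symmetric])
    have "integrable (distr (lborel \<Otimes>\<^sub>M lborel) borel (\<lambda>(s, t). vector [s, t])) ?h"
      using ih lborel_real2 by simp
    then have "integrable (lborel \<Otimes>\<^sub>M lborel) (\<lambda>p. ?h (case p of (s, t) \<Rightarrow> vector [s, t]))"
      using integrable_distr[OF Pm] by blast
    then show "integrable (lborel \<Otimes>\<^sub>M lborel) (\<lambda>(s, t). ?h (vector [s, t]))"
      by (simp add: case_prod_unfold)
  qed
  also have "\<dots> = \<bar>tdet a b c\<bar> * (LINT t|lborel. LINT s|lborel. indicator {0<..<1} t * (indicator {0<..<1} s * (s * F (a + s *\<^sub>R ((b - a) + t *\<^sub>R (c - b))))))"
    by (simp only: hv integral_mult_right_zero)
  finally show ?thesis .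
qed

text \<open>Along the ray a + s d the weighted integrand s (2 phi + grad phi . (s d)) is the
  derivative of s^2 phi (a + s d). The inner integral is therefore the value on the opposite edge,
  and the factor s^2 removes the contribution of the vertex.\<close>

lemma triangle_radial_formula:
  assumes J: "tdet a b c \<noteq> 0" and C1: "C1_with_gradient \<phi> \<phi>'"
  shows "(LINT x|lebesgue_on (interior (convex hull {a, b, c})). 2 * \<phi> x + \<phi>' x \<bullet> (x - a)) =
    \<bar>tdet a b c\<bar> * (LINT t|lebesgue_on {0..1}. \<phi> (linepath b c t))"
proof -
  note c = C1_with_gradient_continuous[OF C1, of UNIV]
  let ?F = "\<lambda>x. 2 * \<phi> x + \<phi>' x \<bullet> (x - a)"
  have F: "continuous_on UNIV ?F" by (intro continuous_intros c)
  have ind: "AE t::real in lborel. indicator {0<..<1} t = (indicator {0..1} t :: real)"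
    using AE_lborel_singleton[of "0::real"] AE_lborel_singleton[of "1::real"]
    by eventually_elim (auto simp: indicator_def)
  have inner: "(LINT s|lborel. indicator {0<..<1} s * (s * ?F (a + s *\<^sub>R d))) = \<phi> (a + d)" for d
  proof -
    have cF: "continuous_on UNIV (\<lambda>s. s * ?F (a + s *\<^sub>R d))"
      by (intro continuous_intros continuous_on_compose2[OF c(1)] continuous_on_compose2[OF c(2)]) auto
    then have m: "(\<lambda>s. s * ?F (a + s *\<^sub>R d)) \<in> borel_measurable borel" by (rule borel_measurable_continuous_onI)
    have "(LINT s|lborel. indicator {0<..<1} s * (s * ?F (a + s *\<^sub>R d))) = (LINT s|lborel. indicator {0..1} s * (s * ?F (a + s *\<^sub>R d)))"
    proof (rule integral_cong_AE)
      show "AE s in lborel. indicator {0<..<1} s * (s * ?F (a + s *\<^sub>R d)) = indicator {0..1} s * (s * ?F (a + s *\<^sub>R d))"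
        using ind by eventually_elim simp
    qed (use m in \<open>auto intro!: borel_measurable_times\<close>)
    also have "\<dots> = (LINT s|lborel. (s * ?F (a + s *\<^sub>R d)) * indicator {0..1} s)"
      by (simp only: mult.commute)
    also have "\<dots> = 1\<^sup>2 * \<phi> (a + 1 *\<^sub>R d) - 0\<^sup>2 * \<phi> (a + 0 *\<^sub>R d)"
    proof (rule integral_FTC_Icc_real)
      fix s :: real
      have "(\<phi> has_derivative (\<lambda>h. h \<bullet> \<phi>' (a + s *\<^sub>R d))) (at (a + s *\<^sub>R d))"
        using C1 by (simp add: C1_with_gradient_def gderiv_def)
      then have "((\<lambda>s. \<phi> (a + s *\<^sub>R d)) has_derivative (\<lambda>h. (h *\<^sub>R d) \<bullet> \<phi>' (a + s *\<^sub>R d))) (at s)"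
        by (rule has_derivative_compose[rotated]) (auto intro!: derivative_eq_intros)
      then have d1: "((\<lambda>s. \<phi> (a + s *\<^sub>R d)) has_real_derivative (d \<bullet> \<phi>' (a + s *\<^sub>R d))) (at s)"
        by (simp add: has_field_derivative_def mult_commute_abs)
      show "((\<lambda>s. s\<^sup>2 * \<phi> (a + s *\<^sub>R d)) has_real_derivative s * ?F (a + s *\<^sub>R d)) (at s)"
        by (rule derivative_eq_intros d1 refl)+ (simp add: algebra_simps power2_eq_square inner_commute)
      show "isCont (\<lambda>s. s * ?F (a + s *\<^sub>R d)) s"
        using cF by (simp add: continuous_on_eq_continuous_at)
    qed simp
    finally show ?thesis by simp
  qed
  have cl: "continuous_on UNIV (\<lambda>t. \<phi> (linepath b c t))"
    unfolding linepath_def by (intro continuous_intros continuous_on_compose2[OF c(1)]) auto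
  have "(LINT x|lebesgue_on (interior (convex hull {a, b, c})). ?F x) =
    \<bar>tdet a b c\<bar> * (LINT t|lborel. indicator {0<..<1} t * \<phi> (a + ((b - a) + t *\<^sub>R (c - b))))"
    unfolding triangle_integral_param[OF J F] integral_mult_right_zero inner ..
  also have "(LINT t|lborel. indicator {0<..<1} t * \<phi> (a + ((b - a) + t *\<^sub>R (c - b)))) = (LINT t|lborel. indicator {0..1} t * \<phi> (linepath b c t))"
  proof (rule integral_cong_AE)
    have eq: "a + ((b - a) + t *\<^sub>R (c - b)) = linepath b c t" for t
      by (simp add: linepath_def algebra_simps)
    show "AE t in lborel. indicator {0<..<1} t * \<phi> (a + ((b - a) + t *\<^sub>R (c - b))) = indicator {0..1} t * \<phi> (linepath b c t)"
      using ind by eventually_elim (simp add: eq)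
    show "(\<lambda>t. indicator {0<..<1} t * \<phi> (a + ((b - a) + t *\<^sub>R (c - b)))) \<in> borel_measurable lborel"
      unfolding eq using borel_measurable_continuous_onI[OF cl] by (auto intro!: borel_measurable_times)
    show "(\<lambda>t. indicator {0..1} t * \<phi> (linepath b c t)) \<in> borel_measurable lborel"
      using borel_measurable_continuous_onI[OF cl] by (auto intro!: borel_measurable_times)
  qed
  also have "\<dots> = (LINT t|lebesgue. indicator {0..1} t * \<phi> (linepath b c t))"
    by (rule integral_completion[symmetric]) (use borel_measurable_continuous_onI[OF cl] in \<open>auto intro!: borel_measurable_times\<close>)
  also have "\<dots> = (LINT t|lebesgue_on {0..1}. \<phi> (linepath b c t))"
    by (subst integral_lebesgue_on_eq) auto
  finally show ?thesis .
qed

text \<open>The absolute value is not C1, but sqrt (phi^2 + e^2) exceeds it by at most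
  \<open>e\<close> and has no longer gradient than phi. The radial formula applies to it, and the
  excess is removed by letting \<open>e\<close> tend to 0.\<close>

lemma triangle_trace_inequality:
  assumes J: "tdet a b c \<noteq> 0" and C1: "C1_with_gradient \<phi> \<phi>'"
    and d: "\<And>x. x \<in> interior (convex hull {a, b, c}) \<Longrightarrow> norm (x - a) \<le> d"
  shows "\<bar>tdet a b c\<bar> * (LINT t|lebesgue_on {0..1}. \<bar>\<phi> (linepath b c t)\<bar>) \<le>
    2 * (LINT x|lebesgue_on (interior (convex hull {a, b, c})). \<bar>\<phi> x\<bar>) + d * (LINT x|lebesgue_on (interior (convex hull {a, b, c})). norm (\<phi>' x))"
proof -
  let ?U = "interior (convex hull {a, b, c})"
  note c = C1_with_gradient_continuous[OF C1, of UNIV]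
  note int = continuous_integrable_on_bounded_open[OF _ open_interior triangle_interior_bounded, of _ a b c]
  have cl: "continuous_on {0..1} (\<lambda>t. \<phi> (linepath b c t))"
    unfolding linepath_def by (intro continuous_intros continuous_on_compose2[OF c(1)]) auto
  have bound: "\<bar>tdet a b c\<bar> * (LINT t|lebesgue_on {0..1}. \<bar>\<phi> (linepath b c t)\<bar>) \<le>
    2 * (LINT x|lebesgue_on ?U. \<bar>\<phi> x\<bar>) + d * (LINT x|lebesgue_on ?U. norm (\<phi>' x)) + e * (LINT x|lebesgue_on ?U. 2)" if e: "0 < e" for e
  proof -
    define \<psi> where "\<psi> x = sqrt ((\<phi> x)\<^sup>2 + e\<^sup>2)" for x
    define \<psi>' where "\<psi>' x = (\<phi> x / \<psi> x) *\<^sub>R \<phi>' x" for x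
    have pos: "0 < (\<phi> x)\<^sup>2 + e\<^sup>2" for x using e by (simp add: add_nonneg_pos)
    have psi0: "0 < \<psi> x" for x unfolding \<psi>_def using pos by simp
    have ge: "\<bar>\<phi> x\<bar> \<le> \<psi> x" for x unfolding \<psi>_def by (rule real_le_rsqrt) simp
    have le: "\<psi> x \<le> \<bar>\<phi> x\<bar> + e" for x
      unfolding \<psi>_def using e by (intro real_le_lsqrt) (auto simp: power2_sum)
    have C1\<psi>: "C1_with_gradient \<psi> \<psi>'"
      unfolding C1_with_gradient_def
    proof (intro conjI allI)
      fix x
      have "GDERIV \<phi> x :> \<phi>' x" using C1 by (simp add: C1_with_gradient_def)
      moreover have "((\<lambda>y. sqrt (y\<^sup>2 + e\<^sup>2)) has_real_derivative (\<phi> x / \<psi> x)) (at (\<phi> x))"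
        using pos[of x] by (auto intro!: derivative_eq_intros simp: \<psi>_def field_simps)
      ultimately show "GDERIV \<psi> x :> \<psi>' x"
        unfolding \<psi>_def[abs_def] \<psi>'_def by (rule GDERIV_DERIV_compose)
      have "continuous_on UNIV \<psi>" unfolding \<psi>_def by (intro continuous_intros c)
      then show "continuous_on UNIV \<psi>'"
        unfolding \<psi>'_def using psi0 by (intro continuous_intros c) (auto simp: less_imp_neq[THEN not_sym])
    qed
    note cpsi = C1_with_gradient_continuous[OF C1\<psi>, of UNIV]
    have norm': "norm (\<psi>' x) \<le> norm (\<phi>' x)" for x
    proof -
      have "\<bar>\<phi> x / \<psi> x\<bar> \<le> 1" using ge[of x] psi0[of x] by (simp add: divide_le_eq)
      then show ?thesis unfolding \<psi>'_def by (simp add: mult_left_le_one_le del: abs_divide)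
    qed
    have clp: "continuous_on {0..1} (\<lambda>t. \<psi> (linepath b c t))"
      unfolding linepath_def by (intro continuous_intros continuous_on_compose2[OF cpsi(1)]) auto
    have "\<bar>tdet a b c\<bar> * (LINT t|lebesgue_on {0..1}. \<bar>\<phi> (linepath b c t)\<bar>) \<le> \<bar>tdet a b c\<bar> * (LINT t|lebesgue_on {0..1}. \<psi> (linepath b c t))"
      by (intro mult_left_mono integral_mono continuous_imp_integrable_real clp continuous_on_rabs cl ge) auto
    also have "\<dots> = (LINT x|lebesgue_on ?U. 2 * \<psi> x + \<psi>' x \<bullet> (x - a))"
      using triangle_radial_formula[OF J C1\<psi>] by simp
    also have "\<dots> \<le> (LINT x|lebesgue_on ?U. 2 * \<bar>\<phi> x\<bar> + d * norm (\<phi>' x) + e * 2)"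
    proof (rule integral_mono)
      show "integrable (lebesgue_on ?U) (\<lambda>x. 2 * \<psi> x + \<psi>' x \<bullet> (x - a))"
        by (intro int continuous_intros cpsi)
      show "integrable (lebesgue_on ?U) (\<lambda>x. 2 * \<bar>\<phi> x\<bar> + d * norm (\<phi>' x) + e * 2)"
        by (intro int continuous_intros c)
      fix x assume "x \<in> space (lebesgue_on ?U)"
      then have x: "norm (x - a) \<le> d" using d by (simp add: space_restrict_space)
      have "\<psi>' x \<bullet> (x - a) \<le> norm (\<psi>' x) * norm (x - a)" by (rule norm_cauchy_schwarz)
      also have "\<dots> \<le> norm (\<phi>' x) * d" using x norm' by (intro mult_mono) auto
      finally show "2 * \<psi> x + \<psi>' x \<bullet> (x - a) \<le> 2 * \<bar>\<phi> x\<bar> + d * norm (\<phi>' x) + e * 2"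
        using le[of x] by (simp add: mult.commute)
    qed
    also have "\<dots> = 2 * (LINT x|lebesgue_on ?U. \<bar>\<phi> x\<bar>) + d * (LINT x|lebesgue_on ?U. norm (\<phi>' x)) + e * (LINT x|lebesgue_on ?U. 2)"
    proof -
      have "integrable (lebesgue_on ?U) (\<lambda>x. \<bar>\<phi> x\<bar>)" "integrable (lebesgue_on ?U) (\<lambda>x. norm (\<phi>' x))" "integrable (lebesgue_on ?U) (\<lambda>x. 2 :: real)"
        by (intro int continuous_intros c)+
      then show ?thesis
        by (simp only: Bochner_Integration.integral_add Bochner_Integration.integrable_add integrable_mult_right integral_mult_right_zero)
    qed
    finally show ?thesis .
  qed
  define A where "A = \<bar>tdet a b c\<bar> * (LINT t|lebesgue_on {0..1}. \<bar>\<phi> (linepath b c t)\<bar>)"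
  define B where "B = 2 * (LINT x|lebesgue_on ?U. \<bar>\<phi> x\<bar>) + d * (LINT x|lebesgue_on ?U. norm (\<phi>' x))"
  define M where "M = (LINT x|lebesgue_on ?U. (2::real))"
  have M0: "0 \<le> M" unfolding M_def by simp
  have "A \<le> B + e" if "0 < e" for e
  proof -
    \<comment> \<open>The excess in \<open>bound\<close> is the chosen parameter times
      \<open>M\<close>; the 1 in the denominator covers M = 0 as well.\<close>
    have "0 < e / (M + 1)" using that M0 by simp
    from bound[OF this] have "A \<le> B + e / (M + 1) * M" unfolding A_def B_def M_def .
    also have "e / (M + 1) * M \<le> e" using that M0 by (simp add: divide_le_eq mult_left_mono)
    finally show ?thesis by simp
  qed
  then have "A \<le> B" by (rule field_le_epsilon)
  then show ?thesis by (simp add: A_def B_def)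
qed

section \<open>Edges with their opposite vertices, and traces on a triangle\<close>

definition apex_of :: "pt set \<Rightarrow> pt set \<Rightarrow> pt \<Rightarrow> bool" where
  "apex_of K e a \<longleftrightarrow> K = convex hull {a, fst (edge_ends e), snd (edge_ends e)} \<and>
     tdet a (fst (edge_ends e)) (snd (edge_ends e)) \<noteq> 0"

text \<open>Twice the area of the triangle with base \<open>e\<close> and apex \<open>a\<close>,
  that is, length times height. The absolute value makes it independent of the order in which
  \<open>edge_ends\<close> lists the end points.\<close>

definition edge_det :: "pt set \<Rightarrow> pt \<Rightarrow> real" where
  "edge_det e a = \<bar>tdet a (fst (edge_ends e)) (snd (edge_ends e))\<bar>"

lemma apex_edge_det_pos: "apex_of K e a \<Longrightarrow> 0 < edge_det e a"
  by (simp add: apex_of_def edge_det_def)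

lemma edge_length_pos: "apex_of K e a \<Longrightarrow> 0 < edge_length e"
  by (auto simp: apex_of_def edge_length_def)

text \<open>Fatou's lemma applied to |s n - s m| as m grows: the pointwise limit inherits the Cauchy
  estimate. Since \<open>f\<close> is given beforehand, the almost everywhere limit and the L1 limit
  are the same function.\<close>

lemma L1_cauchy_limit:
  fixes s :: "nat \<Rightarrow> 'a \<Rightarrow> real"
  assumes s: "\<And>n. integrable M (s n)" and f[measurable]: "f \<in> borel_measurable M"
    and cauchy: "\<And>e. 0 < e \<Longrightarrow> \<exists>N. \<forall>i\<ge>N. \<forall>j\<ge>N. (LINT x|M. \<bar>s i x - s j x\<bar>) < e"
    and lim: "AE x in M. (\<lambda>n. s n x) \<longlonglongrightarrow> f x"
  shows "integrable M f" "(\<lambda>n. LINT x|M. \<bar>s n x - f x\<bar>) \<longlonglongrightarrow> 0"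
proof -
  have sm[measurable]: "s n \<in> borel_measurable M" for n using s by auto
  have key: "(\<integral>\<^sup>+ x. ennreal \<bar>s n x - f x\<bar> \<partial>M) \<le> ennreal e" if e: "0 < e" and N: "\<forall>i\<ge>N. \<forall>j\<ge>N. (LINT x|M. \<bar>s i x - s j x\<bar>) < e" and n: "N \<le> n" for e N n
  proof -
    have "(\<integral>\<^sup>+ x. ennreal \<bar>s n x - f x\<bar> \<partial>M) = (\<integral>\<^sup>+ x. liminf (\<lambda>m. ennreal \<bar>s n x - s m x\<bar>) \<partial>M)"
    proof (rule nn_integral_cong_AE)
      show "AE x in M. ennreal \<bar>s n x - f x\<bar> = liminf (\<lambda>m. ennreal \<bar>s n x - s m x\<bar>)"
        using lim
      proof eventually_elim
        case (elim x)
        have "(\<lambda>m. ennreal \<bar>s n x - s m x\<bar>) \<longlonglongrightarrow> ennreal \<bar>s n x - f x\<bar>"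
          by (intro tendsto_ennrealI tendsto_intros elim)
        then show ?case by (intro lim_imp_Liminf[symmetric]) auto
      qed
    qed
    also have "\<dots> \<le> liminf (\<lambda>m. \<integral>\<^sup>+ x. ennreal \<bar>s n x - s m x\<bar> \<partial>M)"
      by (rule nn_integral_liminf) measurable
    also have "\<dots> \<le> ennreal e"
    proof (rule Liminf_le)
      show "\<forall>\<^sub>F m in sequentially. (\<integral>\<^sup>+ x. ennreal \<bar>s n x - s m x\<bar> \<partial>M) \<le> ennreal e"
      proof (rule eventually_sequentiallyI)
        fix m assume m: "N \<le> m"
        have "(\<integral>\<^sup>+ x. ennreal \<bar>s n x - s m x\<bar> \<partial>M) = ennreal (LINT x|M. \<bar>s n x - s m x\<bar>)"
          using s by (intro nn_integral_eq_integral) auto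
        also have "\<dots> \<le> ennreal e" using N n m by (intro ennreal_leI) (simp add: less_imp_le)
        finally show "(\<integral>\<^sup>+ x. ennreal \<bar>s n x - s m x\<bar> \<partial>M) \<le> ennreal e" .
      qed
    qed simp
    finally show ?thesis .
  qed
  obtain N where N: "\<forall>i\<ge>N. \<forall>j\<ge>N. (LINT x|M. \<bar>s i x - s j x\<bar>) < 1" using cauchy[of 1] by auto
  have "integrable M (\<lambda>x. s N x - f x)"
    using key[OF zero_less_one N order_refl] by (intro integrableI_bounded) (auto simp: less_top[symmetric] top_unique)
  then have "integrable M (\<lambda>x. s N x - (s N x - f x))" using s by (rule Bochner_Integration.integrable_diff[rotated])
  then show int: "integrable M f" by simp
  show "(\<lambda>n. LINT x|M. \<bar>s n x - f x\<bar>) \<longlonglongrightarrow> 0"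
  proof (rule LIMSEQ_I)
    fix e :: real assume e: "0 < e"
    then obtain N where N: "\<forall>i\<ge>N. \<forall>j\<ge>N. (LINT x|M. \<bar>s i x - s j x\<bar>) < e/2" using cauchy[of "e/2"] by auto
    have "norm ((LINT x|M. \<bar>s n x - f x\<bar>) - 0) < e" if "N \<le> n" for n
    proof -
      have "ennreal (LINT x|M. \<bar>s n x - f x\<bar>) \<le> ennreal (e/2)"
        using key[of "e/2" N n] e N that s int by (subst nn_integral_eq_integral[symmetric]) auto
      then show ?thesis using e by simp
    qed
    then show "\<exists>no. \<forall>n\<ge>no. norm ((LINT x|M. \<bar>s n x - f x\<bar>) - 0) < e" by blast
  qed
qed

text \<open>A trace is one function for all edges of a triangle, so a single subsequence must
  converge almost everywhere on each of finitely many edges. It is extracted one index after the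
  other.\<close>

lemma common_AE_cauchy_subseq:
  fixes s :: "'i \<Rightarrow> nat \<Rightarrow> 'a \<Rightarrow> real"
  assumes "finite I" and s: "\<And>i n. i \<in> I \<Longrightarrow> integrable M (s i n)"
    and cauchy: "\<And>i e. i \<in> I \<Longrightarrow> 0 < e \<Longrightarrow> \<exists>N. \<forall>m\<ge>N. \<forall>n\<ge>N. (LINT x|M. \<bar>s i m x - s i n x\<bar>) < e"
  shows "\<exists>r :: nat \<Rightarrow> nat. strict_mono r \<and> (\<forall>i\<in>I. AE x in M. Cauchy (\<lambda>n. s i (r n) x))"
  using assms
proof (induction I rule: finite_induct)
  case empty
  then show ?case by (intro exI[of _ id]) (auto simp: strict_mono_def)
next
  case (insert i I)
  then obtain r :: "nat \<Rightarrow> nat" where r: "strict_mono r" "\<forall>i\<in>I. AE x in M. Cauchy (\<lambda>n. s i (r n) x)"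
    by force
  have "\<exists>N. \<forall>m\<ge>N. \<forall>n\<ge>N. (LINT x|M. norm (s i (r m) x - s i (r n) x)) < e" if e: "0 < e" for e
  proof -
    obtain N where "\<forall>m\<ge>N. \<forall>n\<ge>N. (LINT x|M. \<bar>s i m x - s i n x\<bar>) < e" using insert.prems(2)[of i e] e by auto
    then have "\<forall>m\<ge>N. \<forall>n\<ge>N. (LINT x|M. norm (s i (r m) x - s i (r n) x)) < e"
      using order_trans[OF _ seq_suble[OF r(1)]] by simp
    then show ?thesis by blast
  qed
  then obtain q where q: "strict_mono q" "AE x in M. Cauchy (\<lambda>n. s i (r (q n)) x)"
    using cauchy_L1_AE_cauchy_subseq[of M "\<lambda>n. s i (r n)", OF insert.prems(1)[OF insertI1]] by blast
  have "AE x in M. Cauchy (\<lambda>n. s j (r (q n)) x)" if "j \<in> I" for j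
    using r(2)[rule_format, OF that]
  proof eventually_elim
    case (elim x)
    from Cauchy_subseq_Cauchy[OF this q(1)] show ?case by (simp add: o_def)
  qed
  then show ?case
    using q strict_mono_o[OF r(1) q(1)] by (intro exI[of _ "r \<circ> q"]) (auto simp: o_def)
qed

lemma radial_functional_integrable:
  assumes U: "bounded U" "open U" and u: "integrable (lebesgue_on U) u" and D: "integrable (lebesgue_on U) D"
  shows "integrable (lebesgue_on U) (\<lambda>x. 2 * u x + D x \<bullet> (x - a :: pt))"
proof -
  obtain d where d: "\<And>x. x \<in> U \<Longrightarrow> norm x \<le> d" using U(1) by (auto simp: bounded_iff)
  have "integrable (lebesgue_on U) (\<lambda>x. D x \<bullet> (x - a))"
  proof (rule Bochner_Integration.integrable_bound)
    show "integrable (lebesgue_on U) (\<lambda>x. (d + norm a) * norm (D x))" using D by auto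
    have "(\<lambda>x. x - a) \<in> borel_measurable (lebesgue_on U)"
      by (intro measurable_restrict_space1 measurable_completion) simp
    then show "(\<lambda>x. D x \<bullet> (x - a)) \<in> borel_measurable (lebesgue_on U)"
      using D by (intro borel_measurable_inner) auto
    show "AE x in lebesgue_on U. norm (D x \<bullet> (x - a)) \<le> norm ((d + norm a) * norm (D x))"
    proof (rule AE_I2)
      fix x assume "x \<in> space (lebesgue_on U)"
      then have x: "norm (x - a) \<le> d + norm a" using d[of x] norm_triangle_ineq4[of x a] by (simp add: space_restrict_space)
      have "\<bar>D x \<bullet> (x - a)\<bar> \<le> norm (D x) * norm (x - a)" by (rule Cauchy_Schwarz_ineq2)
      also have "\<dots> \<le> norm (D x) * (d + norm a)" using x by (intro mult_left_mono) auto
      also have "\<dots> \<le> \<bar>(d + norm a) * norm (D x)\<bar>" by (simp only: mult.commute abs_ge_self)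
      finally show "norm (D x \<bullet> (x - a)) \<le> norm ((d + norm a) * norm (D x))" by simp
    qed
  qed
  then show ?thesis using u by simp
qed

text \<open>On a bounded set |x - a| is bounded, so the volume side of the radial formula is
  continuous for W^{1,1} convergence; this carries the formula from C1 to Sobolev functions.\<close>

lemma radial_functional_tendsto:
  assumes U: "bounded U" "open U" and u: "integrable (lebesgue_on U) u" and D: "integrable (lebesgue_on U) D"
    and C1: "\<And>n::nat. C1_with_gradient (\<phi> n) (\<phi>' n)"
    and 1: "(\<lambda>n. LINT x|lebesgue_on U. \<bar>\<phi> n x - u x\<bar>) \<longlonglongrightarrow> 0"
    and 2: "(\<lambda>n. LINT x|lebesgue_on U. norm (\<phi>' n x - D x)) \<longlonglongrightarrow> 0"
  shows "(\<lambda>n. LINT x|lebesgue_on U. 2 * \<phi> n x + \<phi>' n x \<bullet> (x - a)) \<longlonglongrightarrow> (LINT x|lebesgue_on U. 2 * u x + D x \<bullet> (x - a))"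
proof -
  obtain d where d: "\<And>x. x \<in> U \<Longrightarrow> norm x \<le> d" using U(1) by (auto simp: bounded_iff)
  define m where "m = \<bar>d\<bar> + norm a"
  have int: "integrable (lebesgue_on U) (\<phi> n)" "integrable (lebesgue_on U) (\<phi>' n)" for n
    using C1_with_gradient_continuous[OF C1, of UNIV n] U by (auto intro: continuous_integrable_on_bounded_open)
  have bound: "\<bar>(LINT x|lebesgue_on U. 2 * \<phi> n x + \<phi>' n x \<bullet> (x - a)) - (LINT x|lebesgue_on U. 2 * u x + D x \<bullet> (x - a))\<bar> \<le>
    2 * (LINT x|lebesgue_on U. \<bar>\<phi> n x - u x\<bar>) + m * (LINT x|lebesgue_on U. norm (\<phi>' n x - D x))" for n
  proof -
    have i1: "integrable (lebesgue_on U) (\<lambda>x. \<bar>\<phi> n x - u x\<bar>)" using int u by auto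
    have i2: "integrable (lebesgue_on U) (\<lambda>x. norm (\<phi>' n x - D x))" using int D by auto
    note i3 = radial_functional_integrable[OF U int(1)[of n] int(2)[of n], of a] and i4 = radial_functional_integrable[OF U u D, of a]
    have "\<bar>(LINT x|lebesgue_on U. 2 * \<phi> n x + \<phi>' n x \<bullet> (x - a)) - (LINT x|lebesgue_on U. 2 * u x + D x \<bullet> (x - a))\<bar> =
      \<bar>LINT x|lebesgue_on U. (2 * \<phi> n x + \<phi>' n x \<bullet> (x - a)) - (2 * u x + D x \<bullet> (x - a))\<bar>"
      by (subst Bochner_Integration.integral_diff[OF i3 i4]) simp
    also have "\<dots> \<le> (LINT x|lebesgue_on U. \<bar>(2 * \<phi> n x + \<phi>' n x \<bullet> (x - a)) - (2 * u x + D x \<bullet> (x - a))\<bar>)"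
      by (rule integral_abs_bound)
    also have "\<dots> \<le> (LINT x|lebesgue_on U. 2 * \<bar>\<phi> n x - u x\<bar> + m * norm (\<phi>' n x - D x))"
    proof (rule integral_mono)
      show "integrable (lebesgue_on U) (\<lambda>x. \<bar>(2 * \<phi> n x + \<phi>' n x \<bullet> (x - a)) - (2 * u x + D x \<bullet> (x - a))\<bar>)"
        using i3 i4 by (intro integrable_abs Bochner_Integration.integrable_diff)
      show "integrable (lebesgue_on U) (\<lambda>x. 2 * \<bar>\<phi> n x - u x\<bar> + m * norm (\<phi>' n x - D x))"
        using i1 i2 by simp
      fix x assume "x \<in> space (lebesgue_on U)"
      then have x: "norm (x - a) \<le> m" using d[of x] norm_triangle_ineq4[of x a] by (simp add: space_restrict_space m_def)
      have "\<bar>(2 * \<phi> n x + \<phi>' n x \<bullet> (x - a)) - (2 * u x + D x \<bullet> (x - a))\<bar> = \<bar>2 * (\<phi> n x - u x) + (\<phi>' n x - D x) \<bullet> (x - a)\<bar>"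
        by (simp add: inner_diff_left algebra_simps)
      also have "\<dots> \<le> 2 * \<bar>\<phi> n x - u x\<bar> + \<bar>(\<phi>' n x - D x) \<bullet> (x - a)\<bar>"
        using abs_triangle_ineq[of "2 * (\<phi> n x - u x)" "(\<phi>' n x - D x) \<bullet> (x - a)"] by (simp only: abs_mult abs_numeral)
      also have "\<bar>(\<phi>' n x - D x) \<bullet> (x - a)\<bar> \<le> norm (\<phi>' n x - D x) * norm (x - a)" by (rule Cauchy_Schwarz_ineq2)
      also have "\<dots> \<le> norm (\<phi>' n x - D x) * m" using x by (intro mult_left_mono) auto
      finally show "\<bar>(2 * \<phi> n x + \<phi>' n x \<bullet> (x - a)) - (2 * u x + D x \<bullet> (x - a))\<bar> \<le> 2 * \<bar>\<phi> n x - u x\<bar> + m * norm (\<phi>' n x - D x)"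
        by (simp add: mult.commute)
    qed
    also have "\<dots> = 2 * (LINT x|lebesgue_on U. \<bar>\<phi> n x - u x\<bar>) + m * (LINT x|lebesgue_on U. norm (\<phi>' n x - D x))"
      using i1 i2 by simp
    finally show ?thesis .
  qed
  have "(\<lambda>n. 2 * (LINT x|lebesgue_on U. \<bar>\<phi> n x - u x\<bar>) + m * (LINT x|lebesgue_on U. norm (\<phi>' n x - D x))) \<longlonglongrightarrow> 2 * 0 + m * 0"
    by (intro tendsto_intros 1 2)
  then have "(\<lambda>n. 2 * (LINT x|lebesgue_on U. \<bar>\<phi> n x - u x\<bar>) + m * (LINT x|lebesgue_on U. norm (\<phi>' n x - D x))) \<longlonglongrightarrow> 0" by simp
  then have "(\<lambda>n. (LINT x|lebesgue_on U. 2 * \<phi> n x + \<phi>' n x \<bullet> (x - a)) - (LINT x|lebesgue_on U. 2 * u x + D x \<bullet> (x - a))) \<longlonglongrightarrow> 0"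
    by (rule Lim_null_comparison[rotated]) (simp add: bound)
  then show ?thesis by (rule LIM_zero_cancel)
qed

text \<open>A convex set is star-shaped about each of its interior points in the strict sense that
  the approximation asks for: moved points become interior at once.\<close>

lemma W11_triangle_approx:
  assumes K: "apex_of K e a" and wg: "weak_gradient (interior K) u D"
    and u: "integrable (lebesgue_on (interior K)) u" and D: "integrable (lebesgue_on (interior K)) D"
  obtains \<phi> \<phi>' where "\<And>n::nat. C1_with_gradient (\<phi> n) (\<phi>' n)"
    "(\<lambda>n. LINT x|lebesgue_on (interior K). \<bar>\<phi> n x - u x\<bar>) \<longlonglongrightarrow> 0"
    "(\<lambda>n. LINT x|lebesgue_on (interior K). norm (\<phi>' n x - D x)) \<longlonglongrightarrow> 0"
proof -
  have K': "compact K" "convex K"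
    using K by (auto simp: apex_of_def finite_imp_compact_convex_hull)
  obtain c where c: "c \<in> interior K"
    using K triangle_interior_nonempty unfolding apex_of_def by blast
  have star: "(1 - t) *\<^sub>R x + t *\<^sub>R c \<in> interior K" if "x \<in> K" "0 < t" "t \<le> 1" for x t
    using mem_interior_convex_shrink[OF K'(2) c that] by (simp add: algebra_simps)
  have "K \<inter> interior K = interior K" using interior_subset by blast
  from W11_approx[OF K'(1) open_interior wg u D star, unfolded this] that show ?thesis by blast
qed

text \<open>The trace inequality applied to differences of members: convergence inside the triangle
  forces the edge values to be Cauchy.\<close>

lemma edge_path_cauchy:
  assumes K: "apex_of K e a" and C1: "\<And>n::nat. C1_with_gradient (\<phi> n) (\<phi>' n)"
    and u: "integrable (lebesgue_on (interior K)) u" and D: "integrable (lebesgue_on (interior K)) D"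
    and 1: "(\<lambda>n. LINT x|lebesgue_on (interior K). \<bar>\<phi> n x - u x\<bar>) \<longlonglongrightarrow> 0"
    and 2: "(\<lambda>n. LINT x|lebesgue_on (interior K). norm (\<phi>' n x - D x)) \<longlonglongrightarrow> 0"
    and \<epsilon>: "0 < \<epsilon>"
  shows "\<exists>N. \<forall>i\<ge>N. \<forall>j\<ge>N. (LINT t|lebesgue_on {0..1}. \<bar>\<phi> i (edge_path e t) - \<phi> j (edge_path e t)\<bar>) < \<epsilon>"
proof -
  let ?U = "interior K"
  have K': "K = convex hull {a, fst (edge_ends e), snd (edge_ends e)}" and J: "tdet a (fst (edge_ends e)) (snd (edge_ends e)) \<noteq> 0"
    using K by (auto simp: apex_of_def)
  have bdd: "bounded ?U" unfolding K' by (rule triangle_interior_bounded)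
  then obtain d0 where d0: "\<And>x. x \<in> ?U \<Longrightarrow> norm x \<le> d0" by (auto simp: bounded_iff)
  define d where "d = \<bar>d0\<bar> + norm a"
  have d: "norm (x - a) \<le> d" if "x \<in> ?U" for x
    using d0[OF that] norm_triangle_ineq4[of x a] by (simp add: d_def)
  have d_nonneg: "0 \<le> d" by (simp add: d_def)
  define J' where "J' = edge_det e a"
  have J': "0 < J'" using apex_edge_det_pos[OF K] by (simp add: J'_def)
  define A where "A n = 2 * (LINT x|lebesgue_on ?U. \<bar>\<phi> n x - u x\<bar>) + d * (LINT x|lebesgue_on ?U. norm (\<phi>' n x - D x))" for n
  have int: "integrable (lebesgue_on ?U) (\<phi> n)" "integrable (lebesgue_on ?U) (\<phi>' n)" for n
    using C1_with_gradient_continuous[OF C1, of UNIV n] bdd by (auto intro: continuous_integrable_on_bounded_open)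
  have bound: "J' * (LINT t|lebesgue_on {0..1}. \<bar>\<phi> i (edge_path e t) - \<phi> j (edge_path e t)\<bar>) \<le> A i + A j" for i j
  proof -
    note ti = triangle_trace_inequality[OF J C1_with_gradient_diff[OF C1[of i] C1[of j]], folded K', OF d]
    have "(LINT x|lebesgue_on ?U. \<bar>\<phi> i x - \<phi> j x\<bar>) \<le> (LINT x|lebesgue_on ?U. \<bar>\<phi> i x - u x\<bar> + \<bar>\<phi> j x - u x\<bar>)"
      using int u by (intro integral_mono) auto
    also have "\<dots> = (LINT x|lebesgue_on ?U. \<bar>\<phi> i x - u x\<bar>) + (LINT x|lebesgue_on ?U. \<bar>\<phi> j x - u x\<bar>)"
      using int u by (intro Bochner_Integration.integral_add) auto
    finally have 3: "(LINT x|lebesgue_on ?U. \<bar>\<phi> i x - \<phi> j x\<bar>) \<le> (LINT x|lebesgue_on ?U. \<bar>\<phi> i x - u x\<bar>) + (LINT x|lebesgue_on ?U. \<bar>\<phi> j x - u x\<bar>)" .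
    have "(LINT x|lebesgue_on ?U. norm (\<phi>' i x - \<phi>' j x)) \<le> (LINT x|lebesgue_on ?U. norm (\<phi>' i x - D x) + norm (\<phi>' j x - D x))"
    proof (rule integral_mono)
      show "norm (\<phi>' i x - \<phi>' j x) \<le> norm (\<phi>' i x - D x) + norm (\<phi>' j x - D x)" for x
        by norm
    qed (use int D in auto)
    also have "\<dots> = (LINT x|lebesgue_on ?U. norm (\<phi>' i x - D x)) + (LINT x|lebesgue_on ?U. norm (\<phi>' j x - D x))"
      using int D by (intro Bochner_Integration.integral_add) auto
    finally have 4: "d * (LINT x|lebesgue_on ?U. norm (\<phi>' i x - \<phi>' j x)) \<le> d * ((LINT x|lebesgue_on ?U. norm (\<phi>' i x - D x)) + (LINT x|lebesgue_on ?U. norm (\<phi>' j x - D x)))"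
      by (rule mult_left_mono[OF _ d_nonneg])
    show ?thesis
      using ti 3 4 unfolding A_def J'_def edge_det_def edge_path_def by (simp add: distrib_left)
  qed
  have "A \<longlonglongrightarrow> 2 * 0 + d * 0" unfolding A_def by (intro tendsto_intros 1 2)
  then have "\<forall>\<^sub>F n in sequentially. A n < J' * \<epsilon> / 2"
    using J' \<epsilon> by (intro order_tendstoD(2)[where y=0]) auto
  then obtain N where N: "\<And>n. N \<le> n \<Longrightarrow> A n < J' * \<epsilon> / 2" by (auto simp: eventually_sequentially)
  have "(LINT t|lebesgue_on {0..1}. \<bar>\<phi> i (edge_path e t) - \<phi> j (edge_path e t)\<bar>) < \<epsilon>" if "N \<le> i" "N \<le> j" for i j
  proof -
    have "J' * (LINT t|lebesgue_on {0..1}. \<bar>\<phi> i (edge_path e t) - \<phi> j (edge_path e t)\<bar>) < J' * \<epsilon>"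
      using bound[of i j] N[OF that(1)] N[OF that(2)] by linarith
    then show ?thesis using J' by simp
  qed
  then show ?thesis by blast
qed

lemma C1_edge_path_integrable:
  assumes "C1_with_gradient \<phi> \<phi>'"
  shows "integrable (lebesgue_on {0..1}) (\<lambda>t. \<phi> (edge_path e t))"
  unfolding edge_path_def linepath_def
  by (intro continuous_imp_integrable_real continuous_on_compose2[OF C1_with_gradient_continuous(1)[OF assms, of UNIV]] continuous_intros) auto

lemma Lp_1_iff: "u \<in> Lp M 1 \<longleftrightarrow> integrable M u"
  by (auto simp: Lp_def integrable_norm_iff)

text \<open>\<open>trace_on\<close> is a choice, so some trace has to be exhibited before anything
  can be said about it. It is the pointwise limit of C1 approximations along a subsequence that
  serves all edges.\<close>

lemma trace_exists:
  assumes K: "finite {e. e edge_of K}" "\<And>e. e edge_of K \<Longrightarrow> \<exists>a. apex_of K e a" "\<exists>e. e edge_of K"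
    and wg: "weak_gradient (interior K) u D"
    and u: "integrable (lebesgue_on (interior K)) u" and D: "integrable (lebesgue_on (interior K)) D"
  shows "\<exists>\<tau>. is_trace K u \<tau>"
proof -
  let ?U = "interior K" and ?I = "lebesgue_on {0..1::real}"
  obtain e0 a0 where e0: "apex_of K e0 a0" using K by blast
  have Us: "?U \<in> sets lebesgue" by auto
  note wg' = wgrad_AE[OF open_interior wg]
  have D': "integrable (lebesgue_on ?U) (wgrad ?U u)"
    by (rule integrable_lebesgue_on_AE[OF Us D wg'(2)])
  obtain \<phi> \<phi>' where C1: "\<And>n::nat. C1_with_gradient (\<phi> n) (\<phi>' n)"
    and 1: "(\<lambda>n. LINT x|lebesgue_on ?U. \<bar>\<phi> n x - u x\<bar>) \<longlonglongrightarrow> 0"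
    and 2: "(\<lambda>n. LINT x|lebesgue_on ?U. norm (\<phi>' n x - wgrad ?U u x)) \<longlonglongrightarrow> 0"
    using W11_triangle_approx[OF e0 wg'(1) u D'] by blast
  have si: "integrable ?I (\<lambda>t. \<phi> n (edge_path e t))" for n e
    by (rule C1_edge_path_integrable[OF C1])
  have cauchy: "\<exists>N. \<forall>i\<ge>N. \<forall>j\<ge>N. (LINT t|?I. \<bar>\<phi> i (edge_path e t) - \<phi> j (edge_path e t)\<bar>) < \<epsilon>"
    if "e edge_of K" "0 < \<epsilon>" for e \<epsilon>
    using K(2)[OF that(1)] edge_path_cauchy[OF _ C1 u D' 1 2 that(2)] by blast
  obtain r :: "nat \<Rightarrow> nat" where r: "strict_mono r" "\<And>e. e edge_of K \<Longrightarrow> AE t in ?I. Cauchy (\<lambda>n. \<phi> (r n) (edge_path e t))"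
    using common_AE_cauchy_subseq[OF K(1), of ?I "\<lambda>e n t. \<phi> n (edge_path e t)"] si cauchy by auto
  \<comment> \<open>\<open>lim\<close> yields some value also where the sequence diverges; on each
    edge this concerns only a null set of parameters.\<close>
  define \<tau> where "\<tau> x = lim (\<lambda>n. \<phi> (r n) x)" for x
  have edge: "edge_integrable e \<tau>" "(\<lambda>n. edge_integral e (\<lambda>x. \<bar>\<phi> (r n) x - \<tau> x\<bar>)) \<longlonglongrightarrow> 0" if e: "e edge_of K" for e
  proof -
    have m: "(\<lambda>t. \<tau> (edge_path e t)) \<in> borel_measurable ?I"
      unfolding \<tau>_def using si by (intro borel_measurable_lim_metric) auto
    have lim: "AE t in ?I. (\<lambda>n. \<phi> (r n) (edge_path e t)) \<longlonglongrightarrow> \<tau> (edge_path e t)"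
      using r(2)[OF e]
    proof eventually_elim
      case (elim t)
      then show ?case unfolding \<tau>_def by (simp add: Cauchy_convergent_iff convergent_LIMSEQ_iff)
    qed
    have cr: "\<exists>N. \<forall>i\<ge>N. \<forall>j\<ge>N. (LINT t|?I. \<bar>\<phi> (r i) (edge_path e t) - \<phi> (r j) (edge_path e t)\<bar>) < \<epsilon>" if "0 < \<epsilon>" for \<epsilon>
      using cauchy[OF e that] seq_suble[OF r(1)] by (meson order_trans)
    note L = L1_cauchy_limit[where M="?I" and s="\<lambda>n t. \<phi> (r n) (edge_path e t)", OF si m cr lim]
    show "edge_integrable e \<tau>" unfolding edge_integrable_def by (rule L(1))
    show "(\<lambda>n. edge_integral e (\<lambda>x. \<bar>\<phi> (r n) x - \<tau> x\<bar>)) \<longlonglongrightarrow> 0"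
      unfolding edge_integral_def using tendsto_mult_right_zero[OF L(2)] by blast
  qed
  have "is_trace K u \<tau>"
    unfolding is_trace_def
  proof (intro conjI allI impI)
    show "u \<in> sobolev1 ?U 1"
      using u D wg by (auto simp: sobolev1_def Lp_1_iff)
    show "edge_integrable e \<tau>" if "e edge_of K" for e by (rule edge(1)[OF that])
    show "\<exists>\<phi> D. (\<forall>n::nat. C1_with_gradient (\<phi> n) (D n)) \<and>
        (\<lambda>n. LINT x|lebesgue_on (interior K). \<bar>\<phi> n x - u x\<bar>) \<longlonglongrightarrow> 0 \<and>
        (\<lambda>n. LINT x|lebesgue_on (interior K). norm (D n x - wgrad (interior K) u x)) \<longlonglongrightarrow> 0 \<and>
        (\<forall>e. e edge_of K \<longrightarrow> (\<lambda>n. edge_integral e (\<lambda>x. \<bar>\<phi> n x - \<tau> x\<bar>)) \<longlonglongrightarrow> 0)"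
    proof (rule exI[of _ "\<lambda>n. \<phi> (r n)"], rule exI[of _ "\<lambda>n. \<phi>' (r n)"], intro conjI allI impI)
      show "C1_with_gradient (\<phi> (r n)) (\<phi>' (r n))" for n by (rule C1)
      show "(\<lambda>n. LINT x|lebesgue_on (interior K). \<bar>\<phi> (r n) x - u x\<bar>) \<longlonglongrightarrow> 0"
        using LIMSEQ_subseq_LIMSEQ[OF 1 r(1)] by (simp add: o_def)
      show "(\<lambda>n. LINT x|lebesgue_on (interior K). norm (\<phi>' (r n) x - wgrad (interior K) u x)) \<longlonglongrightarrow> 0"
        using LIMSEQ_subseq_LIMSEQ[OF 2 r(1)] by (simp add: o_def)
      show "(\<lambda>n. edge_integral e (\<lambda>x. \<bar>\<phi> (r n) x - \<tau> x\<bar>)) \<longlonglongrightarrow> 0" if "e edge_of K" for e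
        by (rule edge(2)[OF that])
    qed
  qed
  then show ?thesis by blast
qed

text \<open>Valid for every trace: the sequence supplied by \<open>is_trace\<close> satisfies the
  radial formula, its edge integrals converge to that of the trace and its volume terms to those of
  \<open>u\<close>. The edge integral of a trace is thus determined by \<open>u\<close> and its weak
  gradient.\<close>

lemma trace_radial_formula:
  assumes K: "apex_of K e a" "e edge_of K" and tr: "is_trace K u \<tau>"
    and wg: "weak_gradient (interior K) u D"
    and u: "integrable (lebesgue_on (interior K)) u" and D: "integrable (lebesgue_on (interior K)) D"
  shows "edge_det e a * edge_integral e \<tau> = edge_length e * (LINT x|lebesgue_on (interior K). 2 * u x + D x \<bullet> (x - a))"
proof -
  let ?U = "interior K" and ?I = "lebesgue_on {0..1::real}"
  have K': "K = convex hull {a, fst (edge_ends e), snd (edge_ends e)}" and J: "tdet a (fst (edge_ends e)) (snd (edge_ends e)) \<noteq> 0"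
    using K by (auto simp: apex_of_def)
  have bdd: "bounded ?U" unfolding K' by (rule triangle_interior_bounded)
  have Us: "?U \<in> sets lebesgue" by auto
  note wg' = wgrad_AE[OF open_interior wg]
  have D': "integrable (lebesgue_on ?U) (wgrad ?U u)"
    by (rule integrable_lebesgue_on_AE[OF Us D wg'(2)])
  obtain \<phi> \<phi>' where C1: "\<And>n::nat. C1_with_gradient (\<phi> n) (\<phi>' n)"
    and 1: "(\<lambda>n. LINT x|lebesgue_on ?U. \<bar>\<phi> n x - u x\<bar>) \<longlonglongrightarrow> 0"
    and 2: "(\<lambda>n. LINT x|lebesgue_on ?U. norm (\<phi>' n x - wgrad ?U u x)) \<longlonglongrightarrow> 0"
    and 3: "(\<lambda>n. edge_integral e (\<lambda>x. \<bar>\<phi> n x - \<tau> x\<bar>)) \<longlonglongrightarrow> 0"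
    using tr K(2) unfolding is_trace_def by blast
  have ti: "integrable ?I (\<lambda>t. \<tau> (edge_path e t))"
    using tr K(2) unfolding is_trace_def edge_integrable_def by blast
  note si = C1_edge_path_integrable[OF C1, of _ e]
  have "(\<lambda>n. edge_integral e (\<phi> n) - edge_integral e \<tau>) \<longlonglongrightarrow> 0"
  proof (rule Lim_null_comparison[OF _ 3], intro always_eventually allI)
    fix n
    have "edge_integral e (\<phi> n) - edge_integral e \<tau> = edge_length e * (LINT t|?I. \<phi> n (edge_path e t) - \<tau> (edge_path e t))"
      unfolding edge_integral_def using si ti by (simp add: right_diff_distrib)
    also have "\<bar>\<dots>\<bar> \<le> edge_length e * (LINT t|?I. \<bar>\<phi> n (edge_path e t) - \<tau> (edge_path e t)\<bar>)"
      using edge_length_pos[OF K(1)] by (simp add: abs_mult mult_left_mono)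
    finally show "norm (edge_integral e (\<phi> n) - edge_integral e \<tau>) \<le> edge_integral e (\<lambda>x. \<bar>\<phi> n x - \<tau> x\<bar>)"
      by (simp add: edge_integral_def)
  qed
  then have "(\<lambda>n. edge_integral e (\<phi> n)) \<longlonglongrightarrow> edge_integral e \<tau>" by (rule LIM_zero_cancel)
  then have l1: "(\<lambda>n. edge_det e a * edge_integral e (\<phi> n)) \<longlonglongrightarrow> edge_det e a * edge_integral e \<tau>" by (intro tendsto_intros)
  have eq: "edge_det e a * edge_integral e (\<phi> n) = edge_length e * (LINT x|lebesgue_on ?U. 2 * \<phi> n x + \<phi>' n x \<bullet> (x - a))" for n
    using triangle_radial_formula[OF J C1, of n, folded K'] by (simp add: edge_integral_def edge_det_def edge_path_def)
  have "(\<lambda>n. edge_det e a * edge_integral e (\<phi> n)) \<longlonglongrightarrow> edge_length e * (LINT x|lebesgue_on ?U. 2 * u x + wgrad ?U u x \<bullet> (x - a))"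
    unfolding eq by (intro tendsto_intros radial_functional_tendsto[OF bdd open_interior u D' C1 1 2])
  moreover have "(LINT x|lebesgue_on ?U. 2 * u x + D x \<bullet> (x - a)) = (LINT x|lebesgue_on ?U. 2 * u x + wgrad ?U u x \<bullet> (x - a))"
    by (rule integral_lebesgue_on_AE[OF Us]) (use wg'(2) in \<open>eventually_elim, simp\<close>)
  ultimately show ?thesis using l1 LIMSEQ_unique by fastforce
qed

text \<open>One C1 sequence approximates \<open>u\<close> on both triangles. Each member has a
  single integral over the common edge, which the radial formula evaluates from either side, so the
  two volume expressions are limits of the same real sequence.\<close>

lemma radial_two_sided:
  assumes K: "apex_of K e a" "apex_of K' e a'" and sub: "interior K \<subseteq> U" "interior K' \<subseteq> U"
    and U: "open U" and wg: "weak_gradient U u D" and u: "integrable (lebesgue_on U) u" and D: "integrable (lebesgue_on U) D"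
    and star: "\<And>x t. x \<in> K \<union> K' \<Longrightarrow> 0 < t \<Longrightarrow> t \<le> 1 \<Longrightarrow> (1 - t) *\<^sub>R x + t *\<^sub>R m \<in> U"
  shows "(LINT x|lebesgue_on (interior K). 2 * u x + D x \<bullet> (x - a)) / edge_det e a =
    (LINT x|lebesgue_on (interior K'). 2 * u x + D x \<bullet> (x - a')) / edge_det e a'"
proof -
  let ?S = "(K \<union> K') \<inter> U"
  have comp: "compact (K \<union> K')" using K by (auto simp: apex_of_def finite_imp_compact_convex_hull)
  obtain \<phi> \<phi>' where C1: "\<And>n::nat. C1_with_gradient (\<phi> n) (\<phi>' n)"
    and 1: "(\<lambda>n. LINT x|lebesgue_on ?S. \<bar>\<phi> n x - u x\<bar>) \<longlonglongrightarrow> 0"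
    and 2: "(\<lambda>n. LINT x|lebesgue_on ?S. norm (\<phi>' n x - D x)) \<longlonglongrightarrow> 0"
    using W11_approx[OF comp U wg u D star] by blast
  have Us: "U \<in> sets lebesgue" and Ss: "?S \<in> sets lebesgue"
    using U comp by (auto intro!: sets.Int simp: compact_imp_closed borel_closed)
  have le: "(LINT x|lebesgue_on B. h x) \<le> (LINT x|lebesgue_on ?S. h x)" if "integrable (lebesgue_on ?S) h" "B \<in> sets lebesgue" "B \<subseteq> ?S" "\<And>x. 0 \<le> h x"
    for B and h :: "pt \<Rightarrow> real"
  proof -
    have "(LINT x|lebesgue. indicator B x *\<^sub>R h x) \<le> (LINT x|lebesgue. indicator ?S x *\<^sub>R h x)"
      using that Ss by (intro integral_mono') (auto simp: integrable_lebesgue_on_iff indicator_def)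
    then show ?thesis using that Ss by (simp add: integral_lebesgue_on_eq)
  qed
  have side: "(\<lambda>n. LINT t|lebesgue_on {0..1}. \<phi> n (edge_path e t)) \<longlonglongrightarrow>
      (LINT x|lebesgue_on (interior L). 2 * u x + D x \<bullet> (x - b)) / edge_det e b"
    if L: "apex_of L e b" "interior L \<subseteq> ?S" for L b
  proof -
    have L': "L = convex hull {b, fst (edge_ends e), snd (edge_ends e)}" and J: "tdet b (fst (edge_ends e)) (snd (edge_ends e)) \<noteq> 0"
      using L by (auto simp: apex_of_def)
    have bdd: "bounded (interior L)" unfolding L' by (rule triangle_interior_bounded)
    have Ls: "interior L \<in> sets lebesgue" and LU: "interior L \<subseteq> U" using L by auto
    note iu = integrable_lebesgue_on_subset[OF u Us Ls LU] and iD = integrable_lebesgue_on_subset[OF D Us Ls LU]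
    have iS: "integrable (lebesgue_on ?S) (\<phi> n)" "integrable (lebesgue_on ?S) (\<phi>' n)" for n
    proof -
      have "integrable (lebesgue_on (K \<union> K')) (\<phi> n)" "integrable (lebesgue_on (K \<union> K')) (\<phi>' n)"
        using weak_gradient_integrable[OF C1_weak_gradient[OF open_UNIV C1] comp] by auto
      then show "integrable (lebesgue_on ?S) (\<phi> n)" "integrable (lebesgue_on ?S) (\<phi>' n)"
        using comp by (auto intro!: integrable_lebesgue_on_subset[OF _ _ Ss] simp: compact_imp_closed)
    qed
    note iuS = integrable_lebesgue_on_subset[OF u Us Ss Int_lower2] and iDS = integrable_lebesgue_on_subset[OF D Us Ss Int_lower2]
    have l1: "(\<lambda>n. LINT x|lebesgue_on (interior L). \<bar>\<phi> n x - u x\<bar>) \<longlonglongrightarrow> 0"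
    proof (rule tendsto_sandwich[OF _ _ tendsto_const 1]; intro always_eventually allI)
      show "(LINT x|lebesgue_on (interior L). \<bar>\<phi> n x - u x\<bar>) \<le> (LINT x|lebesgue_on ?S. \<bar>\<phi> n x - u x\<bar>)" for n
        using iS iuS by (intro le Ls L) auto
    qed auto
    have l2: "(\<lambda>n. LINT x|lebesgue_on (interior L). norm (\<phi>' n x - D x)) \<longlonglongrightarrow> 0"
    proof (rule tendsto_sandwich[OF _ _ tendsto_const 2]; intro always_eventually allI)
      show "(LINT x|lebesgue_on (interior L). norm (\<phi>' n x - D x)) \<le> (LINT x|lebesgue_on ?S. norm (\<phi>' n x - D x))" for n
        using iS iDS by (intro le Ls L) auto
    qed auto
    have "(\<lambda>n. (LINT x|lebesgue_on (interior L). 2 * \<phi> n x + \<phi>' n x \<bullet> (x - b)) / edge_det e b) \<longlonglongrightarrow>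
      (LINT x|lebesgue_on (interior L). 2 * u x + D x \<bullet> (x - b)) / edge_det e b"
      using apex_edge_det_pos[OF L(1)]
      by (intro tendsto_divide tendsto_const radial_functional_tendsto[OF bdd open_interior iu iD C1 l1 l2]) auto
    moreover have "(LINT x|lebesgue_on (interior L). 2 * \<phi> n x + \<phi>' n x \<bullet> (x - b)) / edge_det e b = (LINT t|lebesgue_on {0..1}. \<phi> n (edge_path e t))" for n
      using triangle_radial_formula[OF J C1, of n, folded L'] apex_edge_det_pos[OF L(1)]
      by (simp add: edge_det_def edge_path_def)
    ultimately show ?thesis by simp
  qed
  have "interior K \<subseteq> ?S" "interior K' \<subseteq> ?S" using sub interior_subset by blast+
  then show ?thesis using side[OF K(1)] side[OF K(2)] LIMSEQ_unique by blast
qed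

section \<open>Triangles and the mesh\<close>

lemma tdet_affine_independent:
  assumes J: "tdet a b c \<noteq> 0"
  shows "a \<noteq> b" "b \<noteq> c" "c \<noteq> a" "\<not> affine_dependent {a, b, c}"
proof -
  show d: "a \<noteq> b" "b \<noteq> c" "c \<noteq> a" using J by auto
  show "\<not> affine_dependent {a, b, c}"
  proof
    assume "affine_dependent {a, b, c}"
    then obtain U where U: "sum U {a, b, c} = 0" "\<exists>v\<in>{a, b, c}. U v \<noteq> 0" "(\<Sum>v\<in>{a, b, c}. U v *\<^sub>R v) = 0"
      using affine_dependent_explicit_finite[of "{a, b, c}"] by auto
    have s: "U a + U b + U c = 0" using U(1) d by simp
    have v: "U a *\<^sub>R a + U b *\<^sub>R b + U c *\<^sub>R c = 0" using U(3) d by (simp add: add.assoc)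
    have "U a * x $ i + U b * y $ i + U c * z $ i = 0" if "x = a" "y = b" "z = c" for x y z i
      using arg_cong[OF v, of "\<lambda>w. w $ i"] that by simp
    then have v1: "U a * a $ 1 + U b * b $ 1 + U c * c $ 1 = 0" and v2: "U a * a $ 2 + U b * b $ 2 + U c * c $ 2 = 0"
      by auto
    have Ua: "U a = - U b - U c" using s by simp
    have w1: "U b * (b $ 1 - a $ 1) + U c * (c $ 1 - a $ 1) = 0" using v1 unfolding Ua by (simp add: algebra_simps)
    have w2: "U b * (b $ 2 - a $ 2) + U c * (c $ 2 - a $ 2) = 0" using v2 unfolding Ua by (simp add: algebra_simps)
    have "U b * tdet a b c = (c $ 2 - a $ 2) * (U b * (b $ 1 - a $ 1) + U c * (c $ 1 - a $ 1)) -
       (c $ 1 - a $ 1) * (U b * (b $ 2 - a $ 2) + U c * (c $ 2 - a $ 2))"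
      by (simp add: tdet_def algebra_simps)
    then have "U b = 0" using w1 w2 J by simp
    have "U c * tdet a b c = (b $ 1 - a $ 1) * (U b * (b $ 2 - a $ 2) + U c * (c $ 2 - a $ 2)) -
       (b $ 2 - a $ 2) * (U b * (b $ 1 - a $ 1) + U c * (c $ 1 - a $ 1))"
      by (simp add: tdet_def algebra_simps)
    then have "U c = 0" using w1 w2 J by simp
    then show False using \<open>U b = 0\<close> Ua U(2) by auto
  qed
qed

lemma simplex_2_triangle:
  assumes "2 simplex (K :: pt set)"
  obtains a b c where "K = convex hull {a, b, c}" "tdet a b c \<noteq> 0"
proof -
  obtain C where C: "\<not> affine_dependent C" "int (card C) = 2 + 1" "K = convex hull C"
    using assms unfolding simplex_def by blast
  then have "card C = 3" by simp
  then obtain a b c where abc: "C = {a, b, c}" "a \<noteq> b" "b \<noteq> c" "a \<noteq> c" by (auto simp: card_3_iff)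
  have "tdet a b c \<noteq> 0"
  proof
    assume J: "tdet a b c = 0"
    have key: "\<alpha> = 0 \<and> \<beta> = 0" if h: "\<alpha> *\<^sub>R (b - a) + \<beta> *\<^sub>R (c - a) = 0" for \<alpha> \<beta>
    proof (rule ccontr)
      assume n: "\<not> (\<alpha> = 0 \<and> \<beta> = 0)"
      define U where "U v = (if v = a then - \<alpha> - \<beta> else if v = b then \<alpha> else \<beta>)" for v
      have "sum U C = 0" using abc by (simp add: U_def)
      moreover have "\<exists>v\<in>C. U v \<noteq> 0" using n abc by (auto simp: U_def)
      moreover have "(\<Sum>v\<in>C. U v *\<^sub>R v) = 0"
      proof -
        have "(\<Sum>v\<in>C. U v *\<^sub>R v) = (- \<alpha> - \<beta>) *\<^sub>R a + (\<alpha> *\<^sub>R b + \<beta> *\<^sub>R c)" using abc by (simp add: U_def)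
        also have "\<dots> = \<alpha> *\<^sub>R (b - a) + \<beta> *\<^sub>R (c - a)" by (simp add: algebra_simps)
        finally show ?thesis using h by simp
      qed
      ultimately have "affine_dependent C" using affine_dependent_explicit_finite[of C] abc(1) by auto
      then show False using C by blast
    qed
    \<comment> \<open>With vanishing determinant these combinations of the edge vectors are zero;
      \<open>key\<close> then forces both coordinates of b - a to vanish.\<close>
    have "(c $ 1 - a $ 1) *\<^sub>R (b - a) + (- (b $ 1 - a $ 1)) *\<^sub>R (c - a) = 0"
      "(c $ 2 - a $ 2) *\<^sub>R (b - a) + (- (b $ 2 - a $ 2)) *\<^sub>R (c - a) = 0"
      using J by (auto simp: vec_eq_iff forall_2 tdet_def algebra_simps)
    from this[THEN key] have "b = a" by (simp add: vec_eq_iff forall_2)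
    then show False using abc by simp
  qed
  then show ?thesis using that C abc by blast
qed

text \<open>Faces of a simplex are the hulls of sets of vertices, and affine independence makes
  dimension 1 the same as having two vertices.\<close>

lemma triangle_edges:
  assumes J: "tdet a b c \<noteq> 0"
  shows "{e. e edge_of (convex hull {a, b, c})} = {closed_segment b c, closed_segment c a, closed_segment a b}"
proof -
  note d = tdet_affine_independent[OF J]
  have "e edge_of (convex hull {a, b, c}) \<longleftrightarrow> (\<exists>s. s \<subseteq> {a, b, c} \<and> card s = 2 \<and> e = convex hull s)" for e
  proof -
    have "aff_dim (convex hull s) = 1 \<longleftrightarrow> card s = 2" if "s \<subseteq> {a, b, c}" for s
    proof -
      have "of_nat (card s) = aff_dim s + 1"
        by (rule aff_dim_affine_independent[OF affine_independent_subset[OF d(4) that]])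
      then show ?thesis by (auto simp: aff_dim_convex_hull)
    qed
    then show ?thesis unfolding edge_of_def face_of_convex_hull_affine_independent[OF d(4)] by auto
  qed
  moreover have "s \<subseteq> {a, b, c} \<and> card s = 2 \<longleftrightarrow> s = {b, c} \<or> s = {c, a} \<or> s = {a, b}" for s
  proof
    assume s: "s \<subseteq> {a, b, c} \<and> card s = 2"
    then obtain x y where "s = {x, y}" "x \<noteq> y" by (auto simp: card_2_iff)
    then show "s = {b, c} \<or> s = {c, a} \<or> s = {a, b}" using s by auto
  qed (use d in auto)
  ultimately have "{e. e edge_of (convex hull {a, b, c})} = {e. \<exists>s. (s = {b, c} \<or> s = {c, a} \<or> s = {a, b}) \<and> e = convex hull s}"
    by (simp add: conj_assoc[symmetric])
  also have "\<dots> = {closed_segment b c, closed_segment c a, closed_segment a b}"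
    unfolding segment_convex_hull by blast
  finally show ?thesis .
qed

lemma edge_ends_closed_segment:
  "edge_ends (closed_segment p q) = (p, q) \<or> edge_ends (closed_segment p q) = (q, p)"
proof -
  have "closed_segment p q = closed_segment (fst (edge_ends (closed_segment p q))) (snd (edge_ends (closed_segment p q)))"
    unfolding edge_ends_def by (rule someI[of _ "(p, q)"]) simp
  then have "{p, q} = {fst (edge_ends (closed_segment p q)), snd (edge_ends (closed_segment p q))}"
    by (simp only: closed_segment_eq)
  then show ?thesis by (cases "edge_ends (closed_segment p q)") (auto simp: doubleton_eq_iff)
qed

lemma apex_of_segment:
  assumes J: "tdet a p q \<noteq> 0" and K: "K = convex hull {a, p, q}"
  shows "apex_of K (closed_segment p q) a"
  using edge_ends_closed_segment[of p q] assms tdet_swap[of a p q]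
  unfolding apex_of_def by (auto simp: insert_commute)

lemma edge_apex_exists:
  assumes "2 simplex K" "e edge_of K"
  shows "\<exists>a. apex_of K e a" "e = closed_segment (fst (edge_ends e)) (snd (edge_ends e))"
proof -
  obtain a b c where K: "K = convex hull {a, b, c}" "tdet a b c \<noteq> 0" using simplex_2_triangle[OF assms(1)] .
  have e: "e = closed_segment b c \<or> e = closed_segment c a \<or> e = closed_segment a b"
    using triangle_edges[OF K(2)] assms(2) unfolding K(1) by blast
  have "apex_of K (closed_segment b c) a" "apex_of K (closed_segment c a) b" "apex_of K (closed_segment a b) c"
    by (rule apex_of_segment; use K in \<open>simp add: insert_commute tdet_rotate[of a b c] tdet_rotate[of b c a]\<close>)+
  then show "\<exists>a. apex_of K e a" using e by blast
  show "e = closed_segment (fst (edge_ends e)) (snd (edge_ends e))"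
  proof -
    obtain p q where "e = closed_segment p q" using e by blast
    then show ?thesis using edge_ends_closed_segment[of p q]
      by (elim disjE) (simp_all del: closed_segment_eq add: closed_segment_commute)
  qed
qed

lemma finite_edges_of:
  assumes "2 simplex (K :: pt set)"
  shows "finite {e. e edge_of K}" "\<exists>e. e edge_of K"
proof -
  obtain a b c where K: "K = convex hull {a, b, c}" "tdet a b c \<noteq> 0" using simplex_2_triangle[OF assms(1)] .
  show "finite {e. e edge_of K}" "\<exists>e. e edge_of K"
    using triangle_edges[OF K(2)] unfolding K(1) by auto
qed

text \<open>\<open>outer_normal\<close> is a definite description, so existence and uniqueness come
  before any of its properties. The component of x - a along it is the height over \<open>e\<close>,
  written as twice the area divided by the base.\<close>

lemma outer_normal_apex:
  assumes ap: "apex_of K e a" and e: "e = closed_segment (fst (edge_ends e)) (snd (edge_ends e))"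
  shows "\<And>x y. x \<in> e \<Longrightarrow> y \<in> e \<Longrightarrow> outer_normal K e \<bullet> (y - x) = 0"
    "\<And>x. x \<in> e \<Longrightarrow> outer_normal K e \<bullet> (x - a) = edge_det e a / edge_length e"
proof -
  obtain p q where pq: "edge_ends e = (p, q)" by fastforce
  have K: "K = convex hull {a, p, q}" and J: "tdet a p q \<noteq> 0" and epq: "e = closed_segment p q"
    using ap e by (auto simp: apex_of_def pq)
  have det: "edge_det e a = \<bar>tdet a p q\<bar>" and len: "edge_length e = norm (q - p)"
    by (auto simp: edge_det_def edge_length_def pq dist_norm norm_minus_commute)
  have "p \<noteq> q" using J by auto
  define l where "l = norm (q - p)"
  have l: "0 < l" using \<open>p \<noteq> q\<close> by (simp add: l_def)
  have l2: "l\<^sup>2 = (q $ 1 - p $ 1)\<^sup>2 + (q $ 2 - p $ 2)\<^sup>2"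
    unfolding l_def power2_norm_eq_inner by (simp add: inner_vec_def sum_2 power2_eq_square)
  \<comment> \<open>A quarter turn of q - p is normal to the edge; the orientation of (a, p, q)
    decides which of the two turns points away from \<open>a\<close>.\<close>
  define s where "s = sgn (tdet a p q)"
  have s: "s * s = 1" "s * tdet a p q = \<bar>tdet a p q\<bar>" using J by (auto simp: s_def sgn_if)
  define n :: pt where "n = vector [s * (q $ 2 - p $ 2) / l, - (s * (q $ 1 - p $ 1) / l)]"
  have n12: "n $ 1 = s * (q $ 2 - p $ 2) / l" "n $ 2 = - (s * (q $ 1 - p $ 1) / l)" by (simp_all add: n_def)
  have inn: "u \<bullet> v = u $ 1 * v $ 1 + u $ 2 * v $ 2" for u v :: pt by (simp add: inner_vec_def sum_2)
  have nn: "n \<bullet> n = 1"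
  proof -
    have "n \<bullet> n = (s * s) * ((q $ 1 - p $ 1)\<^sup>2 + (q $ 2 - p $ 2)\<^sup>2) / l\<^sup>2"
      unfolding inn n12 by (simp add: power2_eq_square add_divide_distrib[symmetric] algebra_simps)
    also have "\<dots> = 1" unfolding s l2[symmetric] using l by simp
    finally show ?thesis .
  qed
  have nd: "n \<bullet> (q - p) = 0" unfolding inn n12 using l by (simp add: field_simps)
  have na: "n \<bullet> (p - a) = \<bar>tdet a p q\<bar> / l"
  proof -
    have "n \<bullet> (p - a) = s * tdet a p q / l"
      unfolding inn n12 tdet_def using l by (simp add: field_simps)
    then show ?thesis using s by simp
  qed
  have seg: "\<exists>t. x = p + t *\<^sub>R (q - p)" if "x \<in> e" for x
    using that unfolding epq closed_segment_def by (auto simp: algebra_simps)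
  have orth: "w \<bullet> (y - x) = 0" if h: "w \<bullet> (q - p) = 0" "x \<in> e" "y \<in> e" for w x y
  proof -
    obtain t where t: "x = p + t *\<^sub>R (q - p)" using seg[OF h(2)] by blast
    obtain t' where t': "y = p + t' *\<^sub>R (q - p)" using seg[OF h(3)] by blast
    have "y - x = (t' - t) *\<^sub>R (q - p)" unfolding t t' by (simp add: algebra_simps)
    then show ?thesis using h(1) by simp
  qed
  have pe: "p \<in> e" "q \<in> e" by (auto simp: epq)
  have n_prop: "norm n = 1 \<and> (\<forall>x\<in>e. \<forall>y\<in>e. n \<bullet> (y - x) = 0) \<and> (\<forall>x\<in>e. \<forall>y\<in>K. n \<bullet> (y - x) \<le> 0)"
  proof (intro conjI ballI)
    show "norm n = 1" using nn by (simp add: norm_eq_sqrt_inner)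
    show "n \<bullet> (y - x) = 0" if "x \<in> e" "y \<in> e" for x y using orth[OF nd that] .
    fix x y assume x: "x \<in> e" and "y \<in> K"
    then obtain u v w where y: "0 \<le> u" "0 \<le> v" "0 \<le> w" "u + v + w = 1" "y = u *\<^sub>R a + v *\<^sub>R p + w *\<^sub>R q"
      unfolding K convex_hull_3 by auto
    have "y - p = (- u) *\<^sub>R (p - a) + w *\<^sub>R (q - p)"
    proof -
      have v: "v = 1 - u - w" using y by simp
      show ?thesis unfolding y(5) v by (simp add: algebra_simps)
    qed
    then have "n \<bullet> (y - p) = - (u * (\<bar>tdet a p q\<bar> / l))" using nd na by (simp add: inner_add_right inner_diff_right)
    moreover have "n \<bullet> (p - x) = 0" by (rule orth[OF nd x pe(1)])
    moreover have "n \<bullet> (y - x) = n \<bullet> (y - p) + n \<bullet> (p - x)" by (simp add: inner_diff_right)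
    ultimately show "n \<bullet> (y - x) \<le> 0" using y l by simp
  qed
  have "outer_normal K e = n"
    unfolding outer_normal_def
  proof (rule the_equality[where P="\<lambda>n. norm n = 1 \<and> (\<forall>x\<in>e. \<forall>y\<in>e. n \<bullet> (y - x) = 0) \<and> (\<forall>x\<in>e. \<forall>y\<in>K. n \<bullet> (y - x) \<le> 0)", OF n_prop])
    fix m assume m: "norm m = 1 \<and> (\<forall>x\<in>e. \<forall>y\<in>e. m \<bullet> (y - x) = 0) \<and> (\<forall>x\<in>e. \<forall>y\<in>K. m \<bullet> (y - x) \<le> 0)"
    have md: "m \<bullet> (q - p) = 0" using m pe by blast
    have aK: "a \<in> K" unfolding K by (simp add: hull_inc)
    have ma: "m \<bullet> (a - p) \<le> 0" using m pe aK by blast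
    have m1: "m \<bullet> m = 1" using m by (simp add: dot_square_norm)
    define k where "k = m \<bullet> n"
    \<comment> \<open>In the plane the vectors orthogonal to q - p form a line, so a competitor
      equals its projection onto n; norm and side condition then leave only the factor 1.\<close>
    have "m = k *\<^sub>R n"
    proof -
      define A B where "A = q $ 2 - p $ 2" and "B = q $ 1 - p $ 1"
      have e1: "m $ 1 * B + m $ 2 * A = 0" using md unfolding inn A_def B_def by simp
      have nl: "n $ 1 * l = s * A" "n $ 2 * l = - (s * B)" using l by (simp_all add: n12 A_def B_def)
      have lAB: "l * l = A * A + B * B" using l2 by (simp add: A_def B_def power2_eq_square)
      have kl: "k * l = s * (m $ 1 * A - m $ 2 * B)"
      proof -
        have "k * l = m $ 1 * (n $ 1 * l) + m $ 2 * (n $ 2 * l)" unfolding k_def inn by (simp add: algebra_simps)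
        then show ?thesis unfolding nl by (simp add: algebra_simps)
      qed
      have "(k * n $ 1) * (l * l) = (k * l) * (n $ 1 * l)" by (simp add: ac_simps)
      also have "\<dots> = (s * s) * (m $ 1 * (A * A) - (m $ 2 * A) * B)" unfolding kl nl by (simp add: algebra_simps)
      also have "m $ 2 * A = - (m $ 1 * B)" using e1 by simp
      also have "(s * s) * (m $ 1 * (A * A) - - (m $ 1 * B) * B) = m $ 1 * (l * l)" unfolding s lAB by (simp add: algebra_simps)
      finally have 1: "k * n $ 1 = m $ 1" using l by simp
      have "(k * n $ 2) * (l * l) = (k * l) * (n $ 2 * l)" by (simp add: ac_simps)
      also have "\<dots> = (s * s) * (m $ 2 * (B * B) - (m $ 1 * B) * A)" unfolding kl nl by (simp add: algebra_simps)
      also have "m $ 1 * B = - (m $ 2 * A)" using e1 by simp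
      also have "(s * s) * (m $ 2 * (B * B) - - (m $ 2 * A) * A) = m $ 2 * (l * l)" unfolding s lAB by (simp add: algebra_simps)
      finally have 2: "k * n $ 2 = m $ 2" using l by simp
      show ?thesis using 1 2 by (simp add: vec_eq_iff forall_2)
    qed
    then have "k * k = 1" using m1 nn by simp
    moreover have "0 \<le> k"
    proof -
      have "m \<bullet> (p - a) = k * (\<bar>tdet a p q\<bar> / l)" using \<open>m = k *\<^sub>R n\<close> na by simp
      moreover have "0 \<le> m \<bullet> (p - a)" using ma by (simp add: inner_diff_right)
      moreover have "0 < \<bar>tdet a p q\<bar> / l" using J l by simp
      ultimately show ?thesis by (metis mult_neg_pos not_less)
    qed
    ultimately have "k = 1" by (simp add: square_eq_1_iff)
    then show "m = n" using \<open>m = k *\<^sub>R n\<close> by simp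
  qed
  then show "\<And>x y. x \<in> e \<Longrightarrow> y \<in> e \<Longrightarrow> outer_normal K e \<bullet> (y - x) = 0" using orth[OF nd] by simp
  fix x assume x: "x \<in> e"
  have "n \<bullet> (x - a) = n \<bullet> (x - p) + n \<bullet> (p - a)" by (simp add: inner_diff_right)
  then show "outer_normal K e \<bullet> (x - a) = edge_det e a / edge_length e"
    using orth[OF nd pe(1) x] na \<open>outer_normal K e = n\<close> by (simp add: det len l_def)
qed

text \<open>Among the radial fields x - a, x - b, x - c that span RT0, each has normal flux only
  through the edge opposite to its centre. This flux density is constant along the edge and is read
  off at one end point. The family \<open>I\<close> is left abstract, so that the identity serves
  edge integrals of C1 functions as well as of traces.\<close>

lemma RT0_green:
  assumes K: "2 simplex K"
    and u: "integrable (lebesgue_on (interior K)) u" and D: "integrable (lebesgue_on (interior K)) D"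
    and I: "\<And>e a. e edge_of K \<Longrightarrow> apex_of K e a \<Longrightarrow>
      edge_det e a * I e = edge_length e * (LINT x|lebesgue_on (interior K). 2 * u x + D x \<bullet> (x - a))"
  shows "(\<Sum>e | e edge_of K. I e * ((\<alpha> + \<beta> *\<^sub>R fst (edge_ends e)) \<bullet> outer_normal K e)) =
    (LINT x|lebesgue_on (interior K). 2 * \<beta> * u x + D x \<bullet> (\<alpha> + \<beta> *\<^sub>R x))"
proof -
  obtain a b c where K': "K = convex hull {a, b, c}" and J: "tdet a b c \<noteq> 0" using simplex_2_triangle[OF K] .
  note dist = tdet_affine_independent(1-3)[OF J]
  have edges: "{e. e edge_of K} = {closed_segment b c, closed_segment c a, closed_segment a b}"
    unfolding K' by (rule triangle_edges[OF J])
  have bdd: "bounded (interior K)" unfolding K' by (rule triangle_interior_bounded)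
  \<comment> \<open>The coefficients must satisfy ca + cb + cc = \<beta> and ca a + cb b + cc c =
    -\<alpha>. They are the barycentric coordinates of -\<alpha>, less those of 0 so that the sum
    vanishes, plus \<beta> times those of 0.\<close>
  define ca where "ca = tdet (- \<alpha>) b c / tdet a b c - tdet 0 b c / tdet a b c + \<beta> * (tdet 0 b c / tdet a b c)"
  define cb where "cb = tdet a (- \<alpha>) c / tdet a b c - tdet a 0 c / tdet a b c + \<beta> * (tdet a 0 c / tdet a b c)"
  define cc where "cc = tdet a b (- \<alpha>) / tdet a b c - tdet a b 0 / tdet a b c + \<beta> * (tdet a b 0 / tdet a b c)"
  have sum: "ca + cb + cc = \<beta>"
  proof -
    have "ca + cb + cc = (tdet (- \<alpha>) b c / tdet a b c + tdet a (- \<alpha>) c / tdet a b c + tdet a b (- \<alpha>) / tdet a b c)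
      - (tdet 0 b c / tdet a b c + tdet a 0 c / tdet a b c + tdet a b 0 / tdet a b c)
      + \<beta> * (tdet 0 b c / tdet a b c + tdet a 0 c / tdet a b c + tdet a b 0 / tdet a b c)"
      unfolding ca_def cb_def cc_def by (simp add: algebra_simps)
    then show ?thesis unfolding tdet_combination(2)[OF J] by simp
  qed
  have comb: "ca *\<^sub>R a + cb *\<^sub>R b + cc *\<^sub>R c = - \<alpha>"
  proof -
    have "ca *\<^sub>R a + cb *\<^sub>R b + cc *\<^sub>R c =
      ((tdet (- \<alpha>) b c / tdet a b c) *\<^sub>R a + (tdet a (- \<alpha>) c / tdet a b c) *\<^sub>R b + (tdet a b (- \<alpha>) / tdet a b c) *\<^sub>R c)
      - ((tdet 0 b c / tdet a b c) *\<^sub>R a + (tdet a 0 c / tdet a b c) *\<^sub>R b + (tdet a b 0 / tdet a b c) *\<^sub>R c)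
      + \<beta> *\<^sub>R ((tdet 0 b c / tdet a b c) *\<^sub>R a + (tdet a 0 c / tdet a b c) *\<^sub>R b + (tdet a b 0 / tdet a b c) *\<^sub>R c)"
      unfolding ca_def cb_def cc_def by (simp add: algebra_simps)
    then show ?thesis unfolding tdet_combination(1)[OF J, symmetric] by simp
  qed
  have v: "\<alpha> + \<beta> *\<^sub>R x = ca *\<^sub>R (x - a) + cb *\<^sub>R (x - b) + cc *\<^sub>R (x - c)" for x
  proof -
    have "ca *\<^sub>R (x - a) + cb *\<^sub>R (x - b) + cc *\<^sub>R (x - c) = (ca + cb + cc) *\<^sub>R x - (ca *\<^sub>R a + cb *\<^sub>R b + cc *\<^sub>R c)"
      by (simp add: algebra_simps)
    then show ?thesis unfolding sum comb by simp
  qed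
  define F where "F z = (LINT x|lebesgue_on (interior K). 2 * u x + D x \<bullet> (x - z))" for z
  note int = radial_functional_integrable[OF bdd open_interior u D]
  have edge: "I e * ((\<alpha> + \<beta> *\<^sub>R fst (edge_ends e)) \<bullet> outer_normal K e) = kA * F zA"
    if z: "tdet zA zB zC \<noteq> 0" "K = convex hull {zA, zB, zC}" and e: "e = closed_segment zB zC" "e edge_of K"
      and v: "\<And>x. \<alpha> + \<beta> *\<^sub>R x = kA *\<^sub>R (x - zA) + kB *\<^sub>R (x - zB) + kC *\<^sub>R (x - zC)" for e zA zB zC kA kB kC
  proof -
    have ap: "apex_of K e zA" unfolding e(1) by (rule apex_of_segment[OF z])
    note en = edge_apex_exists(2)[OF K e(2)]
    note on = outer_normal_apex[OF ap en]
    let ?p = "fst (edge_ends e)"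
    have p: "?p \<in> e" by (subst (2) en) simp
    have zBC: "zB \<in> e" "zC \<in> e" unfolding e(1) by auto
    have "(\<alpha> + \<beta> *\<^sub>R ?p) \<bullet> outer_normal K e = kA * (edge_det e zA / edge_length e)"
      unfolding v inner_commute[of _ "outer_normal K e"] inner_add_right inner_scaleR_right
        on(2)[OF p] on(1)[OF zBC(1) p] on(1)[OF zBC(2) p] by simp
    moreover have "edge_det e zA * I e = edge_length e * F zA"
      using I[OF e(2) ap] by (simp add: F_def)
    moreover have "I e * (kA * (edge_det e zA / edge_length e)) = kA * ((edge_det e zA * I e) / edge_length e)" by simp
    ultimately show ?thesis using edge_length_pos[OF ap] by simp
  qed
  have ea: "I (closed_segment b c) * ((\<alpha> + \<beta> *\<^sub>R fst (edge_ends (closed_segment b c))) \<bullet> outer_normal K (closed_segment b c)) = ca * F a"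
    by (rule edge[where zA=a and zB=b and zC=c]) (use J K' edges v in auto)
  have eb: "I (closed_segment c a) * ((\<alpha> + \<beta> *\<^sub>R fst (edge_ends (closed_segment c a))) \<bullet> outer_normal K (closed_segment c a)) = cb * F b"
  proof (rule edge[where zA=b and zB=c and zC=a])
    show "tdet b c a \<noteq> 0" using J tdet_rotate by metis
    show "\<alpha> + \<beta> *\<^sub>R x = cb *\<^sub>R (x - b) + cc *\<^sub>R (x - c) + ca *\<^sub>R (x - a)" for x using v[of x] by (simp add: ac_simps)
  qed (use K' edges in \<open>auto simp: insert_commute\<close>)
  have ec: "I (closed_segment a b) * ((\<alpha> + \<beta> *\<^sub>R fst (edge_ends (closed_segment a b))) \<bullet> outer_normal K (closed_segment a b)) = cc * F c"
  proof (rule edge[where zA=c and zB=a and zC=b])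
    show "tdet c a b \<noteq> 0" using J tdet_rotate by metis
    show "\<alpha> + \<beta> *\<^sub>R x = cc *\<^sub>R (x - c) + ca *\<^sub>R (x - a) + cb *\<^sub>R (x - b)" for x using v[of x] by (simp add: ac_simps)
  qed (use K' edges in \<open>auto simp: insert_commute\<close>)
  have "(\<Sum>e | e edge_of K. I e * ((\<alpha> + \<beta> *\<^sub>R fst (edge_ends e)) \<bullet> outer_normal K e)) = ca * F a + cb * F b + cc * F c"
    unfolding edges using dist by (simp add: ea eb ec doubleton_eq_iff)
  also have "\<dots> = (LINT x|lebesgue_on (interior K). ca * (2 * u x + D x \<bullet> (x - a)) + cb * (2 * u x + D x \<bullet> (x - b)) + cc * (2 * u x + D x \<bullet> (x - c)))"
    unfolding F_def using int
    by (simp only: Bochner_Integration.integral_add Bochner_Integration.integrable_add integrable_mult_right integral_mult_right_zero)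
  also have "\<dots> = (LINT x|lebesgue_on (interior K). 2 * \<beta> * u x + D x \<bullet> (\<alpha> + \<beta> *\<^sub>R x))"
  proof (rule Bochner_Integration.integral_cong[OF refl])
    fix x
    have "D x \<bullet> (\<alpha> + \<beta> *\<^sub>R x) = ca * (D x \<bullet> (x - a)) + cb * (D x \<bullet> (x - b)) + cc * (D x \<bullet> (x - c))"
      unfolding v by (simp add: inner_add_right)
    then show "ca * (2 * u x + D x \<bullet> (x - a)) + cb * (2 * u x + D x \<bullet> (x - b)) + cc * (2 * u x + D x \<bullet> (x - c)) =
      2 * \<beta> * u x + D x \<bullet> (\<alpha> + \<beta> *\<^sub>R x)"
      unfolding sum[symmetric] by (simp add: algebra_simps)
  qed
  finally show ?thesis .
qed

section \<open>The mesh: splitting of integrals, edges, and pairs of adjacent triangles\<close>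

locale mesh_domain =
  fixes \<Omega> :: "pt set" and \<T> :: "pt set set"
  assumes domain: "polygonal_domain \<Omega>" and mesh: "conforming_mesh \<Omega> \<T>"
begin

lemma domain_open: "open \<Omega>" and domain_bounded: "bounded \<Omega>" and domain_regular: "interior (closure \<Omega>) = \<Omega>"
  using domain by (auto simp: polygonal_domain_def)

lemma domain_sets: "\<Omega> \<in> sets lebesgue"
  using domain_open by auto

lemma mesh_finite: "finite \<T>"
  using mesh by (simp add: conforming_mesh_def triangulation_def)

lemma mesh_simplex: "K \<in> \<T> \<Longrightarrow> 2 simplex K"
  using mesh by (simp add: conforming_mesh_def)

lemma mesh_Int_face: "K \<in> \<T> \<Longrightarrow> K' \<in> \<T> \<Longrightarrow> K \<inter> K' face_of K"
  using mesh by (simp add: conforming_mesh_def triangulation_def)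

lemma mesh_cover: "\<Union>\<T> = closure \<Omega>"
  using mesh by (simp add: conforming_mesh_def)

lemma interior_subset_domain: "K \<in> \<T> \<Longrightarrow> interior K \<subseteq> \<Omega>"
  using mesh_cover domain_regular interior_mono[of K "closure \<Omega>"] by auto

text \<open>The intersection is a face of both triangles, and a face that meets the interior is the
  whole triangle.\<close>

lemma interior_disjoint:
  assumes "K \<in> \<T>" "K' \<in> \<T>" "K \<noteq> K'"
  shows "interior K \<inter> interior K' = {}"
proof (rule ccontr)
  assume "interior K \<inter> interior K' \<noteq> {}"
  then obtain x where x: "x \<in> interior K" "x \<in> interior K'" by blast
  then have "x \<in> K" "x \<in> K'" using interior_subset by blast+
  then have "K \<inter> K' = K" "K' \<inter> K = K'"
    using face_of_disjoint_interior[OF mesh_Int_face[OF assms(1,2)]] face_of_disjoint_interior[OF mesh_Int_face[OF assms(2,1)]] x by blast+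
  then show False using assms(3) by blast
qed

lemma mesh_triangle_props:
  assumes "K \<in> \<T>"
  shows "compact K" "convex K" "K \<in> sets lebesgue" "negligible (frontier K)" "interior K \<noteq> {}" "bounded (interior K)"
proof -
  show "compact K" "convex K" using mesh_simplex[OF assms] by (auto intro: compact_simplex convex_simplex)
  then show "K \<in> sets lebesgue" "negligible (frontier K)" "bounded (interior K)"
    by (auto simp: negligible_convex_frontier compact_imp_closed compact_imp_bounded intro: bounded_subset[OF _ interior_subset])
  obtain a b c where "K = convex hull {a, b, c}" "tdet a b c \<noteq> 0" using simplex_2_triangle[OF mesh_simplex[OF assms]] .
  then show "interior K \<noteq> {}" using triangle_interior_nonempty by blast
qed

lemma AE_not_frontier:
  assumes "K \<in> \<T>"
  shows "AE x in lebesgue. x \<notin> frontier K"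
  using mesh_triangle_props(4)[OF assms] by (intro AE_not_in) (simp add: negligible_iff_null_sets)

lemma AE_in_interior_iff:
  assumes "K \<in> \<T>"
  shows "AE x in lebesgue. x \<in> K \<longleftrightarrow> x \<in> interior K"
  using AE_not_frontier[OF assms]
proof eventually_elim
  case (elim x)
  then show ?case
    using mesh_triangle_props(1)[OF assms] interior_subset[of K]
    by (auto simp: frontier_def compact_imp_closed)
qed

lemma AE_some_interior: "AE x in lebesgue. x \<in> \<Omega> \<longrightarrow> (\<exists>K\<in>\<T>. x \<in> interior K)"
proof -
  have "AE x in lebesgue. \<forall>K\<in>\<T>. x \<in> K \<longleftrightarrow> x \<in> interior K"
    using mesh_finite AE_in_interior_iff by (rule AE_finite_allI)
  then show ?thesis
  proof eventually_elim
    case (elim x)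
    show ?case
    proof
      assume "x \<in> \<Omega>"
      then have "x \<in> \<Union>\<T>" unfolding mesh_cover using closure_subset by blast
      then show "\<exists>K\<in>\<T>. x \<in> interior K" using elim by auto
    qed
  qed
qed

lemma sum_interior_indicator:
  assumes "K \<in> \<T>" "x \<in> interior K"
  shows "(\<Sum>K'\<in>\<T>. indicator (interior K') x *\<^sub>R f K') = (f K :: 'b::real_vector)"
proof -
  have "(\<Sum>K'\<in>\<T>. indicator (interior K') x *\<^sub>R f K') = (\<Sum>K'\<in>{K}. indicator (interior K') x *\<^sub>R f K')"
    using interior_disjoint[OF assms(1)] assms mesh_finite
    by (intro sum.mono_neutral_right) (auto simp: indicator_def)
  then show ?thesis using assms by simp
qed

lemma integral_triangle_interior:
  fixes f :: "pt \<Rightarrow> 'b::euclidean_space"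
  assumes "K \<in> \<T>"
  shows "(LINT x|lebesgue_on K. f x) = (LINT x|lebesgue_on (interior K). f x)"
    "integrable (lebesgue_on K) f \<longleftrightarrow> integrable (lebesgue_on (interior K)) f"
proof -
  have sets: "K \<in> sets lebesgue" "interior K \<in> sets lebesgue" using mesh_triangle_props[OF assms] by auto
  have ae: "AE x in lebesgue. indicator K x *\<^sub>R f x = indicator (interior K) x *\<^sub>R f x"
    using AE_in_interior_iff[OF assms] by eventually_elim (auto simp: indicator_def)
  then have ae': "AE x in lebesgue_on UNIV. indicator K x *\<^sub>R f x = indicator (interior K) x *\<^sub>R f x"
    by (subst AE_lebesgue_on_iff) auto
  show "(LINT x|lebesgue_on K. f x) = (LINT x|lebesgue_on (interior K). f x)"
    using integral_lebesgue_on_AE[OF _ ae'] sets by (simp add: integral_lebesgue_on_eq)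
  have "AE x in lebesgue_on UNIV. indicator (interior K) x *\<^sub>R f x = indicator K x *\<^sub>R f x"
    using ae' by eventually_elim auto
  then show "integrable (lebesgue_on K) f \<longleftrightarrow> integrable (lebesgue_on (interior K)) f"
    using integrable_lebesgue_on_AE[OF _ _ ae'] integrable_lebesgue_on_AE[of UNIV "\<lambda>x. indicator (interior K) x *\<^sub>R f x" "\<lambda>x. indicator K x *\<^sub>R f x"] sets
    by (auto simp: integrable_lebesgue_on_iff)
qed

text \<open>Frontiers of triangles are negligible, so the indicator of \<Omega> is almost everywhere
  the sum of the indicators of the disjoint interiors.\<close>

lemma integral_domain_split:
  fixes f :: "pt \<Rightarrow> real"
  assumes "\<And>K. K \<in> \<T> \<Longrightarrow> integrable (lebesgue_on K) f"
  shows "(LINT x|lebesgue_on \<Omega>. f x) = (\<Sum>K\<in>\<T>. LINT x|lebesgue_on K. f x)"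
    "integrable (lebesgue_on \<Omega>) f"
proof -
  have ae: "AE x in lebesgue. indicator \<Omega> x *\<^sub>R f x = (\<Sum>K\<in>\<T>. indicator (interior K) x *\<^sub>R f x)"
    using AE_some_interior
  proof eventually_elim
    case (elim x)
    show ?case
    proof (cases "x \<in> \<Omega>")
      case True
      then obtain K where K: "K \<in> \<T>" "x \<in> interior K" using elim by blast
      then show ?thesis using sum_interior_indicator[OF K, of "\<lambda>_. f x"] True by simp
    next
      case False
      then have "x \<notin> interior K" if "K \<in> \<T>" for K using interior_subset_domain[OF that] by blast
      then show ?thesis using False by simp
    qed
  qed
  then have ae': "AE x in lebesgue_on UNIV. (\<Sum>K\<in>\<T>. indicator (interior K) x *\<^sub>R f x) = indicator \<Omega> x *\<^sub>R f x"
    using ae by (subst AE_lebesgue_on_iff) (auto elim!: eventually_mono)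
  have int: "integrable lebesgue (\<lambda>x. indicator (interior K) x *\<^sub>R f x)" if "K \<in> \<T>" for K
    using assms[OF that] integral_triangle_interior(2)[OF that, of f] by (simp add: integrable_lebesgue_on_iff)
  have "integrable lebesgue (\<lambda>x. \<Sum>K\<in>\<T>. indicator (interior K) x *\<^sub>R f x)"
    using int by (rule Bochner_Integration.integrable_sum)
  then have "integrable lebesgue (\<lambda>x. indicator \<Omega> x *\<^sub>R f x)"
    using integrable_lebesgue_on_AE[OF _ _ ae'] by (simp add: lebesgue_on_UNIV_eq)
  then show "integrable (lebesgue_on \<Omega>) f" using domain_sets by (simp add: integrable_lebesgue_on_iff)
  have "(LINT x|lebesgue_on \<Omega>. f x) = (LINT x|lebesgue. (\<Sum>K\<in>\<T>. indicator (interior K) x *\<^sub>R f x))"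
    using integral_lebesgue_on_AE[OF _ ae'] domain_sets by (simp add: integral_lebesgue_on_eq)
  also have "\<dots> = (\<Sum>K\<in>\<T>. LINT x|lebesgue. indicator (interior K) x *\<^sub>R f x)"
    using int by (rule Bochner_Integration.integral_sum)
  also have "\<dots> = (\<Sum>K\<in>\<T>. LINT x|lebesgue_on K. f x)"
    by (intro sum.cong refl) (simp add: integral_triangle_interior integral_lebesgue_on_eq)
  finally show "(LINT x|lebesgue_on \<Omega>. f x) = (\<Sum>K\<in>\<T>. LINT x|lebesgue_on K. f x)" .
qed

lemma AE_domain_of_triangles:
  assumes "\<And>K. K \<in> \<T> \<Longrightarrow> AE x in lebesgue_on K. P x"
  shows "AE x in lebesgue_on \<Omega>. P x"
proof -
  have "AE x in lebesgue. \<forall>K\<in>\<T>. x \<in> K \<longrightarrow> P x"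
    using assms mesh_triangle_props(3) by (intro AE_finite_allI mesh_finite) (simp add: AE_lebesgue_on_iff)
  then have "AE x in lebesgue. x \<in> \<Omega> \<longrightarrow> P x"
    by eventually_elim (use mesh_cover closure_subset[of \<Omega>] in blast)
  then show ?thesis by (simp add: AE_lebesgue_on_iff domain_sets)
qed

lemma AE_interior_of_triangle:
  assumes "K \<in> \<T>" "AE x in lebesgue_on K. P x"
  shows "AE x in lebesgue_on (interior K). P x"
  using assms mesh_triangle_props(3)[OF assms(1)] interior_subset[of K]
  by (auto simp: AE_lebesgue_on_iff elim!: eventually_mono)

lemma AE_triangle_of_interior:
  assumes "K \<in> \<T>" "\<And>x. x \<in> interior K \<Longrightarrow> P x"
  shows "AE x in lebesgue_on K. P x"
  unfolding AE_lebesgue_on_iff[OF mesh_triangle_props(3)[OF assms(1)]]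
  using AE_in_interior_iff[OF assms(1)] by eventually_elim (use assms(2) in blast)

lemma edge_triangle: "e \<in> edges \<T> \<Longrightarrow> \<exists>K\<in>\<T>. e edge_of K"
  by (auto simp: edges_def)

lemma finite_edges: "finite (edges \<T>)"
proof -
  have "edges \<T> = (\<Union>K\<in>\<T>. {e. e edge_of K})" by (auto simp: edges_def)
  then show ?thesis using mesh_finite finite_edges_of(1)[OF mesh_simplex] by simp
qed

lemma edge_segment:
  assumes "e \<in> edges \<T>"
  shows "e = closed_segment (fst (edge_ends e)) (snd (edge_ends e))" "fst (edge_ends e) \<noteq> snd (edge_ends e)" "0 < edge_length e"
proof -
  obtain K where K: "K \<in> \<T>" "e edge_of K" using edge_triangle[OF assms] by blast
  note ap = edge_apex_exists[OF mesh_simplex[OF K(1)] K(2)]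
  show "e = closed_segment (fst (edge_ends e)) (snd (edge_ends e))" by (rule ap(2))
  show "0 < edge_length e" using ap(1) edge_length_pos by blast
  then show "fst (edge_ends e) \<noteq> snd (edge_ends e)" by (auto simp: edge_length_def)
qed

lemma edge_rel_interior:
  assumes "e \<in> edges \<T>"
  shows "rel_interior e = open_segment (fst (edge_ends e)) (snd (edge_ends e))"
  using edge_segment(2)[OF assms]
  by (subst edge_segment(1)[OF assms]) (simp add: rel_interior_closed_segment)

lemma edge_path_in_rel_interior:
  assumes "e \<in> edges \<T>" "0 < t" "t < 1"
  shows "edge_path e t \<in> rel_interior e"
  unfolding edge_rel_interior[OF assms(1)] in_segment edge_path_def linepath_def
  using edge_segment(2)[OF assms(1)] assms by blast

lemma edge_path_in_edge:
  assumes "e \<in> edges \<T>" "0 \<le> t" "t \<le> 1"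
  shows "edge_path e t \<in> e"
  by (subst edge_segment(1)[OF assms(1)]) (use assms in \<open>auto simp: in_segment edge_path_def linepath_def\<close>)

text \<open>If the relative interiors met, both edges would lie in the common face of their
  triangles and hence be faces of one triangle, where faces with meeting relative interiors
  coincide. This is why the sum of indicators in \<open>proj_Lam\<close> picks out a single
  edge.\<close>

lemma rel_interior_edges_disjoint:
  assumes e: "e \<in> edges \<T>" "e' \<in> edges \<T>" "e \<noteq> e'"
  shows "rel_interior e \<inter> rel_interior e' = {}"
proof (rule ccontr)
  assume ne: "rel_interior e \<inter> rel_interior e' \<noteq> {}"
  obtain K where K: "K \<in> \<T>" "e edge_of K" using edge_triangle[OF e(1)] by blast
  obtain K' where K': "K' \<in> \<T>" "e' edge_of K'" using edge_triangle[OF e(2)] by blast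
  have f: "e face_of K" "e' face_of K'" using K K' by (auto simp: edge_of_def)
  have sub: "e \<subseteq> K" "e' \<subseteq> K'" using f face_of_imp_subset by blast+
  have fK: "K \<inter> K' face_of K" and fK': "K \<inter> K' face_of K'"
    using mesh_Int_face[OF K(1) K'(1)] mesh_Int_face[OF K'(1) K(1)] by (auto simp: Int_commute)
  have "(K \<inter> K') \<inter> rel_interior e \<noteq> {}" "(K \<inter> K') \<inter> rel_interior e' \<noteq> {}"
    using ne sub rel_interior_subset by blast+
  then have "e \<subseteq> K \<inter> K'" "e' \<subseteq> K \<inter> K'"
    using subset_of_face_of[OF fK sub(1)] subset_of_face_of[OF fK' sub(2)] by blast+
  then have "e' face_of K \<inter> K'" using face_of_subset[OF f(2)] by blast
  then have "e' face_of K" using face_of_trans fK by blast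
  then show False using face_of_eq[OF f(1) _ ne] e(3) by blast
qed

text \<open>With both apexes on the same side of the edge, points on that side close to the edge
  midpoint would be interior to both triangles.\<close>

lemma opposite_sides:
  assumes K: "K \<in> \<T>" "K' \<in> \<T>" "K \<noteq> K'" and ap: "apex_of K e a" "apex_of K' e a'"
  shows "tdet a (fst (edge_ends e)) (snd (edge_ends e)) * tdet a' (fst (edge_ends e)) (snd (edge_ends e)) < 0"
proof (rule ccontr)
  obtain p q where pq: "edge_ends e = (p, q)" by fastforce
  have J: "tdet a p q \<noteq> 0" "K = convex hull {a, p, q}" and J': "tdet a' p q \<noteq> 0" "K' = convex hull {a', p, q}"
    using ap by (auto simp: apex_of_def pq)
  assume "\<not> tdet a (fst (edge_ends e)) (snd (edge_ends e)) * tdet a' (fst (edge_ends e)) (snd (edge_ends e)) < 0"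
  then have pos: "0 < tdet a p q / tdet a' p q"
    using J J' by (simp add: pq zero_less_divide_iff not_less zero_le_mult_iff) argo
  \<comment> \<open>\<open>z\<close> runs from the edge midpoint at s = 0 towards the apex
    \<open>a\<close>; for small positive s its coordinates in \<open>K'\<close> belonging to the
    ends of the edge stay near 1/2.\<close>
  define z where "z s = s *\<^sub>R a + ((1 - s) / 2) *\<^sub>R p + ((1 - s) / 2) *\<^sub>R q" for s :: real
  have s1: "s + (1 - s) / 2 + (1 - s) / 2 = 1" for s :: real by (simp add: field_simps)
  have zK: "z s \<in> interior K" if "0 < s" "s < 1" for s
    unfolding J(2) interior_triangle_iff[OF J(1)] z_def tdet_affine[OF s1[of s], of a p q] using J(1) that by simp
  have z0: "z 0 = 0 *\<^sub>R a' + (1 / 2) *\<^sub>R p + (1 / 2) *\<^sub>R q" by (simp add: z_def)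
  have "(0::real) + 1 / 2 + 1 / 2 = 1" by simp
  from tdet_affine[OF this, of a' p q, folded z0]
  have c0: "tdet a' (z 0) q / tdet a' p q = 1/2" "tdet a' p (z 0) / tdet a' p q = 1/2" using J'(1) by simp_all
  have cont: "continuous_on UNIV z" unfolding z_def by (intro continuous_intros) auto
  have "continuous_on UNIV (\<lambda>s. tdet a' (z s) q * inverse (tdet a' p q))" "continuous_on UNIV (\<lambda>s. tdet a' p (z s) * inverse (tdet a' p q))"
    by (intro continuous_on_mult tdet_continuous continuous_on_const cont)+
  moreover have "(h \<longlongrightarrow> h 0) (at_right 0)" if "continuous_on UNIV h" for h :: "real \<Rightarrow> real"
    using that by (auto simp: continuous_on_def intro: tendsto_within_subset)
  ultimately have "((\<lambda>s. tdet a' (z s) q * inverse (tdet a' p q)) \<longlongrightarrow> tdet a' (z 0) q * inverse (tdet a' p q)) (at_right 0)"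
    "((\<lambda>s. tdet a' p (z s) * inverse (tdet a' p q)) \<longlongrightarrow> tdet a' p (z 0) * inverse (tdet a' p q)) (at_right 0)"
    by blast+
  then have "((\<lambda>s. tdet a' (z s) q / tdet a' p q) \<longlongrightarrow> 1/2) (at_right 0)" "((\<lambda>s. tdet a' p (z s) / tdet a' p q) \<longlongrightarrow> 1/2) (at_right 0)"
    unfolding divide_inverse[symmetric] c0 by blast+
  then have ev: "\<forall>\<^sub>F s in at_right 0. 0 < tdet a' (z s) q / tdet a' p q" "\<forall>\<^sub>F s in at_right 0. 0 < tdet a' p (z s) / tdet a' p q"
    by (auto intro: order_tendstoD(1))
  have ev1: "\<forall>\<^sub>F s in at_right (0::real). 0 < s \<and> s < 1"
    using eventually_at_right_real[of 0 1] by (auto elim: eventually_mono)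
  have "\<forall>\<^sub>F s in at_right (0::real). z s \<in> interior K \<inter> interior K'"
    using ev ev1
  proof eventually_elim
    case (elim s)
    have "tdet (z s) p q / tdet a' p q = s * (tdet a p q / tdet a' p q)"
      unfolding z_def tdet_affine(1)[OF s1[of s], of a p q] by simp
    also have "0 < \<dots>" using pos elim by (intro mult_pos_pos) auto
    finally have "0 < tdet (z s) p q / tdet a' p q" .
    then have "z s \<in> interior K'" unfolding J'(2) interior_triangle_iff[OF J'(1)] using elim by simp
    then show ?case using zK elim by simp
  qed
  then have "\<forall>\<^sub>F s in at_right (0::real). False"
    using interior_disjoint[OF K] by simp
  then show False by (simp add: trivial_limit_at_right_real)
qed

text \<open>Near an inner point of the common edge only the sign of the apex coordinate decides
  membership, and as the apexes lie on opposite sides, one of the two triangles always contains the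
  nearby point. The edge point is thus interior to the closure of \<Omega>, and a domain without
  slits contains it.\<close>

lemma shared_edge_rel_interior:
  assumes K: "K \<in> \<T>" "K' \<in> \<T>" "K \<noteq> K'" and ap: "apex_of K e a" "apex_of K' e a'"
    and y: "y = v *\<^sub>R fst (edge_ends e) + w *\<^sub>R snd (edge_ends e)" "0 < v" "0 < w" "v + w = 1"
  shows "y \<in> \<Omega>"
proof -
  obtain p q where pq: "edge_ends e = (p, q)" by fastforce
  have J: "tdet a p q \<noteq> 0" "K = convex hull {a, p, q}" and J': "tdet a' p q \<noteq> 0" "K' = convex hull {a', p, q}"
    using ap by (auto simp: apex_of_def pq)
  have opp: "tdet a p q * tdet a' p q < 0" using opposite_sides[OF K ap] by (simp add: pq)
  let ?N = "{z. 0 < tdet a z q / tdet a p q} \<inter> {z. 0 < tdet a p z / tdet a p q} \<inter> {z. 0 < tdet a' z q / tdet a' p q} \<inter> {z. 0 < tdet a' p z / tdet a' p q}"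
  have opn: "open ?N" unfolding divide_inverse
    by (intro open_Int open_Collect_less continuous_on_mult tdet_continuous continuous_on_const continuous_on_id)
  have y': "y = 0 *\<^sub>R b + v *\<^sub>R p + w *\<^sub>R q" for b using y(1) by (simp add: pq)
  have vw: "0 + v + w = 1" using y by simp
  have yN: "y \<in> ?N"
    using tdet_affine(2,3)[OF vw, of a p q, folded y'[of a]] tdet_affine(2,3)[OF vw, of a' p q, folded y'[of a']] J(1) J'(1) y by simp
  have "?N \<subseteq> K \<union> K'"
  proof
    fix z assume z: "z \<in> ?N"
    have "0 \<le> tdet z p q / tdet a p q \<or> 0 \<le> tdet z p q / tdet a' p q"
      using opp by (auto simp: mult_less_0_iff zero_le_divide_iff)
    then show "z \<in> K \<union> K'"
      unfolding Un_iff J(2) J'(2) in_triangle_iff[OF J(1)] in_triangle_iff[OF J'(1)] using z by auto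
  qed
  also have "\<dots> \<subseteq> closure \<Omega>" using K mesh_cover by blast
  finally have "y \<in> interior (closure \<Omega>)" using opn yN by (rule interiorI[rotated 2])
  then show ?thesis using domain_regular by simp
qed

text \<open>The moved point either has a positive apex coordinate and is interior to
  \<open>K\<close>, or it lies in the relative interior of the common edge. The ends of the edge,
  which may lie on the boundary of \<Omega>, are avoided because each end keeps a weight of at least
  t / 2.\<close>

lemma shared_edge_star:
  assumes K: "K \<in> \<T>" "K' \<in> \<T>" "K \<noteq> K'" and ap: "apex_of K e a" "apex_of K' e a'"
    and x: "x \<in> K" and t: "0 < t" "t \<le> 1"
  shows "(1 - t) *\<^sub>R x + t *\<^sub>R midpoint (fst (edge_ends e)) (snd (edge_ends e)) \<in> \<Omega>"
proof -
  obtain p q where pq: "edge_ends e = (p, q)" by fastforce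
  have J: "tdet a p q \<noteq> 0" "K = convex hull {a, p, q}"
    using ap by (auto simp: apex_of_def pq)
  obtain u v w where uvw: "0 \<le> u" "0 \<le> v" "0 \<le> w" "u + v + w = 1" "x = u *\<^sub>R a + v *\<^sub>R p + w *\<^sub>R q"
    using x unfolding J(2) convex_hull_3 by auto
  define y where "y = (1 - t) *\<^sub>R x + t *\<^sub>R midpoint p q"
  have y: "y = ((1 - t) * u) *\<^sub>R a + ((1 - t) * v + t / 2) *\<^sub>R p + ((1 - t) * w + t / 2) *\<^sub>R q"
    unfolding y_def uvw midpoint_def by (simp add: algebra_simps)
  have s: "(1 - t) * u + ((1 - t) * v + t / 2) + ((1 - t) * w + t / 2) = 1"
  proof -
    have "(1 - t) * u + ((1 - t) * v + t / 2) + ((1 - t) * w + t / 2) = (1 - t) * (u + v + w) + t" by (simp add: algebra_simps)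
    then show ?thesis using uvw by simp
  qed
  have vw: "0 < (1 - t) * v + t / 2" "0 < (1 - t) * w + t / 2"
    using t uvw by (auto intro!: add_nonneg_pos)
  have "y \<in> \<Omega>"
  proof (cases "(1 - t) * u = 0")
    case True
    show ?thesis
      by (rule shared_edge_rel_interior[OF K ap _ vw]) (use y s True in \<open>simp_all add: pq\<close>)
  next
    case False
    then have "0 < (1 - t) * u" using t uvw by (simp add: less_le)
    then have "y \<in> interior K"
      unfolding J(2) interior_triangle_iff[OF J(1)] y tdet_affine[OF s, of a p q] using J(1) vw by simp
    then show ?thesis using interior_subset_domain[OF K(1)] by blast
  qed
  then show ?thesis by (simp add: y_def pq)
qed

text \<open>The midpoint of a shared edge is in the open set \<Omega>, so the edge cannot lie in the
  frontier. This makes the midpoint continuity in \<open>CR_space\<close> available for every pair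
  of adjacent triangles.\<close>

lemma shared_edge_interior:
  assumes K: "K \<in> \<T>" "K' \<in> \<T>" "K \<noteq> K'" and e: "e edge_of K" "e edge_of K'"
  shows "e \<in> int_edges \<Omega> \<T>"
proof -
  obtain a where a: "apex_of K e a" using edge_apex_exists[OF mesh_simplex[OF K(1)] e(1)] by blast
  obtain a' where a': "apex_of K' e a'" using edge_apex_exists[OF mesh_simplex[OF K(2)] e(2)] by blast
  have ed: "e \<in> edges \<T>" using K e by (auto simp: edges_def)
  let ?m = "(1/2) *\<^sub>R fst (edge_ends e) + (1/2) *\<^sub>R snd (edge_ends e)"
  have "?m \<in> \<Omega>" by (rule shared_edge_rel_interior[OF K a a' refl]) auto
  moreover have "?m \<in> e"
    by (subst (3) edge_segment(1)[OF ed]) (auto simp: in_segment intro!: exI[of _ "1/2"])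
  ultimately have "\<not> e \<subseteq> frontier \<Omega>"
    using domain_open by (auto simp: frontier_def interior_open)
  then show ?thesis using ed by (simp add: int_edges_def bdry_edges_def)
qed

end

section \<open>Finite element spaces\<close>

lemma polys_zero: "(\<lambda>_. 0) \<in> polys k"
  unfolding polys_def by (auto intro!: exI[of _ "\<lambda>_ _. 0"])

lemma polys_add:
  assumes "\<phi> \<in> polys k" "\<psi> \<in> polys k"
  shows "(\<lambda>x. \<phi> x + \<psi> x) \<in> polys k"
proof -
  obtain c where c: "\<phi> = (\<lambda>x. \<Sum>i\<le>k. \<Sum>j\<le>k - i. c i j * (x $ 1) ^ i * (x $ 2) ^ j)"
    using assms(1) by (auto simp: polys_def)
  obtain d where d: "\<psi> = (\<lambda>x. \<Sum>i\<le>k. \<Sum>j\<le>k - i. d i j * (x $ 1) ^ i * (x $ 2) ^ j)"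
    using assms(2) by (auto simp: polys_def)
  show ?thesis
    unfolding polys_def c d by (auto intro!: exI[of _ "\<lambda>i j. c i j + d i j"] simp: sum.distrib[symmetric] algebra_simps)
qed

lemma polys_monomial:
  assumes "i + j \<le> k"
  shows "(\<lambda>x. d * (x $ 1) ^ i * (x $ 2) ^ j) \<in> polys k"
proof -
  have "(\<lambda>x::pt. d * (x $ 1) ^ i * (x $ 2) ^ j) = (\<lambda>x. \<Sum>i'\<le>k. \<Sum>j'\<le>k - i'. (if i' = i \<and> j' = j then d else 0) * (x $ 1) ^ i' * (x $ 2) ^ j')"
  proof
    fix x :: pt
    have "(\<Sum>j'\<le>k - i'. (if i' = i \<and> j' = j then d else 0) * (x $ 1) ^ i' * (x $ 2) ^ j') = (if i' = i then d * (x $ 1) ^ i * (x $ 2) ^ j else 0)" for i'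
    proof (cases "i' = i")
      case True
      have "(\<Sum>j'\<le>k - i. (if i = i \<and> j' = j then d else 0) * (x $ 1) ^ i * (x $ 2) ^ j') = (\<Sum>j'\<le>k - i. if j' = j then d * (x $ 1) ^ i * (x $ 2) ^ j else 0)"
        by (rule sum.cong) auto
      also have "\<dots> = d * (x $ 1) ^ i * (x $ 2) ^ j" using assms by simp
      finally show ?thesis using True by simp
    qed simp
    then show "d * (x $ 1) ^ i * (x $ 2) ^ j = (\<Sum>i'\<le>k. \<Sum>j'\<le>k - i'. (if i' = i \<and> j' = j then d else 0) * (x $ 1) ^ i' * (x $ 2) ^ j')"
      using assms by simp
  qed
  then show ?thesis unfolding polys_def by (intro CollectI exI)
qed

lemma polys_sum: "finite A \<Longrightarrow> (\<And>a. a \<in> A \<Longrightarrow> \<phi> a \<in> polys k) \<Longrightarrow> (\<lambda>x. \<Sum>a\<in>A. \<phi> a x) \<in> polys k"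
  by (induction A rule: finite_induct) (auto intro: polys_zero polys_add)

lemma polys_affine_mult:
  assumes "\<phi> \<in> polys k"
  shows "(\<lambda>x. (\<alpha> + \<beta> * x $ 1 + \<gamma> * x $ 2) * \<phi> x) \<in> polys (Suc k)"
proof -
  obtain c where c: "\<phi> = (\<lambda>x. \<Sum>i\<le>k. \<Sum>j\<le>k - i. c i j * (x $ 1) ^ i * (x $ 2) ^ j)"
    using assms(1) by (auto simp: polys_def)
  have "(\<lambda>x::pt. (\<alpha> + \<beta> * x $ 1 + \<gamma> * x $ 2) * \<phi> x) = (\<lambda>x. \<Sum>i\<le>k. \<Sum>j\<le>k - i. (\<alpha> * c i j) * (x $ 1) ^ i * (x $ 2) ^ j +
     ((\<beta> * c i j) * (x $ 1) ^ Suc i * (x $ 2) ^ j + (\<gamma> * c i j) * (x $ 1) ^ i * (x $ 2) ^ Suc j))"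
    unfolding c sum_distrib_left by (intro ext sum.cong refl) (simp add: algebra_simps)
  also have "\<dots> \<in> polys (Suc k)"
    by (intro polys_sum polys_add polys_monomial) auto
  finally show ?thesis .
qed

lemma polys_0: "polys 0 = {\<lambda>_. c | c. True}"
  unfolding polys_def by auto

lemma polys_const: "(\<lambda>_. c) \<in> polys 0"
  unfolding polys_0 by blast

lemma polys_affine: "(\<lambda>x. \<alpha> + \<beta> * x $ 1 + \<gamma> * x $ 2) \<in> polys 1"
  using polys_affine_mult[OF polys_const[of 1]] by simp

lemma polys_1_affine:
  assumes "\<phi> \<in> polys 1"
  obtains \<alpha> \<beta> \<gamma> where "\<phi> = (\<lambda>x. \<alpha> + \<beta> * x $ 1 + \<gamma> * x $ 2)"
proof -
  obtain c where c: "\<phi> = (\<lambda>x. \<Sum>i\<le>1. \<Sum>j\<le>1 - i. c i j * (x $ 1) ^ i * (x $ 2) ^ j)"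
    using assms(1) by (auto simp: polys_def)
  have "\<phi> = (\<lambda>x. c 0 0 + c 1 0 * x $ 1 + c 0 1 * x $ 2)"
    unfolding c by (simp add: fun_eq_iff)
  then show ?thesis using that by blast
qed

lemma tdet_affine_form: "\<exists>\<alpha> \<beta> \<gamma>. \<forall>x. tdet x b c / J = \<alpha> + \<beta> * x $ 1 + \<gamma> * x $ 2"
proof (intro exI allI)
  fix x
  show "tdet x b c / J = (b $ 1 * c $ 2 - b $ 2 * c $ 1) / J + (b $ 2 - c $ 2) / J * x $ 1 + (c $ 1 - b $ 1) / J * x $ 2"
    unfolding add_divide_distrib[symmetric] times_divide_eq_left by (rule arg_cong[where f="\<lambda>y. y / J"]) (simp add: tdet_def algebra_simps)
qed

lemma polys_polynomial: "\<phi> \<in> polys k \<Longrightarrow> real_polynomial_function \<phi>"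
proof -
  have lin: "real_polynomial_function (\<lambda>x::pt. x $ i)" for i
    by (rule real_polynomial_function.intros(1)[OF bounded_linear_vec_nth])
  assume "\<phi> \<in> polys k"
  then obtain c where "\<phi> = (\<lambda>x. \<Sum>i\<le>k. \<Sum>j\<le>k - i. c i j * (x $ 1) ^ i * (x $ 2) ^ j)"
    by (auto simp: polys_def)
  then show ?thesis
    by (auto intro!: real_polynomial_function_sum real_polynomial_function.intros(4) real_polynomial_function_power real_polynomial_function.intros(2) lin)
qed

lemma real_polynomial_function_C1:
  assumes "real_polynomial_function (\<phi> :: pt \<Rightarrow> real)"
  shows "\<exists>D. C1_with_gradient \<phi> D"
  using assms
proof (induction rule: real_polynomial_function.induct)
  case (linear f)
  define v where "v = (\<Sum>b\<in>Basis. f b *\<^sub>R b)"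
  have f: "f h = h \<bullet> v" for h
  proof -
    have "f h = f (\<Sum>b\<in>Basis. (h \<bullet> b) *\<^sub>R b)" by (simp add: euclidean_representation)
    also have "\<dots> = (\<Sum>b\<in>Basis. (h \<bullet> b) * f b)"
      using bounded_linear.linear[OF linear] by (simp add: linear_sum linear_scale)
    finally show ?thesis by (simp add: v_def inner_sum_right mult.commute)
  qed
  have "C1_with_gradient f (\<lambda>_. v)"
    unfolding C1_with_gradient_def gderiv_def
    using bounded_linear_imp_has_derivative[OF linear] f[abs_def, symmetric] by simp
  then show ?case by blast
next
  case (const c)
  then show ?case using C1_with_gradient_const by blast
next
  case (add f g)
  then show ?case using C1_with_gradient_add by blast
next
  case (mult f g)
  then show ?case using C1_with_gradient_mult by blast
qed

lemma polys_C1: "\<phi> \<in> polys k \<Longrightarrow> \<exists>D. C1_with_gradient \<phi> D"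
  using polys_polynomial real_polynomial_function_C1 by blast

text \<open>Restricted to the line through \<open>c\<close> and x, the polynomial has infinitely
  many roots near \<open>c\<close> and hence vanishes along the whole line.\<close>

lemma real_polynomial_function_zero_open:
  fixes \<phi> :: "pt \<Rightarrow> real"
  assumes p: "real_polynomial_function \<phi>" and U: "open U" "c \<in> U" and z: "\<And>x. x \<in> U \<Longrightarrow> \<phi> x = 0"
  shows "\<phi> x = 0"
proof -
  have "polynomial_function (\<lambda>t::real. t)" by simp
  then have "polynomial_function (\<lambda>t::real. c + t *\<^sub>R (x - c))"
    by (intro polynomial_function_add polynomial_function_mult polynomial_function_const)
  then have "real_polynomial_function (\<phi> \<circ> (\<lambda>t::real. c + t *\<^sub>R (x - c)))"
    using p by (rule real_polynomial_function_compose)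
  then obtain a n where an: "\<phi> \<circ> (\<lambda>t::real. c + t *\<^sub>R (x - c)) = (\<lambda>t. \<Sum>i\<le>n. a i * t ^ i)"
    by (auto simp: real_polynomial_function_iff_sum)
  have an': "\<phi> (c + t *\<^sub>R (x - c)) = (\<Sum>i\<le>n. a i * t ^ i)" for t
    using fun_cong[OF an, of t] by simp
  have "open ((\<lambda>t::real. c + t *\<^sub>R (x - c)) -` U)"
    by (intro open_vimage U continuous_intros)
  moreover have "0 \<in> (\<lambda>t::real. c + t *\<^sub>R (x - c)) -` U" using U by simp
  ultimately obtain r where r: "0 < r" "ball (0::real) r \<subseteq> (\<lambda>t::real. c + t *\<^sub>R (x - c)) -` U"
    by (meson open_contains_ball)
  have "{0<..<r} \<subseteq> {t. (\<Sum>i\<le>n. a i * t ^ i) = 0}"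
  proof
    fix t assume "t \<in> {0<..<r}"
    then have "t \<in> ball 0 r" by simp
    then have "c + t *\<^sub>R (x - c) \<in> U" using r by blast
    then have "\<phi> (c + t *\<^sub>R (x - c)) = 0" by (rule z)
    then show "t \<in> {t. (\<Sum>i\<le>n. a i * t ^ i) = 0}" using an'[of t] by simp
  qed
  moreover have "infinite {0<..<r}" using r(1) by (simp add: infinite_Ioo)
  ultimately have "infinite {t. (\<Sum>i\<le>n. a i * t ^ i) = 0}" using finite_subset by blast
  then have "\<forall>i\<le>n. a i = 0" using polyfun_finite_roots[of a n] by blast
  then have "\<phi> (c + 1 *\<^sub>R (x - c)) = 0" unfolding an' by simp
  then show ?thesis by simp
qed

text \<open>A nonzero value would persist on a nonempty open set, and such a set is not
  negligible.\<close>

lemma AE_zero_continuous: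
  fixes f :: "pt \<Rightarrow> 'b::real_normed_vector"
  assumes f: "continuous_on UNIV f" and K: "K \<in> sets lebesgue" and ae: "AE x in lebesgue_on K. f x = 0" and x: "x \<in> interior K"
  shows "f x = 0"
proof (rule ccontr)
  assume "f x \<noteq> 0"
  let ?V = "interior K \<inter> f -` (- {0})"
  have "open ?V" by (intro open_Int open_interior open_vimage f) auto
  moreover have "x \<in> ?V" using x \<open>f x \<noteq> 0\<close> by simp
  moreover have "AE y in lebesgue. y \<notin> ?V"
    using ae unfolding AE_lebesgue_on_iff[OF K] by eventually_elim (use interior_subset in blast)
  then have "negligible ?V" by (simp add: negligible_iff_null_sets completion.null_sets_iff_AE)
  ultimately show False using open_not_negligible by blast
qed

text \<open>This gives the definite description in \<open>rep\<close> its meaning: agreement almost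
  everywhere on a set with interior pins a polynomial down globally.\<close>

lemma polys_unique:
  assumes "\<phi> \<in> polys k" "\<psi> \<in> polys k" "K \<in> sets lebesgue" "interior K \<noteq> {}" "AE x in lebesgue_on K. \<phi> x = \<psi> x"
  shows "\<phi> = \<psi>"
proof
  fix x
  let ?d = "\<lambda>x. \<phi> x - \<psi> x"
  have p: "real_polynomial_function ?d" using assms(1,2) polys_polynomial by (intro real_polynomial_function_diff)
  obtain D where "C1_with_gradient ?d D" using real_polynomial_function_C1[OF p] by blast
  then have c: "continuous_on UNIV ?d" by (rule C1_with_gradient_continuous)
  have ae: "AE x in lebesgue_on K. ?d x = 0" using assms(5) by eventually_elim simp
  obtain z where "z \<in> interior K" using assms(4) by blast
  then have "?d x = 0"
    using real_polynomial_function_zero_open[OF p open_interior _ AE_zero_continuous[OF c assms(3) ae]] by blast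
  then show "\<phi> x = \<psi> x" by simp
qed

lemma RT0_unique:
  assumes "v \<in> RT0" "w \<in> RT0" "K \<in> sets lebesgue" "interior K \<noteq> {}" "AE x in lebesgue_on K. v x = w x"
  shows "v = w"
proof -
  obtain a b where v: "v = (\<lambda>x. a + b *\<^sub>R x)" using assms(1) by (auto simp: RT0_def)
  obtain a' b' where w: "w = (\<lambda>x. a' + b' *\<^sub>R x)" using assms(2) by (auto simp: RT0_def)
  let ?d = "\<lambda>x. (a - a') + (b - b') *\<^sub>R x"
  have c: "continuous_on UNIV ?d" by (intro continuous_intros)
  have ae: "AE x in lebesgue_on K. ?d x = 0" using assms(5) by eventually_elim (simp add: v w algebra_simps)
  have z: "?d x = 0" if "x \<in> interior K" for x using AE_zero_continuous[OF c assms(3) ae that] .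
  obtain z r where zr: "0 < r" "ball z r \<subseteq> interior K"
    using assms(4) open_interior[of K] by (meson ex_in_conv open_contains_ball)
  define h :: pt where "h = (r/2) *\<^sub>R axis 1 1"
  have h: "norm h = r/2" "h \<noteq> 0" using zr by (auto simp: h_def norm_axis_1)
  have "z \<in> ball z r" "z + h \<in> ball z r" using zr h by (auto simp: dist_norm)
  then have "?d z = 0" "?d (z + h) = 0" using z zr by blast+
  moreover have "?d (z + h) = ?d z + (b - b') *\<^sub>R h" by (simp add: scaleR_add_right)
  ultimately have "(b - b') *\<^sub>R h = 0" by simp
  then have "b = b'" using h by simp
  moreover have "a = a'" using \<open>?d z = 0\<close> \<open>b = b'\<close> by simp
  ultimately show ?thesis by (simp add: v w)
qed

lemma rep_eqI:
  assumes "\<phi> \<in> P" "AE x in lebesgue_on K. v x = \<phi> x"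
    and "\<And>\<psi>. \<psi> \<in> P \<Longrightarrow> AE x in lebesgue_on K. \<psi> x = \<phi> x \<Longrightarrow> \<psi> = \<phi>"
  shows "rep P K v = \<phi>"
  unfolding rep_def
proof (rule the_equality)
  fix \<psi> assume \<psi>: "\<psi> \<in> P \<and> (AE x in lebesgue_on K. v x = \<psi> x)"
  then have "AE x in lebesgue_on K. v x = \<psi> x" by blast
  then have "AE x in lebesgue_on K. \<psi> x = \<phi> x" using assms(2) by eventually_elim simp
  then show "\<psi> = \<phi>" using assms(3) \<psi> by blast
qed (use assms in blast)

lemma rep_polys:
  assumes K: "K \<in> sets lebesgue" "interior K \<noteq> {}" and v: "in_on (polys k) K v"
  shows "rep (polys k) K v \<in> polys k" "AE x in lebesgue_on K. v x = rep (polys k) K v x"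
proof -
  obtain \<phi> where \<phi>: "\<phi> \<in> polys k" "AE x in lebesgue_on K. v x = \<phi> x" using v by (auto simp: in_on_def)
  have "rep (polys k) K v = \<phi>" by (rule rep_eqI[OF \<phi> polys_unique[OF _ \<phi>(1) K]])
  then show "rep (polys k) K v \<in> polys k" "AE x in lebesgue_on K. v x = rep (polys k) K v x" using \<phi> by auto
qed

lemma rep_polys_eq:
  assumes K: "K \<in> sets lebesgue" "interior K \<noteq> {}" and \<phi>: "\<phi> \<in> polys k" "AE x in lebesgue_on K. v x = \<phi> x"
  shows "rep (polys k) K v = \<phi>"
  by (rule rep_eqI[OF \<phi> polys_unique[OF _ \<phi>(1) K]])

lemma rep_RT0:
  assumes K: "K \<in> sets lebesgue" "interior K \<noteq> {}" and v: "in_on RT0 K v"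
  shows "rep RT0 K v \<in> RT0" "AE x in lebesgue_on K. v x = rep RT0 K v x"
proof -
  obtain \<phi> where \<phi>: "\<phi> \<in> RT0" "AE x in lebesgue_on K. v x = \<phi> x" using v by (auto simp: in_on_def)
  have "rep RT0 K v = \<phi>" by (rule rep_eqI[OF \<phi> RT0_unique[OF _ \<phi>(1) K]])
  then show "rep RT0 K v \<in> RT0" "AE x in lebesgue_on K. v x = rep RT0 K v x" using \<phi> by auto
qed

lemma rep_RT0_eq:
  assumes K: "K \<in> sets lebesgue" "interior K \<noteq> {}" and \<phi>: "\<phi> \<in> RT0" "AE x in lebesgue_on K. v x = \<phi> x"
  shows "rep RT0 K v = \<phi>"
  by (rule rep_eqI[OF \<phi> RT0_unique[OF _ \<phi>(1) K]])

lemma divergence_RT0: "divergence (\<lambda>x. \<alpha> + \<beta> *\<^sub>R x) x = 2 * \<beta>"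
proof -
  have "((\<lambda>x. \<alpha> + \<beta> *\<^sub>R x) has_derivative (\<lambda>h. \<beta> *\<^sub>R h)) (at x)" for x :: pt
    by (auto intro!: derivative_eq_intros)
  then have "frechet_derivative (\<lambda>x. \<alpha> + \<beta> *\<^sub>R x) (at x) = (\<lambda>h. \<beta> *\<^sub>R h)"
    by (simp add: frechet_derivative_at[symmetric])
  then show ?thesis by (simp add: divergence_def sum_2 axis_def)
qed

text \<open>The product of the three barycentric coordinates has degree 3, vanishes on the boundary
  and is positive inside; it is divided by its integral.\<close>

lemma triangle_bubble:
  assumes K: "2 simplex K"
  obtains \<phi> where "\<phi> \<in> polys 3" "\<And>x. x \<in> frontier K \<Longrightarrow> \<phi> x = 0" "(LINT x|lebesgue_on (interior K). \<phi> x) = 1"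
proof -
  obtain a b c where K': "K = convex hull {a, b, c}" and J: "tdet a b c \<noteq> 0" using simplex_2_triangle[OF K] .
  define p where "p x = (tdet x b c / tdet a b c) * ((tdet a x c / tdet a b c) * (tdet a b x / tdet a b c))" for x
  have pp: "p \<in> polys 3"
  proof -
    have cyc: "tdet a x c / tdet a b c = tdet x c a / tdet a b c" "tdet a b x / tdet a b c = tdet x a b / tdet a b c" for x by (simp_all add: tdet_def algebra_simps)
    obtain \<alpha> \<beta> \<gamma> where 1: "\<And>x. tdet x b c / tdet a b c = \<alpha> + \<beta> * x $ 1 + \<gamma> * x $ 2" using tdet_affine_form[of b c "tdet a b c"] by blast
    obtain \<alpha>' \<beta>' \<gamma>' where 2: "\<And>x. tdet x c a / tdet a b c = \<alpha>' + \<beta>' * x $ 1 + \<gamma>' * x $ 2" using tdet_affine_form[of c a "tdet a b c"] by blast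
    obtain \<alpha>'' \<beta>'' \<gamma>'' where 3: "\<And>x. tdet x a b / tdet a b c = \<alpha>'' + \<beta>'' * x $ 1 + \<gamma>'' * x $ 2" using tdet_affine_form[of a b "tdet a b c"] by blast
    show ?thesis
      unfolding p_def cyc 1 2 3 numeral_3_eq_3 by (intro polys_affine_mult polys_affine[unfolded One_nat_def])
  qed
  obtain D where C1: "C1_with_gradient p D" using polys_C1[OF pp] by blast
  have cp: "continuous_on UNIV p" by (rule C1_with_gradient_continuous[OF C1])
  have fr: "p x = 0" if "x \<in> frontier K" for x
  proof -
    have "x \<in> K" "x \<notin> interior K"
      using that closed_simplex[OF K] by (auto simp: frontier_def)
    then show ?thesis
      unfolding K' in_triangle_iff[OF J] interior_triangle_iff[OF J] p_def by auto
  qed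
  have pos: "0 < p x" if "x \<in> interior K" for x
    using that unfolding K' interior_triangle_iff[OF J] p_def by (intro mult_pos_pos) auto
  have bdd: "bounded (interior K)" unfolding K' by (rule triangle_interior_bounded)
  have int: "integrable (lebesgue_on (interior K)) p"
    by (rule continuous_integrable_on_bounded_open[OF cp open_interior bdd])
  define I where "I = (LINT x|lebesgue_on (interior K). p x)"
  have I0: "I \<noteq> 0"
  proof
    assume "I = 0"
    moreover have "AE x in lebesgue_on (interior K). 0 \<le> p x"
      using pos by (intro AE_I2) (simp add: space_restrict_space less_imp_le)
    ultimately have "AE x in lebesgue_on (interior K). p x = 0"
      using integral_nonneg_eq_0_iff_AE[OF int] by (simp add: I_def)
    moreover obtain z where "z \<in> interior K" using triangle_interior_nonempty[OF J] unfolding K' by blast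
    ultimately have "p z = 0" using AE_zero_continuous[OF cp, of "interior K" z] by auto
    then show False using pos \<open>z \<in> interior K\<close> by fastforce
  qed
  show thesis
  proof (rule that[of "\<lambda>x. (1/I) * p x"])
    obtain d where d: "p = (\<lambda>x. \<Sum>i\<le>3. \<Sum>j\<le>3 - i. d i j * (x $ 1) ^ i * (x $ 2) ^ j)"
      using pp by (auto simp: polys_def)
    show "(\<lambda>x. (1/I) * p x) \<in> polys 3"
      unfolding polys_def d mem_Collect_eq sum_distrib_left by (rule exI[of _ "\<lambda>i j. (1/I) * d i j"]) (simp add: mult.assoc)
    show "(LINT x|lebesgue_on (interior K). (1/I) * p x) = 1" using I0 by (simp add: I_def[symmetric])
  qed (use fr in auto)
qed

lemma polys_scale:
  assumes "\<phi> \<in> polys k"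
  shows "(\<lambda>x. s * \<phi> x) \<in> polys k"
proof -
  obtain d where d: "\<phi> = (\<lambda>x. \<Sum>i\<le>k. \<Sum>j\<le>k - i. d i j * (x $ 1) ^ i * (x $ 2) ^ j)"
    using assms by (auto simp: polys_def)
  show ?thesis
    unfolding polys_def d mem_Collect_eq sum_distrib_left by (rule exI[of _ "\<lambda>i j. s * d i j"]) (simp add: mult.assoc)
qed

text \<open>One minus twice the barycentric coordinate of a vertex is 1 at the midpoint of the
  opposite edge and 0 at the other two midpoints; these are the Crouzeix-Raviart basis
  functions.\<close>

lemma triangle_midpoint_interpolation:
  assumes K: "2 simplex K"
  obtains \<phi> where "\<phi> \<in> polys 1" "\<And>e. e edge_of K \<Longrightarrow> \<phi> (edge_mid e) = l e"
proof -
  obtain a b c where K': "K = convex hull {a, b, c}" and J: "tdet a b c \<noteq> 0" using simplex_2_triangle[OF K] .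
  define p where "p x = l (closed_segment b c) * (1 - 2 * (tdet x b c / tdet a b c)) +
    (l (closed_segment c a) * (1 - 2 * (tdet a x c / tdet a b c)) + l (closed_segment a b) * (1 - 2 * (tdet a b x / tdet a b c)))" for x
  have pp: "p \<in> polys 1"
  proof -
    have cyc: "tdet a x c / tdet a b c = tdet x c a / tdet a b c" "tdet a b x / tdet a b c = tdet x a b / tdet a b c" for x by (simp_all add: tdet_def algebra_simps)
    obtain \<alpha> \<beta> \<gamma> where 1: "\<And>x. tdet x b c / tdet a b c = \<alpha> + \<beta> * x $ 1 + \<gamma> * x $ 2" using tdet_affine_form[of b c "tdet a b c"] by blast
    obtain \<alpha>' \<beta>' \<gamma>' where 2: "\<And>x. tdet x c a / tdet a b c = \<alpha>' + \<beta>' * x $ 1 + \<gamma>' * x $ 2" using tdet_affine_form[of c a "tdet a b c"] by blast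
    obtain \<alpha>'' \<beta>'' \<gamma>'' where 3: "\<And>x. tdet x a b / tdet a b c = \<alpha>'' + \<beta>'' * x $ 1 + \<gamma>'' * x $ 2" using tdet_affine_form[of a b "tdet a b c"] by blast
    have form: "1 - 2 * (A + B * y + C * z) = (1 - 2 * A) + (- 2 * B) * y + (- 2 * C) * z" for A B C y z :: real
      by (simp add: algebra_simps)
    show ?thesis
      unfolding p_def cyc 1 2 3 form by (intro polys_add polys_scale polys_affine)
  qed
  have mid: "edge_mid (closed_segment x y) = (1/2) *\<^sub>R x + (1/2) *\<^sub>R y" for x y :: pt
    using edge_ends_closed_segment[of x y] by (auto simp: edge_mid_def midpoint_def scaleR_add_right)
  have s: "(0::real) + 1/2 + 1/2 = 1" "(1/2::real) + 0 + 1/2 = 1" "(1/2::real) + 1/2 + 0 = 1" by auto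
  have ma: "edge_mid (closed_segment b c) = 0 *\<^sub>R a + (1/2) *\<^sub>R b + (1/2) *\<^sub>R c"
    and mb: "edge_mid (closed_segment c a) = (1/2) *\<^sub>R a + 0 *\<^sub>R b + (1/2) *\<^sub>R c"
    and mc: "edge_mid (closed_segment a b) = (1/2) *\<^sub>R a + (1/2) *\<^sub>R b + 0 *\<^sub>R c"
    by (simp_all add: mid)
  have "p (edge_mid (closed_segment b c)) = l (closed_segment b c)"
    "p (edge_mid (closed_segment c a)) = l (closed_segment c a)"
    "p (edge_mid (closed_segment a b)) = l (closed_segment a b)"
    unfolding p_def ma mb mc tdet_affine[OF s(1)] tdet_affine[OF s(2)] tdet_affine[OF s(3)] using J by simp_all
  then have "p (edge_mid e) = l e" if "e edge_of K" for e
  proof -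
    have "e \<in> {closed_segment b c, closed_segment c a, closed_segment a b}"
      using that triangle_edges[OF J] unfolding K' by blast
    then show ?thesis
      using \<open>p (edge_mid (closed_segment b c)) = l (closed_segment b c)\<close>
        \<open>p (edge_mid (closed_segment c a)) = l (closed_segment c a)\<close>
        \<open>p (edge_mid (closed_segment a b)) = l (closed_segment a b)\<close> by blast
  qed
  then show ?thesis by (rule that[OF pp])
qed

text \<open>The midpoint rule is exact for affine functions; it turns conditions on edge means into
  conditions at midpoints.\<close>

lemma edge_integral_affine:
  assumes "\<phi> \<in> polys 1"
  shows "edge_integral e \<phi> = edge_length e * \<phi> (edge_mid e)"
proof -
  obtain \<alpha> \<beta> \<gamma> where p: "\<phi> = (\<lambda>x. \<alpha> + \<beta> * x $ 1 + \<gamma> * x $ 2)" using polys_1_affine[OF assms] .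
  obtain P Q where PQ: "edge_ends e = (P, Q)" by fastforce
  define A where "A = \<phi> P" define B where "B = \<phi> Q - \<phi> P"
  have path: "\<phi> (edge_path e t) = A + B * t" for t
    by (simp add: p edge_path_def linepath_def PQ A_def B_def algebra_simps)
  have "(LINT t|lebesgue_on {0..1}. A + B * t) = A + B / 2"
  proof -
    have "(LINT t|lebesgue_on {0..1}. A + B * t) = (LINT t|lborel. (A + B * t) * indicator {0..1} t)"
      by (simp add: integral_lebesgue_on_eq integral_completion mult.commute)
    also have "\<dots> = (A * 1 + B * 1\<^sup>2 / 2) - (A * 0 + B * 0\<^sup>2 / 2)"
      by (rule integral_FTC_Icc_real) (auto intro!: derivative_eq_intros continuous_intros)
    finally show ?thesis by simp
  qed
  moreover have "\<phi> (edge_mid e) = A + B / 2"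
    by (simp add: p edge_mid_def midpoint_def PQ A_def B_def algebra_simps add_divide_distrib diff_divide_distrib)
  ultimately show ?thesis by (simp add: edge_integral_def path)
qed

section \<open>Lebesgue spaces on bounded open sets\<close>

lemma Lp_integrable:
  fixes u :: "pt \<Rightarrow> 'b::euclidean_space"
  assumes U: "open U" "bounded U" and p: "1 \<le> p" and u: "u \<in> Lp (lebesgue_on U) p"
  shows "integrable (lebesgue_on U) u"
proof (rule Bochner_Integration.integrable_bound)
  have "integrable (lebesgue_on U) (\<lambda>_. 1 :: real)"
    by (rule continuous_integrable_on_bounded_open[OF _ U]) simp
  then show "integrable (lebesgue_on U) (\<lambda>x. 1 + norm (u x) powr p)"
    using u by (auto simp: Lp_def)
  show "u \<in> borel_measurable (lebesgue_on U)" using u by (simp add: Lp_def)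
  show "AE x in lebesgue_on U. norm (u x) \<le> norm (1 + norm (u x) powr p)"
  proof (rule AE_I2)
    fix x
    have "norm (u x) \<le> 1 + norm (u x) powr p"
    proof (cases "norm (u x) \<le> 1")
      case True
      then show ?thesis by (simp add: add_increasing2)
    next
      case False
      then have "norm (u x) powr 1 \<le> norm (u x) powr p" using p by (intro powr_mono) auto
      then show ?thesis using False by simp
    qed
    then show "norm (u x) \<le> norm (1 + norm (u x) powr p)" by simp
  qed
qed

lemma Lp_add:
  fixes u v :: "'a \<Rightarrow> 'b::euclidean_space"
  assumes p: "0 < p" and u: "u \<in> Lp M p" and v: "v \<in> Lp M p"
  shows "(\<lambda>x. u x + v x) \<in> Lp M p"
proof -
  have m: "(\<lambda>x. u x + v x) \<in> borel_measurable M" using u v by (auto simp: Lp_def)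
  have "integrable M (\<lambda>x. norm (u x + v x) powr p)"
  proof (rule Bochner_Integration.integrable_bound)
    show "integrable M (\<lambda>x. 2 powr p * (norm (u x) powr p + norm (v x) powr p))"
      using u v by (auto simp: Lp_def)
    show "(\<lambda>x. norm (u x + v x) powr p) \<in> borel_measurable M" using m by measurable
    show "AE x in M. norm (norm (u x + v x) powr p) \<le> norm (2 powr p * (norm (u x) powr p + norm (v x) powr p))"
    proof (rule AE_I2)
      fix x
      let ?m = "max (norm (u x)) (norm (v x))"
      have "norm (u x + v x) \<le> 2 * ?m" using norm_triangle_ineq[of "u x" "v x"] by linarith
      then have "norm (u x + v x) powr p \<le> (2 * ?m) powr p" using p by (intro powr_mono2) auto
      also have "\<dots> = 2 powr p * ?m powr p" by (rule powr_mult)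
      also have "?m powr p \<le> norm (u x) powr p + norm (v x) powr p" by (simp add: max_def)
      finally show "norm (norm (u x + v x) powr p) \<le> norm (2 powr p * (norm (u x) powr p + norm (v x) powr p))"
        by (simp add: mult_left_mono)
    qed
  qed
  then show ?thesis using m by (simp add: Lp_def)
qed

lemma Lp_uminus: "u \<in> Lp M p \<Longrightarrow> (\<lambda>x. - u x) \<in> Lp M p"
  by (simp add: Lp_def)

lemma Lp_AE:
  fixes f g :: "'a::euclidean_space \<Rightarrow> 'b::euclidean_space"
  assumes A: "A \<in> sets lebesgue" and f: "f \<in> Lp (lebesgue_on A) p" and eq: "AE x in lebesgue_on A. f x = g x"
  shows "g \<in> Lp (lebesgue_on A) p"
proof -
  have "AE x in lebesgue_on A. norm (f x) powr p = norm (g x) powr p" using eq by eventually_elim simp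
  then show ?thesis
    using f borel_measurable_lebesgue_on_AE[OF A _ eq] integrable_lebesgue_on_AE[OF A, of "\<lambda>x. norm (f x) powr p" "\<lambda>x. norm (g x) powr p"]
    by (auto simp: Lp_def)
qed

lemma Lp_subset:
  fixes f :: "'a::euclidean_space \<Rightarrow> 'b::euclidean_space"
  assumes "f \<in> Lp (lebesgue_on A) p" "A \<in> sets lebesgue" "B \<in> sets lebesgue" "B \<subseteq> A"
  shows "f \<in> Lp (lebesgue_on B) p"
  using assms integrable_lebesgue_on_subset[of A "\<lambda>x. norm (f x) powr p" B]
  by (auto simp: Lp_def intro: measurable_restrict_mono)

lemma Lp_continuous_bounded:
  fixes f :: "pt \<Rightarrow> 'b::euclidean_space"
  assumes f: "continuous_on UNIV f" and U: "open U" "bounded U" and p: "0 < p"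
  shows "f \<in> Lp (lebesgue_on U) p"
proof -
  have m: "f \<in> borel_measurable (lebesgue_on U)"
    by (intro measurable_restrict_space1 measurable_completion) (simp add: borel_measurable_continuous_onI f)
  have "bounded (f ` closure U)"
    using U by (intro compact_imp_bounded compact_continuous_image continuous_on_subset[OF f]) auto
  then obtain M where M: "\<And>x. x \<in> closure U \<Longrightarrow> norm (f x) \<le> M" by (auto simp: bounded_iff)
  have "integrable (lebesgue_on U) (\<lambda>x. norm (f x) powr p)"
  proof (rule Bochner_Integration.integrable_bound)
    show "integrable (lebesgue_on U) (\<lambda>_. M powr p)"
      by (rule continuous_integrable_on_bounded_open[OF _ U]) simp
    show "(\<lambda>x. norm (f x) powr p) \<in> borel_measurable (lebesgue_on U)" using m by measurable
    show "AE x in lebesgue_on U. norm (norm (f x) powr p) \<le> norm (M powr p)"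
    proof (rule AE_I2)
      fix x assume "x \<in> space (lebesgue_on U)"
      then have "norm (f x) \<le> M" using M closure_subset[of U] by (auto simp: space_restrict_space)
      then show "norm (norm (f x) powr p) \<le> norm (M powr p)" using p by (simp add: powr_mono2)
    qed
  qed
  then show ?thesis using m by (simp add: Lp_def)
qed

lemma C1_edge_radial:
  assumes "apex_of K e a" "C1_with_gradient \<phi> \<phi>'"
  shows "edge_det e a * edge_integral e \<phi> = edge_length e * (LINT x|lebesgue_on (interior K). 2 * \<phi> x + \<phi>' x \<bullet> (x - a))"
proof -
  have K': "K = convex hull {a, fst (edge_ends e), snd (edge_ends e)}" and J: "tdet a (fst (edge_ends e)) (snd (edge_ends e)) \<noteq> 0"
    using assms(1) by (auto simp: apex_of_def)
  show ?thesis
    using triangle_radial_formula[OF J assms(2), folded K'] by (simp add: edge_integral_def edge_det_def edge_path_def)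
qed

text \<open>In a mesh the points of triangle boundaries lie in no interior and receive the default
  value 0; as they form a null set, each piece is recovered almost everywhere.\<close>

definition piecewise :: "pt set set \<Rightarrow> (pt set \<Rightarrow> pt \<Rightarrow> real) \<Rightarrow> pt \<Rightarrow> real" where
  "piecewise \<T> P x = (\<Sum>K\<in>\<T>. indicator (interior K) x * P K x)"

text \<open>Evaluated at one end point because the normal component of an RT0 field is constant
  along an edge.\<close>

definition flux :: "pt set \<Rightarrow> pt set \<Rightarrow> (pt \<Rightarrow> pt) \<Rightarrow> real" where
  "flux K e v = rep RT0 K v (fst (edge_ends e)) \<bullet> outer_normal K e"

text \<open>Evaluated at the origin because the divergence of an RT0 field is constant.\<close>

definition div_on :: "pt set \<Rightarrow> (pt \<Rightarrow> pt) \<Rightarrow> real" where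
  "div_on K v = divergence (rep RT0 K v) 0"

lemma in_onI: "\<phi> \<in> P \<Longrightarrow> AE x in lebesgue_on K. v x = \<phi> x \<Longrightarrow> in_on P K v"
  unfolding in_on_def by blast

section \<open>Green's formula, discrete spaces and projections on the mesh\<close>

context mesh_domain
begin

lemma interior_sets: "interior K \<in> sets lebesgue"
  by auto

lemma piecewise_interior: "K \<in> \<T> \<Longrightarrow> x \<in> interior K \<Longrightarrow> piecewise \<T> P x = P K x"
  using sum_interior_indicator[of K x "\<lambda>K. P K x"] by (simp add: piecewise_def)

lemma piecewise_AE: "K \<in> \<T> \<Longrightarrow> AE x in lebesgue_on K. piecewise \<T> P x = P K x"
  by (rule AE_triangle_of_interior) (auto simp: piecewise_interior)

lemma piecewise_AE_interior: "K \<in> \<T> \<Longrightarrow> AE x in lebesgue_on (interior K). piecewise \<T> P x = P K x"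
  by (rule AE_interior_of_triangle[OF _ piecewise_AE])

lemma Lp_of_interiors:
  fixes f :: "pt \<Rightarrow> 'b::euclidean_space"
  assumes f: "\<And>K. K \<in> \<T> \<Longrightarrow> f \<in> Lp (lebesgue_on (interior K)) p"
  shows "f \<in> Lp (lebesgue_on \<Omega>) p"
proof -
  have "integrable (lebesgue_on K) (\<lambda>x. norm (f x) powr p)" if "K \<in> \<T>" for K
    using f[OF that] integral_triangle_interior(2)[OF that, of "\<lambda>x. norm (f x) powr p"] by (simp add: Lp_def)
  then have int: "integrable (lebesgue_on \<Omega>) (\<lambda>x. norm (f x) powr p)" by (rule integral_domain_split(2))
  have "(\<lambda>x. indicator (interior K) x *\<^sub>R f x) \<in> borel_measurable lebesgue" if "K \<in> \<T>" for K
    using f[OF that] by (subst borel_measurable_restrict_space_iff[symmetric]) (auto simp: Lp_def)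
  then have "(\<lambda>x. \<Sum>K\<in>\<T>. indicator (interior K) x *\<^sub>R f x) \<in> borel_measurable lebesgue"
    by (rule borel_measurable_sum)
  then have m: "(\<lambda>x. \<Sum>K\<in>\<T>. indicator (interior K) x *\<^sub>R f x) \<in> borel_measurable (lebesgue_on \<Omega>)"
    by (rule measurable_restrict_space1)
  have "AE x in lebesgue. x \<in> \<Omega> \<longrightarrow> (\<Sum>K\<in>\<T>. indicator (interior K) x *\<^sub>R f x) = f x"
    using AE_some_interior by eventually_elim (auto simp: sum_interior_indicator)
  then have "AE x in lebesgue_on \<Omega>. (\<Sum>K\<in>\<T>. indicator (interior K) x *\<^sub>R f x) = f x"
    by (simp add: AE_lebesgue_on_iff domain_sets)
  then have "f \<in> borel_measurable (lebesgue_on \<Omega>)"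
    by (rule borel_measurable_lebesgue_on_AE[OF domain_sets m])
  then show ?thesis using int by (simp add: Lp_def)
qed

lemma Lp_interior: "K \<in> \<T> \<Longrightarrow> f \<in> Lp (lebesgue_on \<Omega>) p \<Longrightarrow> f \<in> Lp (lebesgue_on (interior K)) (p :: real)"
  for f :: "pt \<Rightarrow> 'b::euclidean_space"
  by (rule Lp_subset[OF _ domain_sets interior_sets interior_subset_domain])

lemma piecewise_Lp:
  assumes P: "\<And>K. K \<in> \<T> \<Longrightarrow> continuous_on UNIV (P K)" and p: "0 < p"
  shows "piecewise \<T> P \<in> Lp (lebesgue_on \<Omega>) p"
proof (rule Lp_of_interiors)
  fix K assume K: "K \<in> \<T>"
  have "AE x in lebesgue_on (interior K). P K x = piecewise \<T> P x"
    using piecewise_AE_interior[OF K, of P] by eventually_elim simp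
  then show "piecewise \<T> P \<in> Lp (lebesgue_on (interior K)) p"
    by (rule Lp_AE[OF interior_sets Lp_continuous_bounded[OF P[OF K] open_interior mesh_triangle_props(6)[OF K] p]])
qed

lemma broken_grad_interior:
  assumes "K \<in> \<T>" "x \<in> interior K"
  shows "broken_grad \<T> u x = wgrad (interior K) u x"
  using sum_interior_indicator[OF assms, of "\<lambda>K. wgrad (interior K) u x"] by (simp add: broken_grad_def)

lemma broken_grad_AE:
  assumes K: "K \<in> \<T>" and wg: "weak_gradient (interior K) u D"
  shows "AE x in lebesgue_on K. broken_grad \<T> u x = D x" "AE x in lebesgue_on (interior K). D x = broken_grad \<T> u x"
proof -
  have "AE x in lebesgue_on (interior K). D x = wgrad (interior K) u x" by (rule wgrad_AE[OF open_interior wg])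
  then have ae: "AE x in lebesgue. x \<in> interior K \<longrightarrow> D x = broken_grad \<T> u x"
    unfolding AE_lebesgue_on_iff[OF interior_sets] by eventually_elim (simp add: broken_grad_interior[OF K])
  then show "AE x in lebesgue_on (interior K). D x = broken_grad \<T> u x" by (simp add: AE_lebesgue_on_iff)
  have "AE x in lebesgue. x \<in> K \<longrightarrow> broken_grad \<T> u x = D x"
    using ae AE_in_interior_iff[OF K] by eventually_elim auto
  then show "AE x in lebesgue_on K. broken_grad \<T> u x = D x"
    by (simp add: AE_lebesgue_on_iff mesh_triangle_props(3)[OF K])
qed

lemma W_rep:
  assumes v: "v \<in> W_space \<Omega> \<T> s" and K: "K \<in> \<T>"
  obtains \<alpha> \<beta> where "rep RT0 K v = (\<lambda>x. \<alpha> + \<beta> *\<^sub>R x)" "AE x in lebesgue_on K. v x = \<alpha> + \<beta> *\<^sub>R x" "div_on K v = 2 * \<beta>"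
proof -
  have "in_on RT0 K v" using v K by (simp add: W_space_def)
  note r = rep_RT0[OF mesh_triangle_props(3,5)[OF K] this]
  obtain \<alpha> \<beta> where ab: "rep RT0 K v = (\<lambda>x. \<alpha> + \<beta> *\<^sub>R x)" using r(1) by (auto simp: RT0_def)
  show ?thesis
  proof (rule that[OF ab])
    show "AE x in lebesgue_on K. v x = \<alpha> + \<beta> *\<^sub>R x" using r(2) by (simp add: ab)
    show "div_on K v = 2 * \<beta>" unfolding div_on_def ab divergence_RT0 ..
  qed
qed

lemma W_uminus:
  assumes v: "v \<in> W_space \<Omega> \<T> s"
  shows "(\<lambda>x. - v x) \<in> W_space \<Omega> \<T> s"
    and "K \<in> \<T> \<Longrightarrow> flux K e (\<lambda>x. - v x) = - flux K e v"
    and "K \<in> \<T> \<Longrightarrow> div_on K (\<lambda>x. - v x) = - div_on K v"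
proof -
  have r: "rep RT0 K (\<lambda>x. - v x) = (\<lambda>x. - \<alpha> + (- \<beta>) *\<^sub>R x) \<and> in_on RT0 K (\<lambda>x. - v x)"
    if K: "K \<in> \<T>" and ab: "AE x in lebesgue_on K. v x = \<alpha> + \<beta> *\<^sub>R x" for K \<alpha> \<beta>
  proof
    have RT: "(\<lambda>x. - \<alpha> + (- \<beta>) *\<^sub>R x) \<in> RT0" unfolding RT0_def by blast
    have ae: "AE x in lebesgue_on K. - v x = - \<alpha> + (- \<beta>) *\<^sub>R x" using ab by eventually_elim simp
    show "rep RT0 K (\<lambda>x. - v x) = (\<lambda>x. - \<alpha> + (- \<beta>) *\<^sub>R x)"
      by (rule rep_RT0_eq[OF mesh_triangle_props(3,5)[OF K] RT ae])
    show "in_on RT0 K (\<lambda>x. - v x)" by (rule in_onI[OF RT ae])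
  qed
  show "(\<lambda>x. - v x) \<in> W_space \<Omega> \<T> s"
    unfolding W_space_def mem_Collect_eq
  proof (intro conjI ballI)
    show "(\<lambda>x. - v x) \<in> Lp (lebesgue_on \<Omega>) s" using v Lp_uminus by (auto simp: W_space_def)
    fix K assume K: "K \<in> \<T>"
    obtain \<alpha> \<beta> where "AE x in lebesgue_on K. v x = \<alpha> + \<beta> *\<^sub>R x" using W_rep[OF v K] .
    then show "in_on RT0 K (\<lambda>x. - v x)" using r[OF K] by blast
  qed
  assume K: "K \<in> \<T>"
  obtain \<alpha> \<beta> where ab: "rep RT0 K v = (\<lambda>x. \<alpha> + \<beta> *\<^sub>R x)" "AE x in lebesgue_on K. v x = \<alpha> + \<beta> *\<^sub>R x"
    "div_on K v = 2 * \<beta>" using W_rep[OF v K] .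
  have rr: "rep RT0 K (\<lambda>x. - v x) = (\<lambda>x. - \<alpha> + (- \<beta>) *\<^sub>R x)" using r[OF K ab(2)] by blast
  show "flux K e (\<lambda>x. - v x) = - flux K e v"
    unfolding flux_def rr ab(1) by (simp add: inner_add_left inner_diff_left)
  show "div_on K (\<lambda>x. - v x) = - div_on K v"
    unfolding ab(3) unfolding div_on_def rr divergence_RT0 by simp
qed

lemma div_form_eq:
  assumes v: "v \<in> W_space \<Omega> \<T> s"
  shows "div_form \<T> v q = (\<Sum>K\<in>\<T>. div_on K v * (LINT x|lebesgue_on K. q x))"
  unfolding div_form_def
proof (rule sum.cong[OF refl])
  fix K assume K: "K \<in> \<T>"
  obtain \<alpha> \<beta> where ab: "rep RT0 K v = (\<lambda>x. \<alpha> + \<beta> *\<^sub>R x)" "div_on K v = 2 * \<beta>" using W_rep[OF v K] .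
  show "(LINT x|lebesgue_on K. divergence (rep RT0 K v) x * q x) = div_on K v * (LINT x|lebesgue_on K. q x)"
    unfolding ab divergence_RT0 by simp
qed

text \<open>Along an edge both factors are constant, the multiplier almost everywhere and the normal
  component of \<open>v\<close> everywhere, so each edge integral is a product.\<close>

lemma skeleton_form_eq:
  assumes v: "v \<in> W_space \<Omega> \<T> s" and l: "\<And>e. e \<in> edges \<T> \<Longrightarrow> AE t in lebesgue_on {0..1}. l (edge_path e t) = c e"
  shows "skeleton_form \<T> l v = (\<Sum>K\<in>\<T>. \<Sum>e | e edge_of K. c e * edge_length e * flux K e v)"
  unfolding skeleton_form_def
proof (intro sum.cong refl)
  fix K e assume K: "K \<in> \<T>" and "e \<in> {e. e edge_of K}"
  then have eK: "e edge_of K" by simp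
  then have e: "e \<in> edges \<T>" using K by (auto simp: edges_def)
  obtain \<alpha> \<beta> where ab: "rep RT0 K v = (\<lambda>x. \<alpha> + \<beta> *\<^sub>R x)" using W_rep[OF v K] .
  obtain a where a: "apex_of K e a" using edge_apex_exists[OF mesh_simplex[OF K] eK] by blast
  note on = outer_normal_apex(1)[OF a edge_segment(1)[OF e]]
  have pe: "fst (edge_ends e) \<in> e" by (subst (2) edge_segment(1)[OF e]) simp
  have const: "rep RT0 K v (edge_path e t) \<bullet> outer_normal K e = flux K e v" if "0 \<le> t" "t \<le> 1" for t
  proof -
    have "outer_normal K e \<bullet> (edge_path e t - fst (edge_ends e)) = 0"
      by (rule on[OF pe edge_path_in_edge[OF e that]])
    then have "outer_normal K e \<bullet> edge_path e t = outer_normal K e \<bullet> fst (edge_ends e)" by (simp add: inner_diff_right)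
    then show ?thesis
      unfolding flux_def ab inner_commute[of _ "outer_normal K e"] inner_add_right inner_scaleR_right by simp
  qed
  have "AE t in lebesgue_on {0..1}. l (edge_path e t) * (rep RT0 K v (edge_path e t) \<bullet> outer_normal K e) = c e * flux K e v"
    using l[OF e] AE_space by eventually_elim (simp add: const space_restrict_space)
  then have "(LINT t|lebesgue_on {0..1}. l (edge_path e t) * (rep RT0 K v (edge_path e t) \<bullet> outer_normal K e)) = (LINT t|lebesgue_on {0..1::real}. c e * flux K e v)"
    by (intro integral_lebesgue_on_AE) auto
  also have "\<dots> = c e * flux K e v" by (simp add: measure_restrict_space)
  finally show "edge_integral e (\<lambda>x. l x * (rep RT0 K v x \<bullet> outer_normal K e)) = c e * edge_length e * flux K e v"
    by (simp add: edge_integral_def)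
qed

text \<open>Transfers \<open>RT0_green\<close> from the representative of \<open>v\<close> on
  \<open>K\<close> to \<open>v\<close> itself, which agrees with it only almost everywhere.\<close>

lemma W_green:
  assumes v: "v \<in> W_space \<Omega> \<T> s" and K: "K \<in> \<T>"
    and u: "integrable (lebesgue_on (interior K)) u" and D: "integrable (lebesgue_on (interior K)) D"
    and I: "\<And>e a. e edge_of K \<Longrightarrow> apex_of K e a \<Longrightarrow>
      edge_det e a * I e = edge_length e * (LINT x|lebesgue_on (interior K). 2 * u x + D x \<bullet> (x - a))"
  shows "(\<Sum>e | e edge_of K. I e * flux K e v) = div_on K v * (LINT x|lebesgue_on K. u x) + (LINT x|lebesgue_on K. D x \<bullet> v x)"
    "integrable (lebesgue_on K) (\<lambda>x. D x \<bullet> v x)"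
proof -
  obtain \<alpha> \<beta> where ab: "rep RT0 K v = (\<lambda>x. \<alpha> + \<beta> *\<^sub>R x)" "AE x in lebesgue_on K. v x = \<alpha> + \<beta> *\<^sub>R x" "div_on K v = 2 * \<beta>"
    using W_rep[OF v K] .
  have "integrable (lebesgue_on (interior K)) (\<lambda>x. 2 * (0::real) + D x \<bullet> (x - 0))"
    by (rule radial_functional_integrable[OF mesh_triangle_props(6)[OF K] open_interior _ D]) simp
  then have "integrable (lebesgue_on (interior K)) (\<lambda>x. D x \<bullet> \<alpha> + \<beta> * (D x \<bullet> x))"
    using D by auto
  then have i: "integrable (lebesgue_on (interior K)) (\<lambda>x. D x \<bullet> (\<alpha> + \<beta> *\<^sub>R x))"
    by (simp add: inner_add_right)
  have "AE x in lebesgue_on K. D x \<bullet> (\<alpha> + \<beta> *\<^sub>R x) = D x \<bullet> v x" using ab(2) by eventually_elim simp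
  note ae = this and ae' = AE_interior_of_triangle[OF K this]
  have iv: "integrable (lebesgue_on (interior K)) (\<lambda>x. D x \<bullet> v x)"
    by (rule integrable_lebesgue_on_AE[OF interior_sets i ae'])
  then show "integrable (lebesgue_on K) (\<lambda>x. D x \<bullet> v x)"
    by (simp add: integral_triangle_interior(2)[OF K])
  have "(\<Sum>e | e edge_of K. I e * flux K e v) = (LINT x|lebesgue_on (interior K). 2 * \<beta> * u x + D x \<bullet> (\<alpha> + \<beta> *\<^sub>R x))"
    unfolding flux_def ab(1) by (rule RT0_green[OF mesh_simplex[OF K] u D I])
  also have "\<dots> = 2 * \<beta> * (LINT x|lebesgue_on (interior K). u x) + (LINT x|lebesgue_on (interior K). D x \<bullet> (\<alpha> + \<beta> *\<^sub>R x))"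
    using u i by simp
  also have "(LINT x|lebesgue_on (interior K). D x \<bullet> (\<alpha> + \<beta> *\<^sub>R x)) = (LINT x|lebesgue_on (interior K). D x \<bullet> v x)"
    by (rule integral_lebesgue_on_AE[OF interior_sets ae'])
  finally show "(\<Sum>e | e edge_of K. I e * flux K e v) = div_on K v * (LINT x|lebesgue_on K. u x) + (LINT x|lebesgue_on K. D x \<bullet> v x)"
    unfolding ab(3) integral_triangle_interior(1)[OF K] .
qed

text \<open>\<open>h\<close> is known to be C1 on \<open>K\<close> only up to a null set; uniqueness
  of weak gradients identifies its \<open>broken_grad\<close> with the classical gradient of
  \<phi>.\<close>

lemma W_green_C1:
  assumes v: "v \<in> W_space \<Omega> \<T> s" and K: "K \<in> \<T>" and C1: "C1_with_gradient \<phi> \<phi>'"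
    and h: "AE x in lebesgue_on K. h x = \<phi> x"
  shows "(LINT x|lebesgue_on K. v x \<bullet> broken_grad \<T> h x) = (\<Sum>e | e edge_of K. edge_integral e \<phi> * flux K e v) - div_on K v * (LINT x|lebesgue_on K. \<phi> x)"
proof -
  note c = C1_with_gradient_continuous[OF C1, of UNIV]
  note int = continuous_integrable_on_bounded_open[OF _ open_interior mesh_triangle_props(6)[OF K]]
  have "(\<Sum>e | e edge_of K. edge_integral e \<phi> * flux K e v) = div_on K v * (LINT x|lebesgue_on K. \<phi> x) + (LINT x|lebesgue_on K. \<phi>' x \<bullet> v x)"
    by (rule W_green[OF v K int[OF c(1)] int[OF c(2)] C1_edge_radial[OF _ C1]])
  moreover have "(LINT x|lebesgue_on K. v x \<bullet> broken_grad \<T> h x) = (LINT x|lebesgue_on K. \<phi>' x \<bullet> v x)"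
  proof (rule integral_lebesgue_on_AE[OF mesh_triangle_props(3)[OF K]])
    have "AE x in lebesgue_on (interior K). \<phi> x = h x"
      using AE_interior_of_triangle[OF K h] by eventually_elim simp
    then have "weak_gradient (interior K) h \<phi>'"
      by (rule weak_gradient_AE[OF open_interior C1_weak_gradient[OF open_interior C1]])
    from broken_grad_AE(1)[OF K this]
    show "AE x in lebesgue_on K. v x \<bullet> broken_grad \<T> h x = \<phi>' x \<bullet> v x"
      by eventually_elim (simp add: inner_commute)
  qed
  ultimately show ?thesis by simp
qed

lemma edge_integral_zero_frontier:
  assumes K: "K \<in> \<T>" "e edge_of K" and z: "\<And>x. x \<in> frontier K \<Longrightarrow> \<phi> x = 0"
  shows "edge_integral e \<phi> = 0"
proof -
  have e: "e \<in> edges \<T>" using K by (auto simp: edges_def)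
  have "e \<noteq> K"
    using K(2) aff_dim_simplex[OF mesh_simplex[OF K(1)]] by (auto simp: edge_of_def)
  moreover have "e face_of K" using K(2) by (simp add: edge_of_def)
  ultimately have "e \<inter> interior K = {}" "e \<subseteq> K" by (auto dest: face_of_disjoint_interior face_of_imp_subset)
  then have "x \<in> frontier K" if "x \<in> e" for x
    using that closure_subset[of K] by (auto simp: frontier_def)
  then have "\<phi> (edge_path e t) = 0" if "0 \<le> t" "t \<le> 1" for t
    using edge_path_in_edge[OF e that] z by blast
  then have "(LINT t|lebesgue_on {0..1}. \<phi> (edge_path e t)) = (LINT t|lebesgue_on {0..1::real}. 0)"
    by (intro Bochner_Integration.integral_cong) (auto simp: space_restrict_space)
  then show ?thesis by (simp add: edge_integral_def)
qed

lemma bubble_member: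
  assumes P: "\<And>K. K \<in> \<T> \<Longrightarrow> P K \<in> polys 3" "\<And>K x. K \<in> \<T> \<Longrightarrow> x \<in> frontier K \<Longrightarrow> P K x = 0"
  shows "piecewise \<T> P \<in> bubble_space \<Omega> \<T>"
  unfolding bubble_space_def mem_Collect_eq
proof (intro conjI ballI)
  have "continuous_on UNIV (P K)" if "K \<in> \<T>" for K
    using polys_C1[OF P(1)[OF that]] C1_with_gradient_continuous(1) by blast
  then show "piecewise \<T> P \<in> Lp (lebesgue_on \<Omega>) 2" by (rule piecewise_Lp[OF _ zero_less_numeral])
  fix K assume K: "K \<in> \<T>"
  show "in_on (polys 3) K (piecewise \<T> P)" by (rule in_onI[OF P(1)[OF K] piecewise_AE[OF K, of P]])
  have "rep (polys 3) K (piecewise \<T> P) = P K"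
    by (rule rep_polys_eq[OF mesh_triangle_props(3,5)[OF K] P(1)[OF K] piecewise_AE[OF K, of P]])
  then show "rep (polys 3) K (piecewise \<T> P) x = 0" if "x \<in> frontier K" for x using P(2)[OF K that] by simp
qed

text \<open>Midpoint values that depend on the edge alone make the midpoint continuity automatic,
  and by the midpoint rule their vanishing on boundary edges is the condition on edge means.\<close>

lemma CR_member:
  assumes P: "\<And>K. K \<in> \<T> \<Longrightarrow> P K \<in> polys 1" and mid: "\<And>K e. K \<in> \<T> \<Longrightarrow> e edge_of K \<Longrightarrow> P K (edge_mid e) = l e"
    and l: "\<And>e. e \<in> bdry_edges \<Omega> \<T> \<Longrightarrow> l e = 0"
  shows "piecewise \<T> P \<in> CR_space \<Omega> \<T>"
proof -
  have "continuous_on UNIV (P K)" if "K \<in> \<T>" for K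
    using polys_C1[OF P(1)[OF that]] C1_with_gradient_continuous(1) by blast
  then have Lp: "piecewise \<T> P \<in> Lp (lebesgue_on \<Omega>) 2" by (rule piecewise_Lp[OF _ zero_less_numeral])
  have rep: "rep (polys 1) K (piecewise \<T> P) = P K" if K: "K \<in> \<T>" for K
    by (rule rep_polys_eq[OF mesh_triangle_props(3,5)[OF K] P(1)[OF K] piecewise_AE[OF K, of P]])
  have "in_on (polys 1) K (piecewise \<T> P)" if K: "K \<in> \<T>" for K
    by (rule in_onI[OF P(1)[OF K] piecewise_AE[OF K, of P]])
  then show ?thesis
    unfolding CR_space_def using Lp mid l by (auto simp: rep[unfolded One_nat_def] edge_integral_affine[OF P])
qed

lemma proj_Q_AE:
  assumes K: "K \<in> \<T>"
  shows "AE x in lebesgue_on K. proj_Q \<T> \<phi> x = (LINT y|lebesgue_on K. \<phi> y) / measure lebesgue K"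
proof (rule AE_triangle_of_interior[OF K])
  fix x assume "x \<in> interior K"
  from sum_interior_indicator[OF K this, of "\<lambda>K. (LINT y|lebesgue_on K. \<phi> y) / measure lebesgue K"]
  show "proj_Q \<T> \<phi> x = (LINT y|lebesgue_on K. \<phi> y) / measure lebesgue K" by (simp add: proj_Q_def)
qed

lemma proj_Q_member:
  assumes "0 < r"
  shows "proj_Q \<T> \<phi> \<in> Q_space \<Omega> \<T> r"
proof -
  have eq: "proj_Q \<T> \<phi> = piecewise \<T> (\<lambda>K _. (LINT y|lebesgue_on K. \<phi> y) / measure lebesgue K)"
    by (simp add: proj_Q_def piecewise_def fun_eq_iff)
  have "proj_Q \<T> \<phi> \<in> Lp (lebesgue_on \<Omega>) r" unfolding eq by (rule piecewise_Lp[OF _ assms]) simp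
  moreover have "in_on (polys 0) K (proj_Q \<T> \<phi>)" if "K \<in> \<T>" for K
    by (rule in_onI[OF polys_const proj_Q_AE[OF that]])
  ultimately show ?thesis by (simp add: Q_space_def)
qed

lemma measure_triangle_pos:
  assumes K: "K \<in> \<T>"
  shows "0 < measure lebesgue K"
proof -
  have "\<not> negligible K" using mesh_triangle_props(5)[OF K] open_not_negligible[OF open_interior] negligible_subset[OF _ interior_subset] by blast
  moreover have "K \<in> lmeasurable" using mesh_triangle_props(1)[OF K] by (rule lmeasurable_compact)
  ultimately show ?thesis by (simp add: negligible_iff_measure zero_less_measure_iff)
qed

lemma integral_const_triangle:
  assumes K: "K \<in> \<T>" and q: "AE x in lebesgue_on K. q x = (c::real)"
  shows "(LINT x|lebesgue_on K. q x) = c * measure lebesgue K"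
proof -
  have "(LINT x|lebesgue_on K. q x) = (LINT x|lebesgue_on K. c)"
    by (rule integral_lebesgue_on_AE[OF mesh_triangle_props(3)[OF K] q])
  then show ?thesis using mesh_triangle_props(3)[OF K] by (simp add: measure_restrict_space mult.commute)
qed

end

section \<open>Traces of functions in the shifted nonconforming space, and test functions\<close>

context mesh_domain
begin

lemma edge_trace_radial:
  assumes K: "K \<in> \<T>" "e edge_of K" "apex_of K e a" and wg: "weak_gradient (interior K) u D"
    and u: "integrable (lebesgue_on (interior K)) u" and D: "integrable (lebesgue_on (interior K)) D"
  shows "edge_det e a * edge_integral e (trace_on K u) = edge_length e * (LINT x|lebesgue_on (interior K). 2 * u x + D x \<bullet> (x - a))"
proof -
  have "\<exists>\<tau>. is_trace K u \<tau>"
    by (rule trace_exists[OF finite_edges_of(1)[OF mesh_simplex[OF K(1)]] edge_apex_exists(1)[OF mesh_simplex[OF K(1)]]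
        finite_edges_of(2)[OF mesh_simplex[OF K(1)]] wg u D])
  then have "is_trace K u (trace_on K u)" unfolding trace_on_def by (rule someI_ex)
  then show ?thesis by (rule trace_radial_formula[OF K(3,2) _ wg u D])
qed

text \<open>Replaces the two summands by polynomials on each triangle. The boundary condition on
  edge means becomes a condition at midpoints, since edges have positive length and the midpoint
  rule is exact.\<close>

lemma N_space_rep:
  assumes "\<xi> \<in> N_space \<Omega> \<T>"
  obtains P Q where "\<And>K. K \<in> \<T> \<Longrightarrow> P K \<in> polys 1" "\<And>K. K \<in> \<T> \<Longrightarrow> Q K \<in> polys 3"
    "\<And>K. K \<in> \<T> \<Longrightarrow> AE x in lebesgue_on K. \<xi> x = P K x + Q K x"
    "\<And>K x. K \<in> \<T> \<Longrightarrow> x \<in> frontier K \<Longrightarrow> Q K x = 0"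
    "\<And>K e. K \<in> \<T> \<Longrightarrow> e edge_of K \<Longrightarrow> e \<in> bdry_edges \<Omega> \<T> \<Longrightarrow> P K (edge_mid e) = 0"
    "\<And>K K' e. K \<in> \<T> \<Longrightarrow> K' \<in> \<T> \<Longrightarrow> e edge_of K \<Longrightarrow> e edge_of K' \<Longrightarrow> e \<in> int_edges \<Omega> \<T> \<Longrightarrow> P K (edge_mid e) = P K' (edge_mid e)"
proof -
  obtain \<zeta> \<beta> where \<xi>: "\<xi> = (\<lambda>x. \<zeta> x + \<beta> x)" and \<zeta>: "\<zeta> \<in> CR_space \<Omega> \<T>" and \<beta>: "\<beta> \<in> bubble_space \<Omega> \<T>"
    using assms by (auto simp: N_space_def)
  have r1: "rep (polys 1) K \<zeta> \<in> polys 1" "AE x in lebesgue_on K. \<zeta> x = rep (polys 1) K \<zeta> x" if K: "K \<in> \<T>" for K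
    using rep_polys[OF mesh_triangle_props(3,5)[OF K], of 1 \<zeta>] \<zeta> K by (auto simp: CR_space_def)
  have r3: "rep (polys 3) K \<beta> \<in> polys 3" "AE x in lebesgue_on K. \<beta> x = rep (polys 3) K \<beta> x" if K: "K \<in> \<T>" for K
    using rep_polys[OF mesh_triangle_props(3,5)[OF K], of 3 \<beta>] \<beta> K by (auto simp: bubble_space_def)
  show ?thesis
  proof (rule that[of "\<lambda>K. rep (polys 1) K \<zeta>" "\<lambda>K. rep (polys 3) K \<beta>"])
    show "AE x in lebesgue_on K. \<xi> x = rep (polys 1) K \<zeta> x + rep (polys 3) K \<beta> x" if "K \<in> \<T>" for K
      using r1(2)[OF that] r3(2)[OF that] by eventually_elim (simp add: \<xi>)
    show "rep (polys 3) K \<beta> x = 0" if "K \<in> \<T>" "x \<in> frontier K" for K x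
      using \<beta> that by (simp add: bubble_space_def)
    show "rep (polys 1) K \<zeta> (edge_mid e) = rep (polys 1) K' \<zeta> (edge_mid e)"
      if "K \<in> \<T>" "K' \<in> \<T>" "e edge_of K" "e edge_of K'" "e \<in> int_edges \<Omega> \<T>" for K K' e
      using \<zeta> that unfolding CR_space_def by blast
    show "rep (polys 1) K \<zeta> (edge_mid e) = 0" if K: "K \<in> \<T>" "e edge_of K" "e \<in> bdry_edges \<Omega> \<T>" for K e
    proof -
      have "edge_integral e (rep (polys 1) K \<zeta>) = 0" using \<zeta> K unfolding CR_space_def by blast
      moreover have "0 < edge_length e" using K(3) edge_segment(3) by (auto simp: bdry_edges_def)
      ultimately show ?thesis using edge_integral_affine[OF r1(1)[OF K(1)], of e] by simp
    qed
  qed (use r1 r3 in blast)+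
qed

text \<open>Collects what the main argument uses about \<psi>: the broken gradient lies in the space
  on which \<open>G\<close> can be inverted, and the edge integral obeys the radial formula in every
  adjacent triangle, although \<open>edge_trace_integral\<close> looks into only one, unspecified,
  of them.\<close>

lemma shifted_N_element:
  assumes \<xi>: "\<xi> \<in> N_space \<Omega> \<T>" and gt: "gt \<in> sobolev1 \<Omega> p" and p: "1 \<le> p" and \<psi>: "\<psi> = (\<lambda>x. \<xi> x + gt x)"
  shows "broken_grad \<T> \<psi> \<in> Lp (lebesgue_on \<Omega>) p"
    and "\<And>K. K \<in> \<T> \<Longrightarrow> integrable (lebesgue_on (interior K)) \<psi>"
    and "\<And>K. K \<in> \<T> \<Longrightarrow> integrable (lebesgue_on (interior K)) (broken_grad \<T> \<psi>)"
    and "\<And>K e a. K \<in> \<T> \<Longrightarrow> e edge_of K \<Longrightarrow> apex_of K e a \<Longrightarrow>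
      edge_det e a * edge_trace_integral \<T> e \<psi> = edge_length e * (LINT x|lebesgue_on (interior K). 2 * \<psi> x + broken_grad \<T> \<psi> x \<bullet> (x - a))"
    and "\<And>e. e \<in> bdry_edges \<Omega> \<T> \<Longrightarrow> edge_trace_integral \<T> e \<psi> = edge_trace_integral \<T> e gt"
proof -
  obtain P Q where P: "\<And>K. K \<in> \<T> \<Longrightarrow> P K \<in> polys 1" and Q: "\<And>K. K \<in> \<T> \<Longrightarrow> Q K \<in> polys 3"
    and PQ: "\<And>K. K \<in> \<T> \<Longrightarrow> AE x in lebesgue_on K. \<xi> x = P K x + Q K x"
    and Q0: "\<And>K x. K \<in> \<T> \<Longrightarrow> x \<in> frontier K \<Longrightarrow> Q K x = 0"
    and Pb: "\<And>K e. K \<in> \<T> \<Longrightarrow> e edge_of K \<Longrightarrow> e \<in> bdry_edges \<Omega> \<T> \<Longrightarrow> P K (edge_mid e) = 0"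
    and Pi: "\<And>K K' e. K \<in> \<T> \<Longrightarrow> K' \<in> \<T> \<Longrightarrow> e edge_of K \<Longrightarrow> e edge_of K' \<Longrightarrow> e \<in> int_edges \<Omega> \<T> \<Longrightarrow> P K (edge_mid e) = P K' (edge_mid e)"
    using N_space_rep[OF \<xi>] by blast
  obtain Dg where gtLp: "gt \<in> Lp (lebesgue_on \<Omega>) p" and Dg: "Dg \<in> Lp (lebesgue_on \<Omega>) p" and wg: "weak_gradient \<Omega> gt Dg"
    using gt by (auto simp: sobolev1_def)
  note igt = Lp_integrable[OF domain_open domain_bounded p gtLp] and iDg = Lp_integrable[OF domain_open domain_bounded p Dg]
  have "\<forall>K\<in>\<T>. \<exists>D. C1_with_gradient (\<lambda>x. P K x + Q K x) D"
  proof
    fix K assume K: "K \<in> \<T>"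
    obtain D1 D2 where "C1_with_gradient (P K) D1" "C1_with_gradient (Q K) D2" using polys_C1[OF P[OF K]] polys_C1[OF Q[OF K]] by blast
    then show "\<exists>D. C1_with_gradient (\<lambda>x. P K x + Q K x) D" using C1_with_gradient_add by blast
  qed
  then obtain DP where DP: "\<And>K. K \<in> \<T> \<Longrightarrow> C1_with_gradient (\<lambda>x. P K x + Q K x) (DP K)" by metis
  have cPQ: "continuous_on UNIV (\<lambda>x. P K x + Q K x)" "continuous_on UNIV (DP K)" if "K \<in> \<T>" for K
    using C1_with_gradient_continuous[OF DP[OF that]] by blast+
  have iPQ: "integrable (lebesgue_on (interior K)) (\<lambda>x. P K x + Q K x)" "integrable (lebesgue_on (interior K)) (DP K)" if "K \<in> \<T>" for K
    using cPQ[OF that] continuous_integrable_on_bounded_open[OF _ open_interior mesh_triangle_props(6)[OF that]] by blast+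
  have igtK: "integrable (lebesgue_on (interior K)) gt" "integrable (lebesgue_on (interior K)) Dg" if "K \<in> \<T>" for K
    using integrable_lebesgue_on_subset[OF igt domain_sets interior_sets interior_subset_domain[OF that]]
      integrable_lebesgue_on_subset[OF iDg domain_sets interior_sets interior_subset_domain[OF that]] by blast+
  have ae\<psi>: "AE x in lebesgue_on (interior K). P K x + Q K x + gt x = \<psi> x" if "K \<in> \<T>" for K
    using AE_interior_of_triangle[OF that PQ[OF that]] by eventually_elim (simp add: \<psi>)
  have wgK: "weak_gradient (interior K) gt Dg" if "K \<in> \<T>" for K
    by (rule weak_gradient_subset[OF domain_open open_interior interior_subset_domain[OF that] wg])
  have wg\<psi>: "weak_gradient (interior K) \<psi> (\<lambda>x. DP K x + Dg x)" if K: "K \<in> \<T>" for K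
    by (rule weak_gradient_AE[OF open_interior
          weak_gradient_add[OF open_interior C1_weak_gradient[OF open_interior DP[OF K]] wgK[OF K]] ae\<psi>[OF K]])
  note bg = broken_grad_AE(2)[OF _ wg\<psi>]
  show "broken_grad \<T> \<psi> \<in> Lp (lebesgue_on \<Omega>) p"
  proof (rule Lp_of_interiors)
    fix K assume K: "K \<in> \<T>"
    have "(\<lambda>x. DP K x + Dg x) \<in> Lp (lebesgue_on (interior K)) p"
      using p by (intro Lp_add Lp_continuous_bounded cPQ K open_interior mesh_triangle_props(6) Lp_interior Dg) auto
    then show "broken_grad \<T> \<psi> \<in> Lp (lebesgue_on (interior K)) p"
      by (rule Lp_AE[OF interior_sets _ bg[OF K K]])
  qed
  show i\<psi>: "integrable (lebesgue_on (interior K)) \<psi>" if K: "K \<in> \<T>" for K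
    by (rule integrable_lebesgue_on_AE[OF interior_sets Bochner_Integration.integrable_add[OF iPQ(1)[OF K] igtK(1)[OF K]] ae\<psi>[OF K]])
  have iD\<psi>: "integrable (lebesgue_on (interior K)) (\<lambda>x. DP K x + Dg x)" if K: "K \<in> \<T>" for K
    by (rule Bochner_Integration.integrable_add[OF iPQ(2)[OF K] igtK(2)[OF K]])
  show "integrable (lebesgue_on (interior K)) (broken_grad \<T> \<psi>)" if K: "K \<in> \<T>" for K
    by (rule integrable_lebesgue_on_AE[OF interior_sets iD\<psi>[OF K] bg[OF K K]])
  \<comment> \<open>The share of \<open>gt\<close> in the radial functional is kept apart: unlike
    the polynomial part, \<open>gt\<close> has no pointwise edge values.\<close>
  define R where "R K a = (LINT x|lebesgue_on (interior K). 2 * gt x + Dg x \<bullet> (x - a))" for K a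
  have split: "(LINT x|lebesgue_on (interior K). 2 * \<psi> x + (DP K x + Dg x) \<bullet> (x - a)) =
      (LINT x|lebesgue_on (interior K). 2 * (P K x + Q K x) + DP K x \<bullet> (x - a)) + R K a" if K: "K \<in> \<T>" for K a
  proof -
    note bo = mesh_triangle_props(6)[OF K] open_interior
    have "(LINT x|lebesgue_on (interior K). 2 * \<psi> x + (DP K x + Dg x) \<bullet> (x - a)) =
      (LINT x|lebesgue_on (interior K). (2 * (P K x + Q K x) + DP K x \<bullet> (x - a)) + (2 * gt x + Dg x \<bullet> (x - a)))"
    proof (rule integral_lebesgue_on_AE[OF interior_sets])
      show "AE x in lebesgue_on (interior K). 2 * \<psi> x + (DP K x + Dg x) \<bullet> (x - a) =
        (2 * (P K x + Q K x) + DP K x \<bullet> (x - a)) + (2 * gt x + Dg x \<bullet> (x - a))"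
        using ae\<psi>[OF K]
      proof eventually_elim
        case (elim x)
        then have "\<psi> x = P K x + Q K x + gt x" by simp
        then show ?case by (simp add: inner_add_left algebra_simps)
      qed
    qed
    also have "\<dots> = (LINT x|lebesgue_on (interior K). 2 * (P K x + Q K x) + DP K x \<bullet> (x - a)) + R K a"
      unfolding R_def
      by (rule Bochner_Integration.integral_add[OF radial_functional_integrable[OF bo iPQ[OF K]] radial_functional_integrable[OF bo igtK[OF K]]])
    finally show ?thesis .
  qed
  have ePQ: "edge_integral e (\<lambda>x. P K x + Q K x) = edge_length e * P K (edge_mid e)" if K: "K \<in> \<T>" "e edge_of K" for K e
  proof -
    obtain D1 D2 where C: "C1_with_gradient (P K) D1" "C1_with_gradient (Q K) D2" using polys_C1[OF P[OF K(1)]] polys_C1[OF Q[OF K(1)]] by blast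
    have "edge_integral e (\<lambda>x. P K x + Q K x) = edge_integral e (P K) + edge_integral e (Q K)"
      unfolding edge_integral_def
      by (simp add: Bochner_Integration.integral_add[OF C1_edge_path_integrable[OF C(1)] C1_edge_path_integrable[OF C(2)]] distrib_left)
    then show ?thesis
      using edge_integral_zero_frontier[OF K Q0[OF K(1)]] edge_integral_affine[OF P[OF K(1)], of e] by simp
  qed
  have tr: "edge_integral e (trace_on K \<psi>) = edge_length e * (P K (edge_mid e) + R K a / edge_det e a)"
    if K: "K \<in> \<T>" "e edge_of K" "apex_of K e a" for K e a
  proof -
    note dp = apex_edge_det_pos[OF K(3)]
    have "edge_det e a * edge_integral e (trace_on K \<psi>) = edge_length e * (LINT x|lebesgue_on (interior K). 2 * (P K x + Q K x) + DP K x \<bullet> (x - a)) + edge_length e * R K a"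
      unfolding edge_trace_radial[OF K wg\<psi>[OF K(1)] i\<psi>[OF K(1)] iD\<psi>[OF K(1)]] split[OF K(1)] by (rule distrib_left)
    also have "edge_length e * (LINT x|lebesgue_on (interior K). 2 * (P K x + Q K x) + DP K x \<bullet> (x - a)) = edge_det e a * (edge_length e * P K (edge_mid e))"
      using C1_edge_radial[OF K(3) DP[OF K(1)], symmetric] ePQ[OF K(1,2)] by simp
    also have "edge_det e a * (edge_length e * P K (edge_mid e)) + edge_length e * R K a = edge_det e a * (edge_length e * (P K (edge_mid e) + R K a / edge_det e a))"
      using dp by (simp add: field_simps)
    finally show ?thesis using dp by simp
  qed
  have same: "edge_integral e (trace_on K \<psi>) = edge_integral e (trace_on K' \<psi>)"
    if K: "K \<in> \<T>" "e edge_of K" and K': "K' \<in> \<T>" "e edge_of K'" for K K' e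
  proof (cases "K = K'")
    case False
    obtain a where a: "apex_of K e a" using edge_apex_exists[OF mesh_simplex[OF K(1)] K(2)] by blast
    obtain a' where a': "apex_of K' e a'" using edge_apex_exists[OF mesh_simplex[OF K'(1)] K'(2)] by blast
    \<comment> \<open>The polynomial parts agree by midpoint continuity, since a shared edge is an
      interior edge; the shares of \<open>gt\<close> agree by two-sided approximation within
      \<Omega>.\<close>
    have "P K (edge_mid e) = P K' (edge_mid e)"
      by (rule Pi[OF K(1) K'(1) K(2) K'(2) shared_edge_interior[OF K(1) K'(1) False K(2) K'(2)]])
    moreover have "R K a / edge_det e a = R K' a' / edge_det e a'"
      unfolding R_def
    proof (rule radial_two_sided[OF a a' interior_subset_domain[OF K(1)] interior_subset_domain[OF K'(1)] domain_open wg igt iDg])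
      fix x t :: _ assume x: "x \<in> K \<union> K'" and t: "0 < (t::real)" "t \<le> 1"
      show "(1 - t) *\<^sub>R x + t *\<^sub>R midpoint (fst (edge_ends e)) (snd (edge_ends e)) \<in> \<Omega>"
        using x shared_edge_star[OF K(1) K'(1) False a a' _ t] shared_edge_star[OF K'(1) K(1) False[symmetric] a' a _ t] by blast
    qed
    ultimately show ?thesis unfolding tr[OF K a] tr[OF K' a'] by simp
  qed simp
  have chosen: "(SOME K. K \<in> \<T> \<and> e edge_of K) \<in> \<T> \<and> e edge_of (SOME K. K \<in> \<T> \<and> e edge_of K)" if "e \<in> edges \<T>" for e
    using someI_ex[of "\<lambda>K. K \<in> \<T> \<and> e edge_of K"] edge_triangle[OF that] by blast
  show "edge_det e a * edge_trace_integral \<T> e \<psi> = edge_length e * (LINT x|lebesgue_on (interior K). 2 * \<psi> x + broken_grad \<T> \<psi> x \<bullet> (x - a))"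
    if K: "K \<in> \<T>" "e edge_of K" "apex_of K e a" for K e a
  proof -
    have e: "e \<in> edges \<T>" using K by (auto simp: edges_def)
    have "edge_trace_integral \<T> e \<psi> = edge_integral e (trace_on K \<psi>)"
      unfolding edge_trace_integral_def using same[OF _ _ K(1,2)] chosen[OF e] by blast
    moreover have "(LINT x|lebesgue_on (interior K). 2 * \<psi> x + (DP K x + Dg x) \<bullet> (x - a)) = (LINT x|lebesgue_on (interior K). 2 * \<psi> x + broken_grad \<T> \<psi> x \<bullet> (x - a))"
      by (rule integral_lebesgue_on_AE[OF interior_sets]) (use bg[OF K(1) K(1)] in \<open>eventually_elim, simp\<close>)
    ultimately show ?thesis using edge_trace_radial[OF K wg\<psi>[OF K(1)] i\<psi>[OF K(1)] iD\<psi>[OF K(1)]] by simp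
  qed
  \<comment> \<open>On a boundary edge the discrete part has midpoint value 0, so only
    \<open>gt\<close> is left; both sides refer to the same chosen triangle.\<close>
  show "edge_trace_integral \<T> e \<psi> = edge_trace_integral \<T> e gt" if e: "e \<in> bdry_edges \<Omega> \<T>" for e
  proof -
    define K where "K = (SOME K. K \<in> \<T> \<and> e edge_of K)"
    have K: "K \<in> \<T>" "e edge_of K" using chosen[of e] e by (auto simp: K_def bdry_edges_def)
    obtain a where a: "apex_of K e a" using edge_apex_exists[OF mesh_simplex[OF K(1)] K(2)] by blast
    have "edge_det e a * edge_integral e (trace_on K gt) = edge_length e * R K a"
      unfolding R_def by (rule edge_trace_radial[OF K a wgK[OF K(1)] igtK[OF K(1)]])
    then have "edge_integral e (trace_on K gt) = edge_length e * (R K a / edge_det e a)"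
      using apex_edge_det_pos[OF a] by (simp add: field_simps)
    then show ?thesis
      unfolding edge_trace_integral_def K_def[symmetric] tr[OF K a] Pb[OF K e] by simp
  qed
qed

text \<open>Inner points of an edge lie in the relative interior of that edge only, so one term of
  the sum survives; the two end points are a null set.\<close>

lemma proj_Lam_edge:
  assumes e: "e \<in> edges \<T>"
  shows "AE t in lebesgue_on {0..1}. proj_Lam \<T> \<phi> (edge_path e t) = edge_trace_integral \<T> e \<phi> / edge_length e"
proof -
  have pt: "proj_Lam \<T> \<phi> x = edge_trace_integral \<T> e \<phi> / edge_length e" if x: "x \<in> rel_interior e" for x
  proof -
    have "(\<Sum>e'\<in>edges \<T>. indicator (rel_interior e') x * (edge_trace_integral \<T> e' \<phi> / edge_length e')) =
      (\<Sum>e'\<in>{e}. indicator (rel_interior e') x * (edge_trace_integral \<T> e' \<phi> / edge_length e'))"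
      using rel_interior_edges_disjoint[OF e] x e finite_edges
      by (intro sum.mono_neutral_right) (auto simp: indicator_def)
    then show ?thesis using x by (simp add: proj_Lam_def)
  qed
  have "AE t::real in lebesgue. t \<noteq> 0 \<and> t \<noteq> 1"
    using AE_completion[OF AE_lborel_singleton[of "0::real"]] AE_completion[OF AE_lborel_singleton[of "1::real"]] by eventually_elim simp
  then have "AE t in lebesgue. t \<in> {0..1} \<longrightarrow> proj_Lam \<T> \<phi> (edge_path e t) = edge_trace_integral \<T> e \<phi> / edge_length e"
    by eventually_elim (auto intro!: pt edge_path_in_rel_interior[OF e])
  then show ?thesis by (subst AE_lebesgue_on_iff) auto
qed

lemma const_Lp_unit: "(\<lambda>_. c) \<in> Lp (lebesgue_on {0..1::real}) 2" for c :: real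
  by (auto simp: Lp_def)

lemma edge_integral_const:
  assumes "AE t in lebesgue_on {0..1}. l (edge_path e t) = c"
  shows "edge_integral e l = edge_length e * c" "edge_integrable e l"
proof -
  have "AE t in lebesgue_on {0..1::real}. c = l (edge_path e t)" using assms by eventually_elim simp
  note ae = this
  have "(LINT t|lebesgue_on {0..1}. l (edge_path e t)) = (LINT t|lebesgue_on {0..1::real}. c)"
    by (rule integral_lebesgue_on_AE[OF _ assms]) simp
  then show "edge_integral e l = edge_length e * c" by (simp add: edge_integral_def measure_restrict_space)
  have "integrable (lebesgue_on {0..1::real}) (\<lambda>_. c)" by simp
  then show "edge_integrable e l"
    unfolding edge_integrable_def by (rule integrable_lebesgue_on_AE[OF _ _ ae, rotated]) simp
qed

lemma proj_Lam_member:
  assumes g: "\<forall>e\<in>bdry_edges \<Omega> \<T>. edge_integrable e g"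
    and \<phi>: "\<forall>e\<in>bdry_edges \<Omega> \<T>. edge_trace_integral \<T> e \<phi> = edge_integral e g"
  shows "proj_Lam \<T> \<phi> \<in> Lam_space_bc \<Omega> \<T> g"
  unfolding Lam_space_bc_def mem_Collect_eq
proof (intro conjI ballI)
  show "proj_Lam \<T> \<phi> \<in> Lam_space \<T>"
    unfolding Lam_space_def mem_Collect_eq
  proof (intro ballI conjI)
    fix e assume e: "e \<in> edges \<T>"
    show "\<exists>c. AE t in lebesgue_on {0..1}. proj_Lam \<T> \<phi> (edge_path e t) = c" using proj_Lam_edge[OF e] by blast
    have "AE t in lebesgue_on {0..1::real}. edge_trace_integral \<T> e \<phi> / edge_length e = proj_Lam \<T> \<phi> (edge_path e t)"
      using proj_Lam_edge[OF e, of \<phi>] by eventually_elim simp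
    then show "(\<lambda>t. proj_Lam \<T> \<phi> (edge_path e t)) \<in> Lp (lebesgue_on {0..1}) 2"
      by (rule Lp_AE[OF _ const_Lp_unit, rotated]) simp
  qed
  fix e assume eb: "e \<in> bdry_edges \<Omega> \<T>"
  then have e: "e \<in> edges \<T>" by (simp add: bdry_edges_def)
  note c = edge_integral_const[of "proj_Lam \<T> \<phi>" e, OF proj_Lam_edge[OF e]]
  have "edge_integral e (\<lambda>x. proj_Lam \<T> \<phi> x - g x) = edge_integral e (proj_Lam \<T> \<phi>) - edge_integral e g"
    using c(2) g eb unfolding edge_integral_def edge_integrable_def by (simp add: right_diff_distrib)
  then show "edge_integral e (\<lambda>x. proj_Lam \<T> \<phi> x - g x) = 0"
    using c(1) edge_segment(3)[OF e] \<phi> eb by simp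
qed

lemma N_test_function:
  assumes l: "\<And>e. e \<in> bdry_edges \<Omega> \<T> \<Longrightarrow> l e = 0"
  obtains h P P' where "h \<in> N_space \<Omega> \<T>" "\<And>K. K \<in> \<T> \<Longrightarrow> C1_with_gradient (P K) (P' K)"
    "\<And>K. K \<in> \<T> \<Longrightarrow> AE x in lebesgue_on K. h x = P K x"
    "\<And>K. K \<in> \<T> \<Longrightarrow> (LINT x|lebesgue_on K. P K x) = m K"
    "\<And>K e. K \<in> \<T> \<Longrightarrow> e edge_of K \<Longrightarrow> edge_integral e (P K) = edge_length e * l e"
proof -
  have "\<forall>K\<in>\<T>. \<exists>\<phi>. \<phi> \<in> polys 1 \<and> (\<forall>e. e edge_of K \<longrightarrow> \<phi> (edge_mid e) = l e)"
    using triangle_midpoint_interpolation[OF mesh_simplex] by metis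
  then obtain A where A: "\<And>K. K \<in> \<T> \<Longrightarrow> A K \<in> polys 1" "\<And>K e. K \<in> \<T> \<Longrightarrow> e edge_of K \<Longrightarrow> A K (edge_mid e) = l e" by metis
  have "\<forall>K\<in>\<T>. \<exists>\<phi>. \<phi> \<in> polys 3 \<and> (\<forall>x\<in>frontier K. \<phi> x = 0) \<and> (LINT x|lebesgue_on (interior K). \<phi> x) = 1"
    using triangle_bubble[OF mesh_simplex] by metis
  then obtain B where B: "\<And>K. K \<in> \<T> \<Longrightarrow> B K \<in> polys 3" "\<And>K x. K \<in> \<T> \<Longrightarrow> x \<in> frontier K \<Longrightarrow> B K x = 0"
    "\<And>K. K \<in> \<T> \<Longrightarrow> (LINT x|lebesgue_on (interior K). B K x) = 1" by metis
  \<comment> \<open>The bubble \<open>B K\<close> has unit integral, so its coefficient is just what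
    the interpolant lacks to reach m K.\<close>
  define s where "s K = m K - (LINT x|lebesgue_on K. A K x)" for K
  define P where "P K x = A K x + s K * B K x" for K x
  have bp: "(\<lambda>x. s K * B K x) \<in> polys 3" if "K \<in> \<T>" for K using polys_scale[OF B(1)[OF that]] .
  have "\<forall>K\<in>\<T>. \<exists>D. C1_with_gradient (P K) D"
  proof
    fix K assume K: "K \<in> \<T>"
    obtain D1 D2 where "C1_with_gradient (A K) D1" "C1_with_gradient (\<lambda>x. s K * B K x) D2" using polys_C1[OF A(1)[OF K]] polys_C1[OF bp[OF K]] by blast
    then show "\<exists>D. C1_with_gradient (P K) D" unfolding P_def[abs_def] using C1_with_gradient_add by blast
  qed
  then obtain P' where P': "\<And>K. K \<in> \<T> \<Longrightarrow> C1_with_gradient (P K) (P' K)" by metis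
  define h where "h x = piecewise \<T> A x + piecewise \<T> (\<lambda>K x. s K * B K x) x" for x
  have "piecewise \<T> A \<in> CR_space \<Omega> \<T>" by (rule CR_member[OF A l])
  moreover have "piecewise \<T> (\<lambda>K x. s K * B K x) \<in> bubble_space \<Omega> \<T>" by (rule bubble_member) (use bp B(2) in auto)
  ultimately have hN: "h \<in> N_space \<Omega> \<T>" unfolding N_space_def h_def[abs_def] by blast
  show thesis
  proof (rule that[OF hN P'])
    fix K assume K: "K \<in> \<T>"
    show "AE x in lebesgue_on K. h x = P K x"
      using piecewise_AE[OF K, of A] piecewise_AE[OF K, of "\<lambda>K x. s K * B K x"] by eventually_elim (simp add: h_def P_def)
    note int = continuous_integrable_on_bounded_open[OF _ open_interior mesh_triangle_props(6)[OF K]]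
    have iA: "integrable (lebesgue_on (interior K)) (A K)" and iB: "integrable (lebesgue_on (interior K)) (B K)"
      using polys_C1[OF A(1)[OF K]] polys_C1[OF B(1)[OF K]] int C1_with_gradient_continuous(1) by blast+
    show "(LINT x|lebesgue_on K. P K x) = m K"
      unfolding P_def integral_triangle_interior(1)[OF K] using iA iB B(3)[OF K] by (simp add: s_def integral_triangle_interior(1)[OF K])
    fix e assume e: "e edge_of K"
    obtain D1 D2 where C: "C1_with_gradient (A K) D1" "C1_with_gradient (\<lambda>x. s K * B K x) D2" using polys_C1[OF A(1)[OF K]] polys_C1[OF bp[OF K]] by blast
    have "edge_integral e (P K) = edge_integral e (A K) + edge_integral e (\<lambda>x. s K * B K x)"
      unfolding edge_integral_def P_def
      by (subst Bochner_Integration.integral_add[OF C1_edge_path_integrable[OF C(1)] C1_edge_path_integrable[OF C(2)]]) (rule distrib_left)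
    also have "edge_integral e (\<lambda>x. s K * B K x) = 0"
      by (rule edge_integral_zero_frontier[OF K e]) (use B(2)[OF K] in simp)
    finally show "edge_integral e (P K) = edge_length e * l e"
      using edge_integral_affine[OF A(1)[OF K], of e] A(2)[OF K e] by simp
  qed
qed

end

section \<open>From the nonconforming to the hybridized problem\<close>

theorem lemma3p2:
  fixes \<Omega> :: "pt set" and \<T> :: "pt set set"
    and r r' s s' :: real
    and R :: "(pt \<Rightarrow> real) \<Rightarrow> (pt \<Rightarrow> real)"
    and G :: "(pt \<Rightarrow> pt) \<Rightarrow> (pt \<Rightarrow> pt)"
    and f :: "(pt \<Rightarrow> real) \<Rightarrow> real"
    and g gt \<psi> :: "pt \<Rightarrow> real"
    and PW :: "(pt \<Rightarrow> pt) \<Rightarrow> (pt \<Rightarrow> pt)"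
    and u :: "pt \<Rightarrow> pt" and p \<mu> :: "pt \<Rightarrow> real"
  assumes domain: "polygonal_domain \<Omega>"
    and mesh: "conforming_mesh \<Omega> \<T>"
    and exponents: "1 < r" "1 < s" "1 / r + 1 / r' = 1" "1 / s + 1 / s' = 1"
    and R_cont: "Lp_continuous (lebesgue_on \<Omega>) r r' R"
    and G_cont: "Lp_continuous (lebesgue_on \<Omega>) s s' G"
    and G_coercive: "Lp_coercive (lebesgue_on \<Omega>) s G"
    and G_monotone: "Lp_strictly_monotone (lebesgue_on \<Omega>) s G"
    and G_bijective: "Lp_bijective (lebesgue_on \<Omega>) s s' G"
    and f_linear: "Lp_linear_form (lebesgue_on \<Omega>) r f"
    and g_L1: "\<forall>e\<in>bdry_edges \<Omega> \<T>. edge_integrable e g"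
    and gt_sobolev: "gt \<in> sobolev1 \<Omega> s'"
    and gt_bdry: "\<forall>e\<in>bdry_edges \<Omega> \<T>. edge_trace_integral \<T> e gt = edge_integral e g"
    and PW: "is_W_projection \<Omega> \<T> s G PW"
    and G_odd: "\<forall>v \<in> Lp (lebesgue_on \<Omega>) s. AE x in lebesgue_on \<Omega>. G (\<lambda>y. - v y) x = - G v x"
    and psi: "nonconforming_solution \<Omega> \<T> s R G PW f gt \<psi>"
    and u_def: "u = (\<lambda>x. - PW (Lp_inverse (lebesgue_on \<Omega>) s G (broken_grad \<T> \<psi>)) x)"
    and p_mu_def: "(p, \<mu>) = S_map \<T> \<psi>"
  shows "hybrid_solution \<Omega> \<T> r s R G f g u p \<mu>"
proof -
  interpret mesh_domain \<Omega> \<T> using domain mesh by unfold_locales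
  \<comment> \<open>With an exponent of at least 1, \<open>gt\<close> and its weak gradient are
    integrable on the bounded domain, so the W^{1,1} theory of traces covers them.\<close>
  have s': "1 \<le> s'"
  proof -
    have "1 / s' = 1 - 1 / s" using exponents(4) by simp
    moreover have "0 < 1 / s" "1 / s < 1" using exponents(2) by auto
    ultimately have "0 < 1 / s'" "1 / s' < 1" by auto
    then show ?thesis by (simp add: divide_less_eq split: if_splits)
  qed
  have p: "p = proj_Q \<T> \<psi>" and \<mu>: "\<mu> = proj_Lam \<T> \<psi>" using p_mu_def by (auto simp: S_map_def)
  obtain \<xi> where \<xi>: "\<xi> \<in> N_space \<Omega> \<T>" and \<psi>: "\<psi> = (\<lambda>x. \<xi> x + gt x)"
    using psi unfolding nonconforming_solution_def by blast
  note el = shifted_N_element[OF \<xi> gt_sobolev s' \<psi>]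
  define w0 where "w0 = Lp_inverse (lebesgue_on \<Omega>) s G (broken_grad \<T> \<psi>)"
  define w where "w = PW w0"
  \<comment> \<open>The broken gradient lies in the target space of \<open>G\<close>, so the choice
    made by \<open>Lp_inverse\<close> has a witness.\<close>
  have "\<exists>v. v \<in> Lp (lebesgue_on \<Omega>) s \<and> (AE x in lebesgue_on \<Omega>. G v x = broken_grad \<T> \<psi> x)"
    using G_bijective el(1) unfolding Lp_bijective_def by blast
  then have w0: "w0 \<in> Lp (lebesgue_on \<Omega>) s" "AE x in lebesgue_on \<Omega>. G w0 x = broken_grad \<T> \<psi> x"
    using someI_ex[of "\<lambda>v. v \<in> Lp (lebesgue_on \<Omega>) s \<and> (AE x in lebesgue_on \<Omega>. G v x = broken_grad \<T> \<psi> x)"]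
    unfolding w0_def Lp_inverse_def by blast+
  have w: "w \<in> W_space \<Omega> \<T> s" and aw: "\<And>v. v \<in> W_space \<Omega> \<T> s \<Longrightarrow> a_form \<Omega> G w v = a_form \<Omega> G w0 v"
    using PW w0(1) unfolding is_W_projection_def w_def by blast+
  have u: "u = (\<lambda>x. - w x)" by (simp add: u_def w_def w0_def)
  have uW: "u \<in> W_space \<Omega> \<T> s" unfolding u by (rule W_uminus(1)[OF w])
  have N: "c_form \<Omega> R p (proj_Q \<T> h) + (\<Sum>K\<in>\<T>. LINT x|lebesgue_on K. w x \<bullet> broken_grad \<T> h x) = f (proj_Q \<T> h)"
    if "h \<in> N_space \<Omega> \<T>" for h
    using psi that unfolding nonconforming_solution_def p w_def w0_def by blast
  have r0: "0 < r" using exponents(1) by simp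
  note pQ = proj_Q_member[OF r0, of \<psi>, folded p]
  have eq1: "a_form \<Omega> G u v - div_form \<T> v p + skeleton_form \<T> \<mu> v = 0" if v: "v \<in> W_space \<Omega> \<T> s" for v
  proof -
    \<comment> \<open>After summation over the triangles, the left side becomes the skeleton term
      with \<mu>, the first term on the right the divergence term with \<open>p\<close>, and the
      last one minus the form \<open>a\<close>.\<close>
    have green: "(\<Sum>e | e edge_of K. edge_trace_integral \<T> e \<psi> * flux K e v) =
        div_on K v * (LINT x|lebesgue_on K. \<psi> x) + (LINT x|lebesgue_on K. broken_grad \<T> \<psi> x \<bullet> v x)"
      "integrable (lebesgue_on K) (\<lambda>x. broken_grad \<T> \<psi> x \<bullet> v x)" if K: "K \<in> \<T>" for K
      using W_green[OF v K el(2)[OF K] el(3)[OF K] el(4)[OF K]] by blast+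
    have "w \<in> Lp (lebesgue_on \<Omega>) s" using w by (simp add: W_space_def)
    \<comment> \<open>By oddness the minus sign in the definition of \<open>u\<close> passes through
      \<open>G\<close>, which gives the gradient term the sign required by the first
      equation.\<close>
    then have odd: "AE x in lebesgue_on \<Omega>. G u x = - G w x" using G_odd unfolding u by blast
    have "a_form \<Omega> G u v = (LINT x|lebesgue_on \<Omega>. - (G w x \<bullet> v x))"
      unfolding a_form_def by (rule integral_lebesgue_on_AE[OF domain_sets]) (use odd in \<open>eventually_elim, simp\<close>)
    also have "\<dots> = - a_form \<Omega> G w0 v" using aw[OF v] by (simp add: a_form_def)
    also have "a_form \<Omega> G w0 v = (LINT x|lebesgue_on \<Omega>. broken_grad \<T> \<psi> x \<bullet> v x)"
      unfolding a_form_def by (rule integral_lebesgue_on_AE[OF domain_sets]) (use w0(2) in \<open>eventually_elim, simp\<close>)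
    also have "\<dots> = (\<Sum>K\<in>\<T>. LINT x|lebesgue_on K. broken_grad \<T> \<psi> x \<bullet> v x)"
      by (rule integral_domain_split(1)[OF green(2)])
    finally have a: "a_form \<Omega> G u v = - (\<Sum>K\<in>\<T>. LINT x|lebesgue_on K. broken_grad \<T> \<psi> x \<bullet> v x)" .
    \<comment> \<open>Divergences are constant on triangles, so only the cell integrals of
      \<open>p\<close> matter, and these are the ones of \<psi>.\<close>
    have "div_form \<T> v p = (\<Sum>K\<in>\<T>. div_on K v * (LINT x|lebesgue_on K. \<psi> x))"
      unfolding div_form_eq[OF v]
    proof (rule sum.cong[OF refl])
      fix K assume K: "K \<in> \<T>"
      show "div_on K v * (LINT x|lebesgue_on K. p x) = div_on K v * (LINT x|lebesgue_on K. \<psi> x)"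
        unfolding p integral_const_triangle[OF K proj_Q_AE[OF K]] using measure_triangle_pos[OF K] by simp
    qed
    moreover have "skeleton_form \<T> \<mu> v = (\<Sum>K\<in>\<T>. \<Sum>e | e edge_of K. edge_trace_integral \<T> e \<psi> * flux K e v)"
    proof -
      have "skeleton_form \<T> \<mu> v = (\<Sum>K\<in>\<T>. \<Sum>e | e edge_of K. edge_trace_integral \<T> e \<psi> / edge_length e * edge_length e * flux K e v)"
        unfolding \<mu> by (rule skeleton_form_eq[OF v proj_Lam_edge])
      also have "\<dots> = (\<Sum>K\<in>\<T>. \<Sum>e | e edge_of K. edge_trace_integral \<T> e \<psi> * flux K e v)"
      proof (intro sum.cong refl)
        fix K e assume "K \<in> \<T>" "e \<in> {e. e edge_of K}"
        then have "e \<in> edges \<T>" by (auto simp: edges_def)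
        then show "edge_trace_integral \<T> e \<psi> / edge_length e * edge_length e * flux K e v = edge_trace_integral \<T> e \<psi> * flux K e v"
          using edge_segment(3)[of e] by simp
      qed
      finally show ?thesis .
    qed
    ultimately show ?thesis using a green(1) by (simp add: sum.distrib)
  qed
  have eq2: "c_form \<Omega> R p q + div_form \<T> u q = f q" if q: "q \<in> Q_space \<Omega> \<T> r" for q
  proof -
    have "\<forall>K\<in>\<T>. \<exists>c. AE x in lebesgue_on K. q x = c"
    proof
      fix K assume "K \<in> \<T>"
      then have "in_on (polys 0) K q" using q by (simp add: Q_space_def)
      then show "\<exists>c. AE x in lebesgue_on K. q x = c" unfolding in_on_def polys_0 by auto
    qed
    then obtain c where c: "\<And>K. K \<in> \<T> \<Longrightarrow> AE x in lebesgue_on K. q x = c K" by metis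
    \<comment> \<open>Zero edge values and cell integrals c K |K| give a test function whose cell
      projection equals \<open>q\<close> almost everywhere.\<close>
    obtain h P P' where h: "h \<in> N_space \<Omega> \<T>" and P: "\<And>K. K \<in> \<T> \<Longrightarrow> C1_with_gradient (P K) (P' K)"
      and hP: "\<And>K. K \<in> \<T> \<Longrightarrow> AE x in lebesgue_on K. h x = P K x"
      and mP: "\<And>K. K \<in> \<T> \<Longrightarrow> (LINT x|lebesgue_on K. P K x) = c K * measure lebesgue K"
      and eP: "\<And>K e. K \<in> \<T> \<Longrightarrow> e edge_of K \<Longrightarrow> edge_integral e (P K) = edge_length e * 0"
      using N_test_function[of "\<lambda>_. 0" "\<lambda>K. c K * measure lebesgue K"] by auto
    have mh: "(LINT x|lebesgue_on K. h x) = c K * measure lebesgue K" if K: "K \<in> \<T>" for K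
      using integral_lebesgue_on_AE[OF mesh_triangle_props(3)[OF K] hP[OF K]] mP[OF K] by simp
    have qh: "AE x in lebesgue_on \<Omega>. proj_Q \<T> h x = q x"
    proof (rule AE_domain_of_triangles)
      fix K assume K: "K \<in> \<T>"
      show "AE x in lebesgue_on K. proj_Q \<T> h x = q x"
        using proj_Q_AE[OF K, of h] c[OF K] by eventually_elim (use mh[OF K] measure_triangle_pos[OF K] in simp)
    qed
    have "c_form \<Omega> R p (proj_Q \<T> h) = c_form \<Omega> R p q"
      unfolding c_form_def by (rule integral_lebesgue_on_AE[OF domain_sets]) (use qh in \<open>eventually_elim, simp\<close>)
    \<comment> \<open>The projection agrees with \<open>q\<close> only almost everywhere;
      \<open>Lp_linear_form\<close> includes compatibility of \<open>f\<close> with such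
      equality.\<close>
    moreover have "f (proj_Q \<T> h) = f q"
      using f_linear qh proj_Q_member[OF r0, of h] q unfolding Lp_linear_form_def Q_space_def by blast
    moreover have "(\<Sum>K\<in>\<T>. LINT x|lebesgue_on K. w x \<bullet> broken_grad \<T> h x) = div_form \<T> u q"
      unfolding div_form_eq[OF uW]
    proof (rule sum.cong[OF refl])
      fix K assume K: "K \<in> \<T>"
      \<comment> \<open>No edge term is left, so Green's formula produces minus the divergence of
        \<open>w\<close>, which is the divergence of \<open>u\<close>.\<close>
      have "(LINT x|lebesgue_on K. w x \<bullet> broken_grad \<T> h x) = - (div_on K w * (c K * measure lebesgue K))"
        unfolding W_green_C1[OF w K P[OF K] hP[OF K]] mP[OF K] using eP[OF K] by simp
      then show "(LINT x|lebesgue_on K. w x \<bullet> broken_grad \<T> h x) = div_on K u * (LINT x|lebesgue_on K. q x)"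
        unfolding integral_const_triangle[OF K c[OF K]] u W_uminus(3)[OF w K] by simp
    qed
    ultimately show ?thesis using N[OF h] by simp
  qed
  have eq3: "skeleton_form \<T> l u = 0" if l: "l \<in> Lam_space_bc \<Omega> \<T> (\<lambda>_. 0)" for l
  proof -
    have "\<forall>e\<in>edges \<T>. \<exists>c. AE t in lebesgue_on {0..1}. l (edge_path e t) = c"
      using l by (auto simp: Lam_space_bc_def Lam_space_def)
    then obtain c where c: "\<And>e. e \<in> edges \<T> \<Longrightarrow> AE t in lebesgue_on {0..1}. l (edge_path e t) = c e" by metis
    \<comment> \<open>The homogeneous boundary condition on \<open>l\<close> is what allows its edge
      values to be those of a function in the nonconforming space.\<close>
    have c0: "c e = 0" if e: "e \<in> bdry_edges \<Omega> \<T>" for e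
    proof -
      have ee: "e \<in> edges \<T>" using e by (simp add: bdry_edges_def)
      have "edge_integral e l = 0" using l e by (simp add: Lam_space_bc_def)
      then show ?thesis using edge_integral_const(1)[OF c[OF ee]] edge_segment(3)[OF ee] by simp
    qed
    \<comment> \<open>With zero cell integrals the terms with \<open>R\<close> and \<open>f\<close>
      disappear from (N), which then consists of edge terms alone.\<close>
    obtain h P P' where h: "h \<in> N_space \<Omega> \<T>" and P: "\<And>K. K \<in> \<T> \<Longrightarrow> C1_with_gradient (P K) (P' K)"
      and hP: "\<And>K. K \<in> \<T> \<Longrightarrow> AE x in lebesgue_on K. h x = P K x"
      and mP: "\<And>K. K \<in> \<T> \<Longrightarrow> (LINT x|lebesgue_on K. P K x) = 0"
      and eP: "\<And>K e. K \<in> \<T> \<Longrightarrow> e edge_of K \<Longrightarrow> edge_integral e (P K) = edge_length e * c e"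
      using N_test_function[of c "\<lambda>_. 0"] c0 by auto
    have mh: "(LINT x|lebesgue_on K. h x) = 0" if K: "K \<in> \<T>" for K
      using integral_lebesgue_on_AE[OF mesh_triangle_props(3)[OF K] hP[OF K]] mP[OF K] by simp
    have Q0: "proj_Q \<T> h = (\<lambda>_. 0)" unfolding proj_Q_def using mh by simp
    have "(\<lambda>_. 0) \<in> Lp (lebesgue_on \<Omega>) r" by (simp add: Lp_def)
    then have f0: "f (\<lambda>_. 0) = 0"
      using f_linear[unfolded Lp_linear_form_def, THEN conjunct1, rule_format, of "\<lambda>_. 0" "\<lambda>_. 0" 0 0] by simp
    have "(\<Sum>K\<in>\<T>. LINT x|lebesgue_on K. w x \<bullet> broken_grad \<T> h x) = 0"
      using N[OF h] by (simp add: Q0 f0 c_form_def)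
    moreover have "(LINT x|lebesgue_on K. w x \<bullet> broken_grad \<T> h x) = (\<Sum>e | e edge_of K. c e * edge_length e * flux K e w)" if K: "K \<in> \<T>" for K
      unfolding W_green_C1[OF w K P[OF K] hP[OF K]] mP[OF K] using eP[OF K] by (simp add: mult.commute)
    moreover have "skeleton_form \<T> l u = - (\<Sum>K\<in>\<T>. \<Sum>e | e edge_of K. c e * edge_length e * flux K e w)"
      using skeleton_form_eq[OF uW c] by (simp add: u W_uminus(2)[OF w] sum_negf)
    ultimately show ?thesis by simp
  qed
  \<comment> \<open>On boundary edges the edge integrals of \<psi> are those of \<open>gt\<close>,
    and these are prescribed to be those of \<open>g\<close>.\<close>
  have "\<mu> \<in> Lam_space_bc \<Omega> \<T> g"
    unfolding \<mu> using el(5) gt_bdry by (intro proj_Lam_member[OF g_L1]) simp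
  then show ?thesis
    unfolding hybrid_solution_def using uW pQ eq1 eq2 eq3 by blast
qed

end
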